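(* For every $U^0\in\mathcal{M}^N$, the evolution problem $$\frac{\mathrm{d}U}{\mathrm{d}t} = - U \langle \mathcal{G} U, U \rangle + \mathcal{G} U\langle U, U \rangle, \qquad U(0) = U^0,$$ admits a unique global solution $U \in C^1([0,\infty); [H_0^1(\Omega)]^N)$.
   Context: Let $d,N\geqslant 1$ be integers and $\Omega\subset\mathbb{R}^d$ a bounded domain; all functions are real-valued. $(u,v)=\int_\Omega uv$ is the $L^2(\Omega)$ inner product and $\|\cdot\|$ its norm. $\mathcal{V}:\Omega\to\mathbb{R}$ is a potential such that $a(u,v)=\int_\Omega(\nabla u\cdot\nabla v+\mathcal{V}uv)$ is an inner product on $H_0^1(\Omega)$ and there are constants $c_1,c_2>0$ with $c_1\|\nabla u\|^2\leqslant a(u,u)\leqslant c_2\|\nabla u\|^2$ for all $u\in H_0^1(\Omega)$. The operator $\mathcal{G}=(-\Delta+\mathcal{V})^{-1}:H^{-1}(\Omega)\to H_0^1(\Omega)$ is defined by $a(\mathcal{G}f,v)=f(v)$ for all $v\in H_0^1(\Omega)$ (with $f(v)=(f,v)$ if $f\in L^2(\Omega)$), and acts componentwise on $N$-tuples. For $N$-tuples $U=(u_1,\dots,u_N)$, $V=(v_1,\dots,v_N)$, $\langle U,V\rangle\in\mathbb{R}^{N\times N}$ is the matrix with entries $(u_i,v_j)$. For $Q=(q_{ij})\in\mathbb{R}^{N\times N}$, $UQ$ is the $N$-tuple with $(UQ)_k=\sum_{i}u_iq_{ik}$. $\mathcal{M}^N=\{U\in[H_0^1(\Omega)]^N:\langle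 U,U\rangle=I_N\}$. *)

theory Defs
  imports "HOL-Analysis.Analysis"
begin

text \<open>
  Elements of \<open>L\<^sup>2(\<Omega>)\<close>, \<open>H\<^sup>1(\<Omega>)\<close> and \<open>H\<^sup>1\<^sub>0(\<Omega>)\<close> are represented by functions on the whole of
  \<open>\<real>\<^sup>d\<close>, of which only the restriction to \<open>\<Omega>\<close> matters, and which are identified when they agree
  almost everywhere on \<open>\<Omega>\<close>. Norms, pairings, weak gradients and membership respect this
  identification.
\<close>

section \<open>Sobolev spaces\<close>

definition L2 :: "(real^'d) set \<Rightarrow> (real^'d \<Rightarrow> real) set" where
  "L2 \<Omega> = {u \<in> borel_measurable (lebesgue_on \<Omega>). integrable (lebesgue_on \<Omega>) (\<lambda>x. (u x)\<^sup>2)}"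

definition L2_inner :: "(real^'d) set \<Rightarrow> (real^'d \<Rightarrow> real) \<Rightarrow> (real^'d \<Rightarrow> real) \<Rightarrow> real" where
  "L2_inner \<Omega> u v = (LINT x|lebesgue_on \<Omega>. u x * v x)"

definition L2_norm :: "(real^'d) set \<Rightarrow> (real^'d \<Rightarrow> real) \<Rightarrow> real" where
  "L2_norm \<Omega> u = sqrt (L2_inner \<Omega> u u)"

definition ae_eq :: "(real^'d) set \<Rightarrow> (real^'d \<Rightarrow> real) \<Rightarrow> (real^'d \<Rightarrow> real) \<Rightarrow> bool" where
  "ae_eq \<Omega> u v \<longleftrightarrow> (AE x in lebesgue_on \<Omega>. u x = v x)"

definition partial :: "'d::finite \<Rightarrow> (real^'d \<Rightarrow> real) \<Rightarrow> real^'d \<Rightarrow> real" where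
  "partial i f x = frechet_derivative f (at x) (axis i 1)"

fun iter_partial :: "'d::finite list \<Rightarrow> (real^'d \<Rightarrow> real) \<Rightarrow> real^'d \<Rightarrow> real" where
  "iter_partial [] f = f"
| "iter_partial (i # is) f = partial i (iter_partial is f)"

text \<open>\<open>C\<^sup>\<infinity>\<close>: differentiability of the partial derivatives of every order already forces them all to
  be continuous.\<close>

definition smooth :: "(real^'d::finite \<Rightarrow> real) \<Rightarrow> bool" where
  "smooth f \<longleftrightarrow> (\<forall>is x. iter_partial is f differentiable (at x))"

definition test_functions :: "(real^'d::finite) set \<Rightarrow> (real^'d \<Rightarrow> real) set" where
  "test_functions \<Omega> =
     {\<phi>. smooth \<phi> \<and> compact (closure {x. \<phi> x \<noteq> 0}) \<and> closure {x. \<phi> x \<noteq> 0} \<subseteq> \<Omega>}"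

definition is_weak_grad ::
    "(real^'d::finite) set \<Rightarrow> (real^'d \<Rightarrow> real) \<Rightarrow> (real^'d \<Rightarrow> real^'d) \<Rightarrow> bool" where
  "is_weak_grad \<Omega> u g \<longleftrightarrow>
     (\<forall>i. (\<lambda>x. g x $ i) \<in> L2 \<Omega>) \<and>
     (\<forall>\<phi>\<in>test_functions \<Omega>. \<forall>i. L2_inner \<Omega> u (partial i \<phi>) = - L2_inner \<Omega> (\<lambda>x. g x $ i) \<phi>)"

definition H1 :: "(real^'d::finite) set \<Rightarrow> (real^'d \<Rightarrow> real) set" where
  "H1 \<Omega> = {u \<in> L2 \<Omega>. \<exists>g. is_weak_grad \<Omega> u g}"

text \<open>For \<open>u \<in> H\<^sup>1(\<Omega>)\<close> the weak gradient exists and is unique up to null sets of \<open>\<Omega>\<close>.\<close>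

definition grad :: "(real^'d::finite) set \<Rightarrow> (real^'d \<Rightarrow> real) \<Rightarrow> real^'d \<Rightarrow> real^'d" where
  "grad \<Omega> u = (SOME g. is_weak_grad \<Omega> u g)"

definition grad_norm :: "(real^'d::finite) set \<Rightarrow> (real^'d \<Rightarrow> real) \<Rightarrow> real" where
  "grad_norm \<Omega> u = L2_norm \<Omega> (\<lambda>x. norm (grad \<Omega> u x))"

definition H1_norm :: "(real^'d::finite) set \<Rightarrow> (real^'d \<Rightarrow> real) \<Rightarrow> real" where
  "H1_norm \<Omega> u = sqrt ((L2_norm \<Omega> u)\<^sup>2 + (grad_norm \<Omega> u)\<^sup>2)"

definition H10 :: "(real^'d::finite) set \<Rightarrow> (real^'d \<Rightarrow> real) set" where
  "H10 \<Omega> = {u \<in> H1 \<Omega>. \<forall>\<epsilon>>0. \<exists>\<phi>\<in>test_functions \<Omega>. H1_norm \<Omega> (\<lambda>x. u x - \<phi> x) < \<epsilon>}"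


section \<open>The energy form and the operator \<open>\<G>\<close>\<close>

definition energy_integrand ::
    "(real^'d::finite) set \<Rightarrow> (real^'d \<Rightarrow> real) \<Rightarrow> (real^'d \<Rightarrow> real) \<Rightarrow> (real^'d \<Rightarrow> real)
      \<Rightarrow> real^'d \<Rightarrow> real" where
  "energy_integrand \<Omega> \<V> u v x = grad \<Omega> u x \<bullet> grad \<Omega> v x + \<V> x * u x * v x"

definition energy_form ::
    "(real^'d::finite) set \<Rightarrow> (real^'d \<Rightarrow> real) \<Rightarrow> (real^'d \<Rightarrow> real) \<Rightarrow> (real^'d \<Rightarrow> real) \<Rightarrow> real" where
  "energy_form \<Omega> \<V> u v = (LINT x|lebesgue_on \<Omega>. energy_integrand \<Omega> \<V> u v x)"

definition inner_product_on_H10 ::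
    "(real^'d::finite) set \<Rightarrow> ((real^'d \<Rightarrow> real) \<Rightarrow> (real^'d \<Rightarrow> real) \<Rightarrow> real) \<Rightarrow> bool" where
  "inner_product_on_H10 \<Omega> a \<longleftrightarrow>
     (\<forall>u\<in>H10 \<Omega>. \<forall>v\<in>H10 \<Omega>. a u v = a v u) \<and>
     (\<forall>u\<in>H10 \<Omega>. \<forall>v\<in>H10 \<Omega>. \<forall>w\<in>H10 \<Omega>. a (\<lambda>x. u x + v x) w = a u w + a v w) \<and>
     (\<forall>u\<in>H10 \<Omega>. \<forall>v\<in>H10 \<Omega>. \<forall>r. a (\<lambda>x. r * u x) v = r * a u v) \<and>
     (\<forall>u\<in>H10 \<Omega>. 0 \<le> a u u \<and> (a u u = 0 \<longrightarrow> ae_eq \<Omega> u (\<lambda>_. 0)))"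

text \<open>The potential is admissible if the integral defining \<open>a(u,v)\<close> converges on \<open>H\<^sup>1\<^sub>0(\<Omega>)\<close> (a
  divergent integral would silently be \<open>0\<close>) and \<open>a\<close> is an inner product there.\<close>

definition admissible_potential :: "(real^'d::finite) set \<Rightarrow> (real^'d \<Rightarrow> real) \<Rightarrow> bool" where
  "admissible_potential \<Omega> \<V> \<longleftrightarrow>
     (\<forall>u\<in>H10 \<Omega>. \<forall>v\<in>H10 \<Omega>. integrable (lebesgue_on \<Omega>) (energy_integrand \<Omega> \<V> u v)) \<and>
     inner_product_on_H10 \<Omega> (energy_form \<Omega> \<V>)"

text \<open>\<open>\<G>\<close> acts on functionals on \<open>H\<^sup>1\<^sub>0(\<Omega>)\<close>; the defining property determines \<open>\<G> f\<close> (up to null sets)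
  when \<open>f\<close> is in \<open>H\<^sup>-\<^sup>1(\<Omega>)\<close>, the space of bounded linear functionals.\<close>

definition solution_op ::
    "(real^'d::finite) set \<Rightarrow> (real^'d \<Rightarrow> real) \<Rightarrow> ((real^'d \<Rightarrow> real) \<Rightarrow> real) \<Rightarrow> real^'d \<Rightarrow> real" where
  "solution_op \<Omega> \<V> f =
     (SOME w. w \<in> H10 \<Omega> \<and> (\<forall>v\<in>H10 \<Omega>. energy_form \<Omega> \<V> w v = f v))"


section \<open>Tuples of functions\<close>

type_synonym ('d, 'n) tuple = "'n \<Rightarrow> real^'d \<Rightarrow> real"

text \<open>\<open>L\<^sup>2(\<Omega>)\<close> is embedded in \<open>H\<^sup>-\<^sup>1(\<Omega>)\<close> by \<open>u \<mapsto> (u, \<cdot>)\<close>.\<close>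

definition solution_op_tuple ::
    "(real^'d::finite) set \<Rightarrow> (real^'d \<Rightarrow> real) \<Rightarrow> ('d, 'n) tuple \<Rightarrow> ('d, 'n) tuple" where
  "solution_op_tuple \<Omega> \<V> U = (\<lambda>k. solution_op \<Omega> \<V> (L2_inner \<Omega> (U k)))"

definition outer ::
    "(real^'d) set \<Rightarrow> ('d, 'n) tuple \<Rightarrow> ('d, 'n) tuple \<Rightarrow> real^'n^'n" where
  "outer \<Omega> U V = (\<chi> i j. L2_inner \<Omega> (U i) (V j))"

definition tuple_mult :: "('d, 'n::finite) tuple \<Rightarrow> real^'n^'n \<Rightarrow> ('d, 'n) tuple" where
  "tuple_mult U Q = (\<lambda>k x. \<Sum>i\<in>UNIV. U i x * Q $ i $ k)"

definition H10_tuples :: "(real^'d::finite) set \<Rightarrow> ('d, 'n) tuple set" where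
  "H10_tuples \<Omega> = {U. \<forall>k. U k \<in> H10 \<Omega>}"

definition tuple_norm :: "(real^'d::finite) set \<Rightarrow> ('d, 'n::finite) tuple \<Rightarrow> real" where
  "tuple_norm \<Omega> U = sqrt (\<Sum>k\<in>UNIV. (H1_norm \<Omega> (U k))\<^sup>2)"

definition tuple_ae_eq :: "(real^'d) set \<Rightarrow> ('d, 'n) tuple \<Rightarrow> ('d, 'n) tuple \<Rightarrow> bool" where
  "tuple_ae_eq \<Omega> U V \<longleftrightarrow> (\<forall>k. ae_eq \<Omega> (U k) (V k))"

definition orthonormal_tuples :: "(real^'d::finite) set \<Rightarrow> ('d, 'n::finite) tuple set" where
  "orthonormal_tuples \<Omega> = {U \<in> H10_tuples \<Omega>. outer \<Omega> U U = mat 1}"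


section \<open>The evolution problem\<close>

text \<open>\<open>U\<close> is differentiable as a map from \<open>[0,\<infinity>)\<close> (one-sidedly at \<open>0\<close>) to \<open>[H\<^sup>1\<^sub>0(\<Omega>)]\<^sup>N\<close>, with a
  derivative \<open>U'\<close> that is continuous in the \<open>H\<^sup>1\<close> norm.\<close>

definition C1_curve ::
    "(real^'d::finite) set \<Rightarrow> (real \<Rightarrow> ('d, 'n::finite) tuple) \<Rightarrow> (real \<Rightarrow> ('d, 'n) tuple) \<Rightarrow> bool" where
  "C1_curve \<Omega> U U' \<longleftrightarrow>
     (\<forall>t\<ge>0. U t \<in> H10_tuples \<Omega> \<and> U' t \<in> H10_tuples \<Omega> \<and>
        ((\<lambda>s. tuple_norm \<Omega> (\<lambda>k x. (U s k x - U t k x) / (s - t) - U' t k x)) \<longlongrightarrow> 0)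
          (at t within {0..}) \<and>
        ((\<lambda>s. tuple_norm \<Omega> (\<lambda>k x. U' s k x - U' t k x)) \<longlongrightarrow> 0) (at t within {0..}))"

definition flow_rhs ::
    "(real^'d::finite) set \<Rightarrow> (real^'d \<Rightarrow> real) \<Rightarrow> ('d, 'n::finite) tuple \<Rightarrow> ('d, 'n) tuple" where
  "flow_rhs \<Omega> \<V> U =
     (let GU = solution_op_tuple \<Omega> \<V> U in
      (\<lambda>k x. - tuple_mult U (outer \<Omega> GU U) k x + tuple_mult GU (outer \<Omega> U U) k x))"

definition global_solution ::
    "(real^'d::finite) set \<Rightarrow> (real^'d \<Rightarrow> real) \<Rightarrow> ('d, 'n::finite) tuple
      \<Rightarrow> (real \<Rightarrow> ('d, 'n) tuple) \<Rightarrow> bool" where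
  "global_solution \<Omega> \<V> U0 U \<longleftrightarrow>
     tuple_ae_eq \<Omega> (U 0) U0 \<and>
     (\<exists>U'. C1_curve \<Omega> U U' \<and> (\<forall>t\<ge>0. tuple_ae_eq \<Omega> (U' t) (flow_rhs \<Omega> \<V> (U t))))"

end

theory Submission
  imports Defs
begin

text \<open>
  The equation is a flow for which \<open>\<langle>U, U\<rangle>\<close> is constant: since \<open>\<G>\<close> is symmetric, the derivative of
  \<open>B = \<langle>U, U\<rangle>\<close> is \<open>- A B - B A + B A + A B = 0\<close> with \<open>A = \<langle>\<G> U, U\<rangle>\<close>. On orthonormal tuples the equation
  becomes \<open>U' = \<G> U - U A\<close>, whose right-hand side is Lipschitz in the \<open>L\<^sup>2\<close> norm, so uniqueness follows
  from Gronwall's inequality in \<open>L\<^sup>2\<close>. For existence the equation is reduced to linear ones: solve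
  \<open>W' = \<G> W\<close>, \<open>W(0) = U\<^sup>0\<close> in \<open>[H\<^sup>1\<^sub>0]\<^sup>N\<close>, put \<open>M = \<langle>W, W\<rangle>\<close> and \<open>N = \<langle>\<G> W, W\<rangle>\<close>, and solve the linear matrix
  equation \<open>Q' = - M\<^sup>-\<^sup>1 N Q\<close>, \<open>Q(0) = I\<close>. Here \<open>M \<ge> I\<close> because \<open>\<G>\<close> is positive. Then \<open>Q\<^sup>T M Q\<close> is constant,
  and \<open>U = W Q\<close> is the solution.

  To work in a complete inner product type, \<open>L\<^sup>2(\<Omega>)\<close> is embedded by zero extension into the quotient
  \<open>l2\<close> of \<open>L\<^sup>2(\<real>\<^sup>d)\<close> by null functions, and \<open>H\<^sup>1(\<Omega>)\<close> isometrically into the product \<open>l2 \<times> l2\<^sup>d\<close> by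
  \<open>u \<mapsto> (u, \<nabla>u)\<close>; the image of \<open>H\<^sup>1\<^sub>0(\<Omega>)\<close> is closed.
\<close>

section \<open>The space \<open>L\<^sup>2\<close> as a complete inner product type\<close>

text \<open>The right-hand side is cubic, hence only locally Lipschitz: a fixed-point argument
  applied to it directly would give a local solution and leave an a priori bound to prove, while
  linear equations with continuous coefficients are globally solvable from the start. The matrix
  equation is found by inserting \<open>U = W Q\<close>: then \<open>U' = G U + W Q'\<close>, and
  \<open>W Q'\<close> has to equal \<open>- U A\<close> with \<open>A = Q^T N Q\<close>. If
  \<open>Q^T M Q = I\<close>, then \<open>Q Q^T\<close> is the inverse of \<open>M\<close>, so that
  \<open>- W Q Q^T N Q\<close> becomes linear in \<open>Q\<close>. Positivity enters through
  \<open>M' = 2 N\<close>: it keeps the inverse of \<open>M\<close> bounded for all times.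

  Two facts about the domain carry the analysis. Test functions separate \<open>L2 \<Omega>\<close>,
  so a weak gradient chosen by \<open>SOME\<close> is determined almost everywhere. The energy form
  is controlled only through the gradient, so the Poincare inequality is what makes it coercive in
  the full norm and gives access to the representation theorem.\<close>

definition square_integrable :: "'a measure \<Rightarrow> ('a \<Rightarrow> real) set" where
  "square_integrable M = {f \<in> borel_measurable M. integrable M (\<lambda>x. (f x)\<^sup>2)}"

lemma square_integrable_mult:
  assumes "f \<in> square_integrable M" "g \<in> square_integrable M"
  shows "integrable M (\<lambda>x. f x * g x)"
proof (rule Bochner_Integration.integrable_bound)
  show "integrable M (\<lambda>x. (f x)\<^sup>2 + (g x)\<^sup>2)"
    using assms by (auto simp: square_integrable_def)
  show "(\<lambda>x. f x * g x) \<in> borel_measurable M"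
    using assms by (auto simp: square_integrable_def)
  show "AE x in M. norm (f x * g x) \<le> norm ((f x)\<^sup>2 + (g x)\<^sup>2)"
  proof (rule AE_I2)
    fix x
    have "0 \<le> (\<bar>f x\<bar> - \<bar>g x\<bar>)\<^sup>2" by simp
    then have "2 * (\<bar>f x\<bar> * \<bar>g x\<bar>) \<le> (f x)\<^sup>2 + (g x)\<^sup>2" by (simp add: power2_diff)
    moreover have "0 \<le> \<bar>f x\<bar> * \<bar>g x\<bar>" by simp
    ultimately have "\<bar>f x\<bar> * \<bar>g x\<bar> \<le> (f x)\<^sup>2 + (g x)\<^sup>2" by linarith
    then show "norm (f x * g x) \<le> norm ((f x)\<^sup>2 + (g x)\<^sup>2)" by (simp add: abs_mult)
  qed
qed

lemma square_integrable_zero: "(\<lambda>x. 0) \<in> square_integrable M"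
  by (simp add: square_integrable_def)

lemma square_integrable_add:
  assumes "f \<in> square_integrable M" "g \<in> square_integrable M"
  shows "(\<lambda>x. f x + g x) \<in> square_integrable M"
  using assms square_integrable_mult[OF assms]
  by (auto simp: square_integrable_def power2_sum mult.assoc)

lemma square_integrable_cmult:
  assumes "f \<in> square_integrable M"
  shows "(\<lambda>x. r * f x) \<in> square_integrable M"
  using assms by (auto simp: square_integrable_def power_mult_distrib)

lemma square_integrable_uminus:
  "f \<in> square_integrable M \<Longrightarrow> (\<lambda>x. - f x) \<in> square_integrable M"
  using square_integrable_cmult[of f M "-1"] by simp

lemma square_integrable_diff:
  assumes "f \<in> square_integrable M" "g \<in> square_integrable M"
  shows "(\<lambda>x. f x - g x) \<in> square_integrable M"
  using square_integrable_add[OF assms(1) square_integrable_uminus[OF assms(2)]] by simp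

lemma square_integrable_abs:
  "f \<in> square_integrable M \<Longrightarrow> (\<lambda>x. \<bar>f x\<bar>) \<in> square_integrable M"
  by (auto simp: square_integrable_def)

lemma square_integrable_indicator:
  assumes "A \<in> sets M" "f \<in> square_integrable M"
  shows "(\<lambda>x. indicator A x * f x) \<in> square_integrable M"
proof -
  have "(indicator A x * f x)\<^sup>2 = indicator A x *\<^sub>R (f x)\<^sup>2" for x
    by (simp add: indicator_def)
  then show ?thesis
    using assms integrable_mult_indicator[OF assms(1), of "\<lambda>x. (f x)\<^sup>2"]
    by (auto simp: square_integrable_def intro!: borel_measurable_times)
qed

text \<open>A partial equivalence relation: it is reflexive exactly on the square integrable
  functions, so a single quotient both restricts to them and identifies functions that agree almost
  everywhere.\<close>

definition l2_rel :: "('a::euclidean_space \<Rightarrow> real) \<Rightarrow> ('a \<Rightarrow> real) \<Rightarrow> bool" where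
  "l2_rel f g \<longleftrightarrow> f \<in> square_integrable lebesgue \<and> g \<in> square_integrable lebesgue \<and>
     (AE x in lebesgue. f x = g x)"

quotient_type (overloaded) 'a l2 = "'a::euclidean_space \<Rightarrow> real" / partial: l2_rel
proof (rule part_equivpI)
  show "\<exists>f::'a \<Rightarrow> real. l2_rel f f"
    using square_integrable_zero by (force simp: l2_rel_def)
  show "symp (l2_rel :: ('a \<Rightarrow> real) \<Rightarrow> _)"
    by (auto simp: symp_def l2_rel_def)
  show "transp (l2_rel :: ('a \<Rightarrow> real) \<Rightarrow> _)"
    by (auto simp: transp_def l2_rel_def)
qed

instantiation l2 :: (euclidean_space) real_inner
begin

lift_definition zero_l2 :: "'a l2" is "\<lambda>x. 0"
  by (simp add: l2_rel_def square_integrable_zero)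

lift_definition plus_l2 :: "'a l2 \<Rightarrow> 'a l2 \<Rightarrow> 'a l2" is "\<lambda>f g x. f x + g x"
  by (auto simp: l2_rel_def square_integrable_add)

lift_definition minus_l2 :: "'a l2 \<Rightarrow> 'a l2 \<Rightarrow> 'a l2" is "\<lambda>f g x. f x - g x"
  by (auto simp: l2_rel_def square_integrable_diff)

lift_definition uminus_l2 :: "'a l2 \<Rightarrow> 'a l2" is "\<lambda>f x. - f x"
  by (auto simp: l2_rel_def square_integrable_uminus)

lift_definition scaleR_l2 :: "real \<Rightarrow> 'a l2 \<Rightarrow> 'a l2" is "\<lambda>r f x. r * f x"
  by (auto simp: l2_rel_def square_integrable_cmult)

lift_definition inner_l2 :: "'a l2 \<Rightarrow> 'a l2 \<Rightarrow> real" is "\<lambda>f g. LINT x|lebesgue. f x * g x"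
proof -
  fix f f' g g' :: "'a \<Rightarrow> real"
  assume "l2_rel f f'" "l2_rel g g'"
  then show "(LINT x|lebesgue. f x * g x) = (LINT x|lebesgue. f' x * g' x)"
    by (intro integral_cong_AE) (auto simp: l2_rel_def square_integrable_def)
qed

definition norm_l2 :: "'a l2 \<Rightarrow> real" where "norm_l2 f = sqrt (inner f f)"
definition sgn_l2 :: "'a l2 \<Rightarrow> 'a l2" where "sgn_l2 f = inverse (norm f) *\<^sub>R f"
definition dist_l2 :: "'a l2 \<Rightarrow> 'a l2 \<Rightarrow> real" where "dist_l2 f g = norm (f - g)"
definition uniformity_l2 :: "('a l2 \<times> 'a l2) filter" where
  "uniformity_l2 = (INF e\<in>{0<..}. principal {(x, y). dist x y < e})"
definition open_l2 :: "'a l2 set \<Rightarrow> bool" where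
  "open_l2 S = (\<forall>x\<in>S. \<forall>\<^sub>F (x', y) in uniformity. x' = x \<longrightarrow> y \<in> S)"

instance
proof
  fix f g h :: "'a l2" and r s :: real
  show "f + g + h = f + (g + h)"
    by transfer (auto simp: l2_rel_def square_integrable_add add.assoc)
  show "f + g = g + f"
    by transfer (auto simp: l2_rel_def square_integrable_add add.commute)
  show "0 + f = f" by transfer (auto simp: l2_rel_def)
  show "- f + f = 0" by transfer (auto simp: l2_rel_def square_integrable_zero)
  show "f - g = f + - g"
    by transfer (auto simp: l2_rel_def square_integrable_diff)
  show "r *\<^sub>R (f + g) = r *\<^sub>R f + r *\<^sub>R g"
    by transfer
      (auto simp: l2_rel_def distrib_left intro!: square_integrable_add square_integrable_cmult)
  show "(r + s) *\<^sub>R f = r *\<^sub>R f + s *\<^sub>R f"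
    by transfer
      (auto simp: l2_rel_def distrib_right intro!: square_integrable_add square_integrable_cmult)
  show "r *\<^sub>R s *\<^sub>R f = (r * s) *\<^sub>R f"
    by transfer (auto simp: l2_rel_def mult.assoc intro!: square_integrable_cmult)
  show "1 *\<^sub>R f = f" by transfer (auto simp: l2_rel_def)
  show "sgn f = inverse (norm f) *\<^sub>R f" by (rule sgn_l2_def)
  show "dist f g = norm (f - g)" by (rule dist_l2_def)
  show "uniformity = (INF e\<in>{0<..}. principal {(x, y :: 'a l2). dist x y < e})"
    by (rule uniformity_l2_def)
  show "\<And>S :: 'a l2 set. open S = (\<forall>x\<in>S. \<forall>\<^sub>F (x', y) in uniformity. x' = x \<longrightarrow> y \<in> S)"
    by (rule open_l2_def)
  show "f \<bullet> g = g \<bullet> f" by transfer (simp add: mult.commute)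
  show "(f + g) \<bullet> h = f \<bullet> h + g \<bullet> h"
    by transfer (simp add: l2_rel_def distrib_right square_integrable_mult)
  show "(r *\<^sub>R f) \<bullet> g = r * (f \<bullet> g)" by transfer (simp add: mult.assoc)
  show "0 \<le> f \<bullet> f" by transfer simp
  show "(f \<bullet> f = 0) = (f = 0)"
    by transfer
      (subst integral_nonneg_eq_0_iff_AE,
        auto simp: l2_rel_def square_integrable_zero square_integrable_mult)
  show "norm f = sqrt (f \<bullet> f)" by (rule norm_l2_def)
qed

end

lemma norm_abs_l2:
  assumes "f \<in> square_integrable lebesgue"
  shows "(norm (abs_l2 f))\<^sup>2 = (LINT x|lebesgue. (f x)\<^sup>2)"
proof -
  have "abs_l2 f \<bullet> abs_l2 f = (LINT x|lebesgue. f x * f x)"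
    using assms by (intro inner_l2.abs_eq) (auto simp: l2_rel_def)
  then show ?thesis by (simp only: power2_norm_eq_inner) (simp add: power2_eq_square)
qed

lemma rep_l2:
  "rep_l2 X \<in> square_integrable lebesgue" "abs_l2 (rep_l2 X) = X"
  using Quotient3_rep_reflp[OF Quotient3_l2, of X] Quotient3_abs_rep[OF Quotient3_l2, of X]
  by (auto simp: l2_rel_def)

lemma abs_l2_eq_iff:
  assumes "f \<in> square_integrable lebesgue" "g \<in> square_integrable lebesgue"
  shows "abs_l2 f = abs_l2 g \<longleftrightarrow> (AE x in lebesgue. f x = g x)"
  using assms Quotient3_rel[OF Quotient3_l2, of f g] by (auto simp: l2_rel_def)

lemma abs_l2_add:
  assumes "f \<in> square_integrable lebesgue" "g \<in> square_integrable lebesgue"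
  shows "abs_l2 (\<lambda>x. f x + g x) = abs_l2 f + abs_l2 g"
  using assms by (subst plus_l2.abs_eq) (auto simp: l2_rel_def)

lemma abs_l2_diff:
  assumes "f \<in> square_integrable lebesgue" "g \<in> square_integrable lebesgue"
  shows "abs_l2 (\<lambda>x. f x - g x) = abs_l2 f - abs_l2 g"
  using assms by (subst minus_l2.abs_eq) (auto simp: l2_rel_def)

lemma abs_l2_scale:
  assumes "f \<in> square_integrable lebesgue"
  shows "abs_l2 (\<lambda>x. r * f x) = r *\<^sub>R abs_l2 f"
  using assms by (subst scaleR_l2.abs_eq) (auto simp: l2_rel_def)

lemma abs_l2_inner:
  assumes "f \<in> square_integrable lebesgue" "g \<in> square_integrable lebesgue"
  shows "abs_l2 f \<bullet> abs_l2 g = (LINT x|lebesgue. f x * g x)"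
  using assms by (subst inner_l2.abs_eq) (auto simp: l2_rel_def)

section \<open>Completeness of \<open>l2\<close> (Riesz-Fischer)\<close>

lemma nn_integral_rep_l2_diff:
  "(\<integral>\<^sup>+x. ennreal ((rep_l2 X x - rep_l2 Y x)\<^sup>2) \<partial>lebesgue) = ennreal ((dist X Y)\<^sup>2)"
proof -
  have i: "(\<lambda>x. rep_l2 X x - rep_l2 Y x) \<in> square_integrable lebesgue"
    by (intro square_integrable_diff rep_l2)
  have "abs_l2 (\<lambda>x. rep_l2 X x - rep_l2 Y x) = X - Y"
    by (simp add: abs_l2_diff rep_l2)
  then show ?thesis
    using norm_abs_l2[OF i] i
    by (subst nn_integral_eq_integral) (auto simp: dist_norm square_integrable_def)
qed

lemma norm_abs_l2_abs:
  assumes "f \<in> square_integrable lebesgue"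
  shows "norm (abs_l2 (\<lambda>x. \<bar>f x\<bar>)) = norm (abs_l2 f)"
proof (rule power2_eq_imp_eq)
  show "(norm (abs_l2 (\<lambda>x. \<bar>f x\<bar>)))\<^sup>2 = (norm (abs_l2 f))\<^sup>2"
    by (simp add: norm_abs_l2 assms square_integrable_abs)
qed simp_all

text \<open>The partial sums \<open>S n\<close> of the absolute increments have norm at most 2 by
  the triangle inequality and the geometric series. Monotone convergence then bounds the integral of
  their squared supremum by 4, so the supremum is finite almost everywhere and the telescoping
  series converges absolutely there.\<close>

lemma fast_l2_sequence_AE_convergent:
  fixes X :: "nat \<Rightarrow> 'a::euclidean_space l2"
  assumes "\<And>k. dist (X (Suc k)) (X k) \<le> (1/2) ^ k"
  shows "AE x in lebesgue. convergent (\<lambda>k. rep_l2 (X k) x)"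
proof -
  define F where "F k = rep_l2 (X k)" for k
  define D where "D k x = \<bar>F (Suc k) x - F k x\<bar>" for k x
  define S where "S n x = (\<Sum>k<n. D k x)" for n x
  have FL: "F k \<in> square_integrable lebesgue" for k
    by (simp add: F_def rep_l2)
  have DL: "D k \<in> square_integrable lebesgue" for k
    unfolding D_def by (intro square_integrable_abs square_integrable_diff FL)
  have SL: "S n \<in> square_integrable lebesgue \<and> norm (abs_l2 (S n)) \<le> (\<Sum>k<n. (1/2)^k)" for n
  proof (induction n)
    case 0
    have "S 0 = (\<lambda>x. 0)" by (simp add: S_def fun_eq_iff)
    then show ?case by (simp add: square_integrable_zero flip: zero_l2_def)
  next
    case (Suc n)
    have eq: "S (Suc n) = (\<lambda>x. S n x + D n x)" by (simp add: S_def fun_eq_iff)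
    have "norm (abs_l2 (D n)) = norm (abs_l2 (\<lambda>x. F (Suc n) x - F n x))"
      unfolding D_def by (intro norm_abs_l2_abs square_integrable_diff FL)
    also have "\<dots> = dist (X (Suc n)) (X n)"
      unfolding F_def by (simp add: abs_l2_diff rep_l2 dist_norm)
    also have "\<dots> \<le> (1/2)^n" by (rule assms)
    finally show ?case
      unfolding eq using Suc DL
      by (auto simp: abs_l2_add square_integrable_add intro: order_trans[OF norm_triangle_ineq])
  qed
  have bound: "(\<integral>\<^sup>+x. ennreal ((S n x)\<^sup>2) \<partial>lebesgue) \<le> 4" for n
  proof -
    have "(\<Sum>k<n. (1/2::real)^k) \<le> 2"
      by (simp add: sum_gp_strict)
    then have "norm (abs_l2 (S n)) \<le> 2" using SL[of n] by linarith
    then have "(norm (abs_l2 (S n)))\<^sup>2 \<le> 2\<^sup>2" by (intro power_mono) auto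
    then show ?thesis using SL[of n]
      by (subst nn_integral_eq_integral)
        (auto simp: square_integrable_def simp flip: norm_abs_l2 intro: ennreal_leI[of _ 4, simplified])
  qed
  have Smono: "mono (\<lambda>n. S n x)" for x
    by (auto simp: S_def D_def mono_def intro!: sum_mono2)
  have S0: "0 \<le> S n x" for n x
    by (auto simp: S_def D_def intro!: sum_nonneg)
  have "(\<integral>\<^sup>+x. (SUP n. ennreal ((S n x)\<^sup>2)) \<partial>lebesgue) = (SUP n. \<integral>\<^sup>+x. ennreal ((S n x)\<^sup>2) \<partial>lebesgue)"
  proof (rule nn_integral_monotone_convergence_SUP)
    show "incseq (\<lambda>n x. ennreal ((S n x)\<^sup>2))"
      using Smono S0 by (auto simp: mono_def le_fun_def intro!: ennreal_leI power_mono)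
    show "\<And>n. (\<lambda>x. ennreal ((S n x)\<^sup>2)) \<in> borel_measurable lebesgue"
      using SL by (auto simp: square_integrable_def)
  qed
  also have "\<dots> \<le> 4" by (intro SUP_least bound)
  finally have "(\<integral>\<^sup>+x. (SUP n. ennreal ((S n x)\<^sup>2)) \<partial>lebesgue) \<noteq> \<infinity>"
    by (auto simp: top_unique)
  then have "AE x in lebesgue. (SUP n. ennreal ((S n x)\<^sup>2)) \<noteq> \<infinity>"
    by (intro nn_integral_noteq_infinite borel_measurable_SUP measurable_compose[OF _ measurable_ennreal]
        borel_measurable_power) (use SL in \<open>auto simp: square_integrable_def\<close>)
  then show ?thesis
  proof (eventually_elim)
    fix x assume "(SUP n. ennreal ((S n x)\<^sup>2)) \<noteq> \<infinity>"
    then obtain B where B: "0 \<le> B" "(SUP n. ennreal ((S n x)\<^sup>2)) = ennreal B"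
      by (cases "SUP n. ennreal ((S n x)\<^sup>2)") auto
    have "S n x \<le> sqrt B" for n
    proof -
      have "ennreal ((S n x)\<^sup>2) \<le> ennreal B" using B(2) by (metis SUP_upper UNIV_I)
      then show ?thesis using B(1) by (intro real_le_rsqrt) auto
    qed
    then have "summable (\<lambda>k. D k x)"
      by (intro summableI_nonneg_bounded[where x="sqrt B"]) (auto simp: S_def D_def)
    then have "summable (\<lambda>k. F (Suc k) x - F k x)"
      unfolding D_def by (rule summable_rabs_cancel)
    then have "convergent (\<lambda>n. \<Sum>k<n. F (Suc k) x - F k x)"
      by (simp add: summable_iff_convergent)
    then have "convergent (\<lambda>n. F n x - F 0 x)"
      by (simp add: sum_lessThan_telescope[where f="\<lambda>k. F k x"])
    then have "convergent (\<lambda>n. (F n x - F 0 x) + F 0 x)"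
      by (intro convergent_add convergent_const)
    then show "convergent (\<lambda>k. rep_l2 (X k) x)" by (simp add: F_def)
  qed
qed

text \<open>The pointwise limit is also the limit in norm, by Fatou's lemma applied to the distances
  of \<open>X n\<close> to later terms.\<close>

lemma fast_l2_Cauchy_sequence_convergent:
  fixes X :: "nat \<Rightarrow> 'a::euclidean_space l2"
  assumes "Cauchy X" and fast: "\<And>k. dist (X (Suc k)) (X k) \<le> (1/2) ^ k"
  shows "convergent X"
proof -
  define F where "F k = rep_l2 (X k)" for k
  define f where "f x = lim (\<lambda>k. F k x)" for x
  have FL: "F k \<in> square_integrable lebesgue" for k
    by (simp add: F_def rep_l2)
  have meas[measurable]: "F k \<in> borel_measurable lebesgue" for k
    using FL by (auto simp: square_integrable_def)
  have fmeas[measurable]: "f \<in> borel_measurable lebesgue"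
    unfolding f_def by (rule borel_measurable_lim_metric) (rule meas)
  have conv: "AE x in lebesgue. (\<lambda>k. F k x) \<longlonglongrightarrow> f x"
    using fast_l2_sequence_AE_convergent[OF fast] unfolding F_def f_def
    by eventually_elim (simp add: convergent_LIMSEQ_iff)
  have fatou: "(\<integral>\<^sup>+x. ennreal ((F n x - f x)\<^sup>2) \<partial>lebesgue) \<le> ennreal (e\<^sup>2)"
    if "\<And>k. k \<ge> n \<Longrightarrow> dist (X n) (X k) \<le> e" for n e
  proof -
    have "(\<integral>\<^sup>+x. ennreal ((F n x - f x)\<^sup>2) \<partial>lebesgue)
        = (\<integral>\<^sup>+x. liminf (\<lambda>k. ennreal ((F n x - F k x)\<^sup>2)) \<partial>lebesgue)"
    proof (rule nn_integral_cong_AE)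
      show "AE x in lebesgue. ennreal ((F n x - f x)\<^sup>2)
          = liminf (\<lambda>k. ennreal ((F n x - F k x)\<^sup>2))"
        using conv
      proof eventually_elim
        fix x assume "(\<lambda>k. F k x) \<longlonglongrightarrow> f x"
        then have "(\<lambda>k. ennreal ((F n x - F k x)\<^sup>2)) \<longlonglongrightarrow> ennreal ((F n x - f x)\<^sup>2)"
          by (intro tendsto_ennrealI tendsto_power tendsto_diff tendsto_const)
        then show "ennreal ((F n x - f x)\<^sup>2) = liminf (\<lambda>k. ennreal ((F n x - F k x)\<^sup>2))"
          by (rule lim_imp_Liminf[OF sequentially_bot, symmetric])
      qed
    qed
    also have "\<dots> \<le> liminf (\<lambda>k. \<integral>\<^sup>+x. ennreal ((F n x - F k x)\<^sup>2) \<partial>lebesgue)"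
      by (rule nn_integral_liminf) simp
    also have "\<dots> = liminf (\<lambda>k. ennreal ((dist (X n) (X k))\<^sup>2))"
      by (simp add: F_def nn_integral_rep_l2_diff)
    also have "\<dots> \<le> liminf (\<lambda>k. ennreal (e\<^sup>2))"
    proof (rule Liminf_mono)
      show "\<forall>\<^sub>F k in sequentially. ennreal ((dist (X n) (X k))\<^sup>2) \<le> ennreal (e\<^sup>2)"
        using that by (auto intro!: eventually_sequentiallyI[of n] ennreal_leI power_mono)
    qed
    also have "\<dots> = ennreal (e\<^sup>2)" by (simp add: Liminf_const)
    finally show ?thesis .
  qed
  \<comment> \<open>Finiteness of the Fatou bound puts \<open>F n - f\<close> into the space;
    \<open>f\<close> itself then lies there as the difference of \<open>F n0\<close> and
    \<open>F n0 - f\<close>.\<close>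
  have diffL: "(\<lambda>x. F n x - f x) \<in> square_integrable lebesgue"
    if "\<And>k. k \<ge> n \<Longrightarrow> dist (X n) (X k) \<le> e" for n e
  proof -
    have "integrable lebesgue (\<lambda>x. (F n x - f x)\<^sup>2)"
      using le_less_trans[OF fatou[OF that] ennreal_less_top] by (intro integrableI_bounded) auto
    then show ?thesis by (simp add: square_integrable_def)
  qed
  obtain n0 where "\<And>k. k \<ge> n0 \<Longrightarrow> dist (X n0) (X k) \<le> 1"
    using \<open>Cauchy X\<close>[unfolded Cauchy_def, rule_format, OF zero_less_one] by (blast intro: less_imp_le)
  then have "(\<lambda>x. F n0 x - (F n0 x - f x)) \<in> square_integrable lebesgue"
    by (intro square_integrable_diff FL diffL) auto
  then have fL: "f \<in> square_integrable lebesgue" by simp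
  have "X \<longlonglongrightarrow> abs_l2 f"
  proof (rule LIMSEQ_I)
    fix r :: real assume "0 < r"
    then have "0 < r/2" by simp
    from \<open>Cauchy X\<close>[unfolded Cauchy_def, rule_format, OF this]
    obtain N where N: "\<And>m n. m \<ge> N \<Longrightarrow> n \<ge> N \<Longrightarrow> dist (X m) (X n) < r/2"
      by blast
    show "\<exists>no. \<forall>n\<ge>no. norm (X n - abs_l2 f) < r"
    proof (intro exI allI impI)
      fix n assume "n \<ge> N"
      then have *: "dist (X n) (X k) \<le> r/2" if "k \<ge> n" for k
        using N[OF \<open>n \<ge> N\<close> order_trans[OF \<open>n \<ge> N\<close> that]] by simp
      have "X n = abs_l2 (F n)" by (simp add: F_def rep_l2)
      then have eq: "X n - abs_l2 f = abs_l2 (\<lambda>x. F n x - f x)"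
        by (simp only: abs_l2_diff[OF FL fL, of n])
      have L: "(\<lambda>x. F n x - f x) \<in> square_integrable lebesgue" by (rule diffL[OF *])
      have "ennreal ((norm (abs_l2 (\<lambda>x. F n x - f x)))\<^sup>2)
          = (\<integral>\<^sup>+x. ennreal ((F n x - f x)\<^sup>2) \<partial>lebesgue)"
        unfolding norm_abs_l2[OF L] using L
        by (intro nn_integral_eq_integral[symmetric]) (auto simp: square_integrable_def)
      also have "\<dots> \<le> ennreal ((r/2)\<^sup>2)" by (rule fatou[OF *])
      finally have "(norm (X n - abs_l2 f))\<^sup>2 \<le> (r/2)\<^sup>2" unfolding eq by simp
      then have "norm (X n - abs_l2 f) \<le> r/2"
        by (rule power2_le_imp_le) (use \<open>0 < r\<close> in simp)
      then show "norm (X n - abs_l2 f) < r" using \<open>0 < r\<close> by linarith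
    qed
  qed
  then show ?thesis by (rule convergentI)
qed

instance l2 :: (euclidean_space) complete_space
proof
  fix X :: "nat \<Rightarrow> 'a l2"
  assume X: "Cauchy X"
  \<comment> \<open>Only a subsequence has steps below \<open>(1/2)^k\<close>; that suffices because
    a Cauchy sequence with a convergent subsequence converges. Taking \<open>N (Suc k)\<close> into
    the maximum puts \<open>r (Suc k)\<close> in place for the next step.\<close>
  obtain r :: "nat \<Rightarrow> nat" where r: "strict_mono r" "\<And>k. dist (X (r (Suc k))) (X (r k)) \<le> (1/2) ^ k"
  proof -
    have "\<forall>k. \<exists>N. \<forall>m\<ge>N. \<forall>n\<ge>N. dist (X m) (X n) < (1/2)^k"
      using X unfolding Cauchy_def by simp
    then obtain N where N: "\<And>k m n. m \<ge> N k \<Longrightarrow> n \<ge> N k \<Longrightarrow> dist (X m) (X n) < (1/2)^k"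
      by metis
    define r where "r = rec_nat (N 0) (\<lambda>k s. Suc (max s (max (N k) (N (Suc k)))))"
    have rS: "r (Suc k) = Suc (max (r k) (max (N k) (N (Suc k))))" for k by (simp add: r_def)
    have "r k \<ge> N k" for k by (cases k) (simp add: r_def, simp add: rS)
    moreover have "r (Suc k) \<ge> N k" for k by (simp add: rS)
    ultimately have "dist (X (r (Suc k))) (X (r k)) \<le> (1/2) ^ k" for k
      by (intro less_imp_le[OF N])
    moreover have "strict_mono r" by (rule strict_mono_Suc_iff[THEN iffD2, rule_format], subst rS) simp
    ultimately show thesis using that by blast
  qed
  have "Cauchy (X \<circ> r)" using X r(1) by (rule Cauchy_subseq_Cauchy)
  then have "convergent (X \<circ> r)"
    using r(2) by (intro fast_l2_Cauchy_sequence_convergent) auto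
  then obtain L where L: "(X \<circ> r) \<longlonglongrightarrow> L" by (auto simp: convergent_def)
  have "X \<longlonglongrightarrow> L"
  proof (rule metric_LIMSEQ_I)
    fix e :: real assume "0 < e"
    then obtain N where N: "\<And>m n. m \<ge> N \<Longrightarrow> n \<ge> N \<Longrightarrow> dist (X m) (X n) < e/2"
      using X unfolding Cauchy_def by (metis half_gt_zero)
    obtain M where M: "\<And>n. n \<ge> M \<Longrightarrow> dist (X (r n)) L < e/2"
      using metric_LIMSEQ_D[OF L, of "e/2"] \<open>0 < e\<close> by auto
    show "\<exists>no. \<forall>n\<ge>no. dist (X n) L < e"
    proof (intro exI allI impI)
      fix n assume "n \<ge> N"
      have "r (max N M) \<ge> N" using seq_suble[OF r(1), of "max N M"] by simp
      then have "dist (X n) (X (r (max N M))) < e/2" using N \<open>n \<ge> N\<close> by blast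
      moreover have "dist (X (r (max N M))) L < e/2" using M by simp
      ultimately show "dist (X n) L < e" using dist_triangle[of "X n" L "X (r (max N M))"] by simp
    qed
  qed
  then show "convergent X" by (rule convergentI)
qed

instance l2 :: (euclidean_space) banach ..

section \<open>Smooth functions\<close>

lemma partial_eqI: "(f has_derivative f') (at x) \<Longrightarrow> partial i f x = f' (axis i 1)"
  unfolding partial_def by (metis frechet_derivative_at)

lemma partial_has_derivative:
  assumes "f differentiable (at x)"
  shows "(f has_derivative frechet_derivative f (at x)) (at x)"
  using assms by (simp add: frechet_derivative_works)

lemma partial_add:
  assumes "f differentiable (at x)" "g differentiable (at x)"
  shows "partial i (\<lambda>x. f x + g x) x = partial i f x + partial i g x"
  unfolding partial_eqI[OF has_derivative_add[OF assms[THEN partial_has_derivative]]]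
  by (simp add: partial_def)

lemma partial_mult:
  assumes "f differentiable (at x)" "g differentiable (at x)"
  shows "partial i (\<lambda>x. f x * g x) x = f x * partial i g x + partial i f x * g x"
  unfolding partial_eqI[OF has_derivative_mult[OF assms[THEN partial_has_derivative]]]
  by (simp add: partial_def)

lemma partial_const: "partial i (\<lambda>x. c) = (\<lambda>x. 0)"
  using partial_eqI[OF has_derivative_const] by (auto simp: fun_eq_iff)

lemma has_derivative_coordinate: "((\<lambda>x. x $ j) has_derivative (\<lambda>h. h $ j)) (at x)"
  by (rule bounded_linear.has_derivative[OF bounded_linear_vec_nth has_derivative_ident])

lemma partial_coordinate: "partial i (\<lambda>x. x $ j) = (\<lambda>x. if i = j then 1 else 0)"
  by (auto simp: fun_eq_iff axis_def partial_eqI[OF has_derivative_coordinate])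

lemma partial_compose_coordinate:
  assumes "(g has_real_derivative g') (at (c * x $ j + b))"
  shows "((\<lambda>x. g (c * x $ j + b)) has_derivative (\<lambda>h. g' * (c * h $ j))) (at x)"
proof -
  have "((\<lambda>x. c * x $ j + b) has_derivative (\<lambda>h. c * h $ j)) (at x)"
    by (auto intro!: derivative_eq_intros has_derivative_coordinate)
  from has_derivative_compose[OF this assms[unfolded has_field_derivative_def]]
  show ?thesis by simp
qed

text \<open>\<open>smooth\<close> quantifies over lists of indices. A set of differentiable
  functions that is stable under \<open>partial\<close> replaces inductions over such lists, and
  with them a Leibniz rule for higher derivatives.\<close>

lemma smooth_coinduct:
  assumes "f \<in> S" "\<And>g x. g \<in> S \<Longrightarrow> g differentiable (at x)" "\<And>g i. g \<in> S \<Longrightarrow> partial i g \<in> S"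
  shows "smooth f"
proof -
  have "iter_partial is f \<in> S" for "is"
    by (induction "is") (use assms in auto)
  then show ?thesis using assms(2) by (auto simp: smooth_def)
qed

lemma smooth_differentiable: "smooth f \<Longrightarrow> f differentiable (at x)"
  unfolding smooth_def by (metis iter_partial.simps(1))

lemma smooth_partial: "smooth f \<Longrightarrow> smooth (partial i f)"
proof -
  have "iter_partial is (partial i f) = iter_partial (is @ [i]) f" for "is"
    by (induction "is") auto
  then show "smooth f \<Longrightarrow> smooth (partial i f)" by (simp add: smooth_def)
qed

lemma smooth_continuous: "smooth f \<Longrightarrow> continuous_on S f"
  by (meson smooth_differentiable differentiable_imp_continuous_within continuous_at_imp_continuous_on)

text \<open>The derivatives of \<open>exp (- 1 / t)\<close> (extended by \<open>0\<close> to \<open>t \<le> 0\<close>) are of the following form.\<close>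

definition exp_inverse :: "real poly \<Rightarrow> real \<Rightarrow> real" where
  "exp_inverse p t = (if t > 0 then poly p (1 / t) * exp (- (1 / t)) else 0)"

lemma tendsto_poly_mult_exp_minus: "((\<lambda>y::real. poly p y * exp (- y)) \<longlongrightarrow> 0) at_top"
proof -
  have "((\<lambda>y::real. \<Sum>i\<le>degree p. coeff p i * (y ^ i / exp y)) \<longlongrightarrow> (\<Sum>i\<le>degree p. coeff p i * 0)) at_top"
    by (intro tendsto_intros tendsto_power_div_exp_0)
  then show ?thesis
    by (simp add: poly_altdef sum_distrib_right exp_minus divide_inverse mult.assoc)
qed

text \<open>With \<open>y = 1 / t\<close> the derivative of \<open>p y * exp (- y)\<close> in
  \<open>t\<close> is \<open>y^2 * (p - p') y * exp (- y)\<close>, and \<open>[:0, 0, 1:]\<close> is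
  the polynomial \<open>y^2\<close>. At 0 the difference quotient from the right becomes
  \<open>y * p y * exp (- y)\<close>, where \<open>pCons 0 p\<close> stands for
  \<open>y * p y\<close>, and the exponential beats every polynomial.\<close>

lemma exp_inverse_has_real_derivative:
  "(exp_inverse p has_real_derivative exp_inverse ([:0, 0, 1:] * (p - pderiv p)) t) (at t)"
proof -
  consider "t > 0" | "t < 0" | "t = 0" by linarith
  then show ?thesis
  proof cases
    case 1
    have "((\<lambda>t. poly p (1 / t) * exp (- (1 / t))) has_real_derivative
        exp_inverse ([:0, 0, 1:] * (p - pderiv p)) t) (at t)"
      using 1
      by (auto intro!: derivative_eq_intros DERIV_chain2[OF poly_DERIV]
          simp: exp_inverse_def field_simps power2_eq_square)
    then show ?thesis
      by (rule has_field_derivative_transform_within_open[where S="{0<..}"])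
        (use 1 in \<open>auto simp: exp_inverse_def\<close>)
  next
    case 2
    have "((\<lambda>t. 0) has_real_derivative exp_inverse ([:0, 0, 1:] * (p - pderiv p)) t) (at t)"
      using 2 by (simp add: exp_inverse_def)
    then show ?thesis
      by (rule has_field_derivative_transform_within_open[where S="{..<0}"])
        (use 2 in \<open>auto simp: exp_inverse_def\<close>)
  next
    case 3
    have "((\<lambda>h. exp_inverse p h / h) \<longlongrightarrow> 0) (at 0)"
    proof (rule filterlim_split_at)
      have "\<forall>\<^sub>F h::real in at_left 0. exp_inverse p h / h = 0"
        by (auto simp: eventually_at_filter exp_inverse_def)
      then show "((\<lambda>h. exp_inverse p h / h) \<longlongrightarrow> 0) (at_left 0)"
        by (rule tendsto_eventually)
      have "\<forall>\<^sub>F y::real in at_top. poly (pCons 0 p) y * exp (- y) = exp_inverse p (inverse y) / inverse y"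
        using eventually_gt_at_top[of 0]
        by eventually_elim (simp add: exp_inverse_def divide_inverse mult_ac)
      with tendsto_poly_mult_exp_minus
      have "((\<lambda>y. exp_inverse p (inverse y) / inverse y) \<longlongrightarrow> 0) at_top"
        by (rule Lim_transform_eventually)
      then show "((\<lambda>h. exp_inverse p h / h) \<longlongrightarrow> 0) (at_right 0)"
        by (simp add: filterlim_at_right_to_top)
    qed
    then show ?thesis
      using 3 by (simp add: has_field_derivative_iff exp_inverse_def)
  qed
qed

inductive_set smooth_closure :: "(real^'d::finite \<Rightarrow> real) set" where
  smooth: "smooth f \<Longrightarrow> f \<in> smooth_closure"
| const: "(\<lambda>x. c) \<in> smooth_closure"
| coordinate: "(\<lambda>x. x $ i) \<in> smooth_closure"
| exp_inverse: "(\<lambda>x. exp_inverse p (c * x $ i + b)) \<in> smooth_closure"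
| add: "f \<in> smooth_closure \<Longrightarrow> g \<in> smooth_closure \<Longrightarrow> (\<lambda>x. f x + g x) \<in> smooth_closure"
| mult: "f \<in> smooth_closure \<Longrightarrow> g \<in> smooth_closure \<Longrightarrow> (\<lambda>x. f x * g x) \<in> smooth_closure"

lemma smooth_closure_differentiable: "f \<in> smooth_closure \<Longrightarrow> f differentiable (at x)"
proof (induction rule: smooth_closure.induct)
  case (coordinate i)
  then show ?case using has_derivative_coordinate differentiable_def by blast
next
  case (exp_inverse p c i b)
  then show ?case
    using partial_compose_coordinate[OF exp_inverse_has_real_derivative] differentiable_def by blast
qed (auto simp: smooth_differentiable)

lemma smooth_closure_partial: "f \<in> smooth_closure \<Longrightarrow> partial i f \<in> smooth_closure"
proof (induction rule: smooth_closure.induct)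
  case (smooth f)
  then show ?case by (intro smooth_closure.smooth smooth_partial)
next
  case (const c)
  then show ?case by (simp add: partial_const smooth_closure.const)
next
  case (coordinate j)
  then show ?case by (simp add: partial_coordinate smooth_closure.const)
next
  case (exp_inverse p c j b)
  have "partial i (\<lambda>x. exp_inverse p (c * x $ j + b)) =
      (\<lambda>x. exp_inverse ([:0, 0, 1:] * (p - pderiv p)) (c * x $ j + b) * (if i = j then c else 0))"
    by (auto simp: fun_eq_iff axis_def
        partial_eqI[OF partial_compose_coordinate[OF exp_inverse_has_real_derivative]])
  then show ?case
    by (simp only:) (intro smooth_closure.mult smooth_closure.exp_inverse smooth_closure.const)
next
  case (add f g)
  then have "partial i (\<lambda>x. f x + g x) = (\<lambda>x. partial i f x + partial i g x)"
    by (simp add: fun_eq_iff partial_add smooth_closure_differentiable)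
  then show ?case using add by (simp add: smooth_closure.add)
next
  case (mult f g)
  then have "partial i (\<lambda>x. f x * g x) = (\<lambda>x. f x * partial i g x + partial i f x * g x)"
    by (simp add: fun_eq_iff partial_mult smooth_closure_differentiable)
  then show ?case using mult by (simp add: smooth_closure.add smooth_closure.mult)
qed

lemma smooth_closure_iff: "f \<in> smooth_closure \<longleftrightarrow> smooth f"
  using smooth_coinduct[OF _ smooth_closure_differentiable smooth_closure_partial]
    smooth_closure.smooth by blast

lemmas smooth_const = smooth_closure.const[unfolded smooth_closure_iff]
lemmas smooth_coordinate = smooth_closure.coordinate[unfolded smooth_closure_iff]
lemmas smooth_exp_inverse = smooth_closure.exp_inverse[unfolded smooth_closure_iff]
lemmas smooth_add = smooth_closure.add[unfolded smooth_closure_iff]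
lemmas smooth_mult = smooth_closure.mult[unfolded smooth_closure_iff]

lemma smooth_diff: "smooth f \<Longrightarrow> smooth g \<Longrightarrow> smooth (\<lambda>x. f x - g x)"
  using smooth_add[OF _ smooth_mult[OF smooth_const[of "-1"]], of f g] by simp

lemma smooth_prod: "(\<And>i. i \<in> A \<Longrightarrow> smooth (f i)) \<Longrightarrow> smooth (\<lambda>x. \<Prod>i\<in>A. f i x)"
  by (induction A rule: infinite_finite_induct) (auto intro: smooth_const smooth_mult)

section \<open>Test functions\<close>

lemma test_functionsI:
  assumes "smooth \<phi>" "compact K" "K \<subseteq> \<Omega>" "\<And>x. x \<notin> K \<Longrightarrow> \<phi> x = 0"
  shows "\<phi> \<in> test_functions \<Omega>"
proof -
  have "closure {x. \<phi> x \<noteq> 0} \<subseteq> K"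
    using assms(2,4) by (intro closure_minimal compact_imp_closed) auto
  moreover from this have "compact (closure {x. \<phi> x \<noteq> 0})"
    using compact_Int_closed[OF assms(2) closed_closure, of "{x. \<phi> x \<noteq> 0}"]
    by (simp add: inf.absorb2)
  ultimately show ?thesis using assms by (auto simp: test_functions_def)
qed

lemma test_functionsE:
  assumes "\<phi> \<in> test_functions \<Omega>"
  obtains K where "smooth \<phi>" "compact K" "K \<subseteq> \<Omega>" "\<And>x. x \<notin> K \<Longrightarrow> \<phi> x = 0"
proof
  show "smooth \<phi>" "compact (closure {x. \<phi> x \<noteq> 0})" "closure {x. \<phi> x \<noteq> 0} \<subseteq> \<Omega>"
    using assms by (auto simp: test_functions_def)
  show "\<phi> x = 0" if "x \<notin> closure {x. \<phi> x \<noteq> 0}" for x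
    using that closure_subset[of "{x. \<phi> x \<noteq> 0}"] by auto
qed

lemma test_functions_mono: "\<Omega> \<subseteq> \<Omega>' \<Longrightarrow> test_functions \<Omega> \<subseteq> test_functions \<Omega>'"
  by (auto simp: test_functions_def)

lemma test_functions_mult:
  assumes "\<phi> \<in> test_functions \<Omega>" "smooth f"
  shows "(\<lambda>x. f x * \<phi> x) \<in> test_functions \<Omega>"
proof -
  obtain K where "smooth \<phi>" "compact K" "K \<subseteq> \<Omega>" "\<And>x. x \<notin> K \<Longrightarrow> \<phi> x = 0"
    using test_functionsE[OF assms(1)] by blast
  then show ?thesis by (intro test_functionsI[of _ K] smooth_mult assms) auto
qed

lemma test_functions_zero: "(\<lambda>x. 0) \<in> test_functions \<Omega>"
  by (rule test_functionsI[of _ "{}"]) (auto intro: smooth_const)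

lemma test_functions_add:
  assumes "\<phi> \<in> test_functions \<Omega>" "\<psi> \<in> test_functions \<Omega>"
  shows "(\<lambda>x. \<phi> x + \<psi> x) \<in> test_functions \<Omega>"
proof -
  obtain K where K: "smooth \<phi>" "compact K" "K \<subseteq> \<Omega>" "\<And>x. x \<notin> K \<Longrightarrow> \<phi> x = 0"
    using test_functionsE[OF assms(1)] by blast
  obtain L where L: "smooth \<psi>" "compact L" "L \<subseteq> \<Omega>" "\<And>x. x \<notin> L \<Longrightarrow> \<psi> x = 0"
    using test_functionsE[OF assms(2)] by blast
  show ?thesis
    using K L by (intro test_functionsI[of _ "K \<union> L"] smooth_add compact_Un) auto
qed

lemma test_functions_partial:
  assumes "\<phi> \<in> test_functions \<Omega>"
  shows "partial i \<phi> \<in> test_functions \<Omega>"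
proof -
  obtain K where K: "smooth \<phi>" "compact K" "K \<subseteq> \<Omega>" "\<And>x. x \<notin> K \<Longrightarrow> \<phi> x = 0"
    using test_functionsE[OF assms] by blast
  show ?thesis
  proof (rule test_functionsI[OF smooth_partial[OF K(1)] K(2,3)])
    fix x assume x: "x \<notin> K"
    have "((\<lambda>x. 0) has_derivative (\<lambda>h. 0)) (at x)" by simp
    then have "(\<phi> has_derivative (\<lambda>h. 0)) (at x)"
      by (rule has_derivative_transform_within_open[where s="- K"])
        (use x K in \<open>auto simp: compact_imp_closed\<close>)
    then show "partial i \<phi> x = 0" by (rule partial_eqI)
  qed
qed

section \<open>Integrals of test functions and of their derivatives\<close>

lemma test_functions_integrable:
  fixes \<phi> :: "real^'d::finite \<Rightarrow> real"
  assumes "\<phi> \<in> test_functions \<Omega>"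
  shows "integrable lborel \<phi>"
proof -
  obtain K where K: "smooth \<phi>" "compact K" "K \<subseteq> \<Omega>" "\<And>x. x \<notin> K \<Longrightarrow> \<phi> x = 0"
    using test_functionsE[OF assms] by blast
  have "integrable lborel (\<lambda>x. indicator K x *\<^sub>R \<phi> x)"
    by (rule borel_integrable_compact[OF K(2) smooth_continuous[OF K(1)]])
  moreover have "(\<lambda>x. indicator K x *\<^sub>R \<phi> x) = \<phi>"
    using K(4) by (auto simp: fun_eq_iff indicator_def)
  ultimately show ?thesis by simp
qed

lemma smooth_borel_measurable: "smooth \<phi> \<Longrightarrow> \<phi> \<in> borel_measurable borel"
  by (rule borel_measurable_continuous_onI[OF smooth_continuous])

lemma test_functions_bounded:
  assumes "\<phi> \<in> test_functions \<Omega>"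
  shows "\<exists>B\<ge>0. \<forall>x. \<bar>\<phi> x\<bar> \<le> B"
proof -
  obtain K where K: "smooth \<phi>" "compact K" "K \<subseteq> \<Omega>" "\<And>x. x \<notin> K \<Longrightarrow> \<phi> x = 0"
    using test_functionsE[OF assms] by blast
  have "bounded (\<phi> ` K)"
    by (intro compact_imp_bounded compact_continuous_image smooth_continuous K)
  then obtain B where B: "\<And>x. x \<in> K \<Longrightarrow> \<bar>\<phi> x\<bar> \<le> B" by (auto simp: bounded_iff)
  have "\<bar>\<phi> x\<bar> \<le> \<bar>B\<bar>" for x
    using B[of x] K(4)[of x] by (cases "x \<in> K") auto
  then show ?thesis by (intro exI[of _ "\<bar>B\<bar>"]) simp
qed

lemma partial_line_derivative:
  assumes "smooth f"
  shows "((\<lambda>s. f (x + s *\<^sub>R axis i 1)) has_real_derivative partial i f (x + s *\<^sub>R axis i 1)) (at s)"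
proof -
  have 1: "((\<lambda>s. x + s *\<^sub>R axis i 1) has_derivative (\<lambda>s. s *\<^sub>R axis i 1)) (at s)"
    by (auto intro!: derivative_eq_intros)
  let ?D = "frechet_derivative f (at (x + s *\<^sub>R axis i 1))"
  have 2: "(f has_derivative ?D) (at (x + s *\<^sub>R axis i 1))"
    by (rule partial_has_derivative[OF smooth_differentiable[OF assms]])
  have "?D (h *\<^sub>R axis i 1) = partial i f (x + s *\<^sub>R axis i 1) * h" for h
    using linear_cmul[OF has_derivative_linear[OF 2]] by (simp add: partial_def)
  then show ?thesis
    using has_derivative_compose[OF 1 2] by (simp add: has_field_derivative_def)
qed

text \<open>Difference quotients have integral zero by translation invariance of Lebesgue measure,
  and they converge dominatedly to the partial derivative; this takes the place of iterated
  integration.\<close>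

lemma integral_partial_eq_0:
  fixes f :: "real^'d::finite \<Rightarrow> real"
  assumes f: "f \<in> test_functions UNIV"
  shows "(LINT x|lborel. partial i f x) = 0"
proof -
  obtain K where K: "smooth f" "compact K" "K \<subseteq> UNIV" "\<And>x. x \<notin> K \<Longrightarrow> f x = 0"
    using test_functionsE[OF f] by blast
  obtain r where r: "\<And>x. x \<in> K \<Longrightarrow> norm x \<le> r"
    using compact_imp_bounded[OF K(2)] by (auto simp: bounded_iff)
  obtain B where B: "B \<ge> 0" "\<And>x. \<bar>partial i f x\<bar> \<le> B"
    using test_functions_bounded[OF test_functions_partial[OF f, of i]] by blast
  define e where "e = (axis i 1 :: real^'d)"
  define h where "h n = 1 / (real n + 1)" for n
  have h: "0 < h n" "h n \<le> 1" for n by (auto simp: h_def)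
  define q where "q n x = (f (x + h n *\<^sub>R e) - f x) / h n" for n x
  have shift: "(LINT x|lborel. f (x + c)) = (LINT x|lborel. f x)" "integrable lborel (\<lambda>x. f (x + c))" for c
  proof -
    have [measurable]: "f \<in> borel_measurable borel" by (rule smooth_borel_measurable[OF K(1)])
    have "(LINT x|distr lborel borel ((+) c). f x) = (LINT x|lborel. f (c + x))"
      by (rule integral_distr) auto
    then show "(LINT x|lborel. f (x + c)) = (LINT x|lborel. f x)"
      by (simp only: lborel_distr_plus add.commute)
    have "integrable (distr lborel borel ((+) c)) f \<longleftrightarrow> integrable lborel (\<lambda>x. f (c + x))"
      by (rule integrable_distr_eq) auto
    then show "integrable lborel (\<lambda>x. f (x + c))"
      using test_functions_integrable[OF f] by (simp only: lborel_distr_plus add.commute)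
  qed
  have q_integral: "(LINT x|lborel. q n x) = 0" for n
    unfolding q_def using shift test_functions_integrable[OF f]
    by (simp add: Bochner_Integration.integral_diff)
  have "(\<lambda>n. LINT x|lborel. q n x) \<longlonglongrightarrow> (LINT x|lborel. partial i f x)"
  proof (rule integral_dominated_convergence)
    show "partial i f \<in> borel_measurable lborel"
      using smooth_borel_measurable[OF smooth_partial[OF K(1)]] by simp
    show "q n \<in> borel_measurable lborel" for n
      using smooth_borel_measurable[OF K(1)] unfolding q_def by measurable
    show "integrable lborel (\<lambda>x. B * indicator (cball (0::real^'d) (r + 1)) x)"
      by (intro integrable_mult_right integrable_real_indicator)
        (auto simp: emeasure_bounded_finite[OF bounded_cball, simplified])
    show "AE x in lborel. (\<lambda>n. q n x) \<longlonglongrightarrow> partial i f x"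
    proof (rule AE_I2)
      fix x
      have "((\<lambda>s. (f (x + s *\<^sub>R e) - f x) / s) \<longlongrightarrow> partial i f x) (at 0)"
        using partial_line_derivative[OF K(1), of x i 0] by (simp add: DERIV_def e_def)
      moreover have "filterlim h (at 0) sequentially"
        unfolding filterlim_at
      proof
        show "h \<longlonglongrightarrow> 0"
          using LIMSEQ_inverse_real_of_nat unfolding h_def by (simp add: inverse_eq_divide add.commute)
        show "\<forall>\<^sub>F n in sequentially. h n \<in> UNIV \<and> h n \<noteq> 0" by (simp add: h_def)
      qed
      ultimately show "(\<lambda>n. q n x) \<longlonglongrightarrow> partial i f x"
        unfolding q_def by (rule filterlim_compose)
    qed
    \<comment> \<open>By the mean value theorem a quotient is a value of the derivative, hence at
      most \<open>B\<close> in absolute value. Since \<open>h n\<close> is at most 1, both points of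
      the quotient lie outside the ball of radius \<open>r\<close> around \<open>K\<close> as soon
      as \<open>norm x > r + 1\<close>.\<close>
    show "AE x in lborel. norm (q n x) \<le> B * indicator (cball 0 (r + 1)) x" for n
    proof (rule AE_I2)
      fix x
      obtain \<xi> where \<xi>: "f (x + h n *\<^sub>R e) - f (x + 0 *\<^sub>R e) = (h n - 0) * partial i f (x + \<xi> *\<^sub>R e)"
        using MVT2[OF h(1)[of n], of "\<lambda>s. f (x + s *\<^sub>R e)" "\<lambda>s. partial i f (x + s *\<^sub>R e)"]
          partial_line_derivative[OF K(1), of x i] unfolding e_def by blast
      then have "q n x = partial i f (x + \<xi> *\<^sub>R e)" using h(1)[of n] by (simp add: q_def)
      then have "\<bar>q n x\<bar> \<le> B" using B(2) by simp
      moreover have "q n x = 0" if "norm x > r + 1"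
      proof -
        have "norm e = 1" by (simp add: e_def)
        then have "norm x \<le> norm (x + h n *\<^sub>R e) + h n"
          using norm_triangle_ineq4[of "x + h n *\<^sub>R e" "h n *\<^sub>R e"] h(1)[of n] by simp
        then have "x \<notin> K" "x + h n *\<^sub>R e \<notin> K"
          using that r[of x] r[of "x + h n *\<^sub>R e"] h(2)[of n] by auto
        then show ?thesis using K(4) by (simp add: q_def)
      qed
      ultimately show "norm (q n x) \<le> B * indicator (cball 0 (r + 1)) x"
        by (cases "norm x > r + 1") (auto simp: indicator_def B(1))
    qed
  qed
  then show ?thesis by (simp add: q_integral LIMSEQ_const_iff)
qed

text \<open>With \<open>s t = exp (- 1 / t)\<close> for positive \<open>t\<close>, the cutoff is the
  product over the coordinates of \<open>s (n (x_i - a_i) - 1) * s (n (b_i - x_i) - 1)\<close>. The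
  shift by -1 confines the support to the closed box shrunk by \<open>1 / n\<close>; inside the open
  box all arguments tend to infinity, where \<open>s\<close> tends to 1.\<close>

lemma test_functions_box_limit:
  fixes a b :: "real^'d::finite"
  obtains \<beta> where "\<And>n::nat. \<beta> n \<in> test_functions (box a b)" "\<And>n x. 0 \<le> \<beta> n x \<and> \<beta> n x \<le> 1"
    "\<And>x. x \<in> box a b \<Longrightarrow> (\<lambda>n. \<beta> n x) \<longlonglongrightarrow> 1"
proof -
  define s where "s = exp_inverse 1"
  have s: "s t = (if t > 0 then exp (- (1 / t)) else 0)" for t by (simp add: s_def exp_inverse_def)
  have s01: "0 \<le> s t" "s t \<le> 1" for t by (auto simp: s)
  have s_lim: "(\<lambda>n. s (real n * c + d)) \<longlonglongrightarrow> 1" if "c > 0" for c d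
  proof -
    have lim: "filterlim (\<lambda>n. real n * c + d) at_top sequentially"
      using filterlim_tendsto_add_at_top[OF tendsto_const[of d]
          filterlim_at_top_mult_tendsto_pos[OF tendsto_const that filterlim_real_sequentially]]
      by (simp add: add.commute)
    have "((\<lambda>y::real. exp (- inverse y)) \<longlongrightarrow> exp (- 0)) at_top"
      by (intro tendsto_exp tendsto_minus tendsto_inverse_0_at_top filterlim_ident)
    then have "((\<lambda>y::real. exp (- (1 / y))) \<longlongrightarrow> 1) at_top" by (simp add: inverse_eq_divide)
    moreover have "\<forall>\<^sub>F y in at_top. exp (- (1 / y)) = s y"
      using eventually_gt_at_top[of 0] by eventually_elim (simp add: s)
    ultimately have "(s \<longlongrightarrow> 1) at_top" by (rule Lim_transform_eventually)
    then show ?thesis by (rule filterlim_compose[OF _ lim])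
  qed
  define \<beta> where "\<beta> n x = (\<Prod>i\<in>UNIV. s (real n * x $ i + (- (real n * a $ i) - 1))
      * s ((- real n) * x $ i + (real n * b $ i - 1)))" for n and x :: "real^'d"
  show thesis
  proof
    fix n
    define K where "K = cbox (\<chi> i. a $ i + 1 / real n) (\<chi> i. b $ i - 1 / real n)"
    show "\<beta> n \<in> test_functions (box a b)"
    \<comment> \<open>For \<open>n = 0\<close> the convention \<open>1 / 0 = 0\<close> makes
      \<open>K\<close> the unshrunk closed box, which need not lie in the open one; but then all
      arguments are -1 and the function is zero.\<close>
    proof (cases "n = 0")
      case True
      then have "\<beta> n = (\<lambda>x. 0)" by (auto simp: \<beta>_def s fun_eq_iff)
      then show ?thesis by (simp add: test_functions_zero)
    next
      case False
      show ?thesis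
      proof (rule test_functionsI[of _ K])
        show "smooth (\<beta> n)"
          unfolding \<beta>_def s_def by (intro smooth_prod smooth_mult smooth_exp_inverse)
        show "compact K" by (simp add: K_def)
        have "0 < 1 / real n" using False by simp
        show "K \<subseteq> box a b"
        proof
          fix y assume "y \<in> K"
          then have y: "a $ i + 1 / real n \<le> y $ i \<and> y $ i \<le> b $ i - 1 / real n" for i
            by (simp add: K_def mem_box_cart)
          have "a $ i < y $ i \<and> y $ i < b $ i" for i
            using y[of i] \<open>0 < 1 / real n\<close> by linarith
          then show "y \<in> box a b" by (simp add: mem_box_cart)
        qed
        fix x assume "x \<notin> K"
        then obtain i where "x $ i < a $ i + 1 / real n \<or> x $ i > b $ i - 1 / real n"
          by (auto simp: K_def mem_box_cart not_le)
        then have "real n * x $ i + (- (real n * a $ i) - 1) \<le> 0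
            \<or> (- real n) * x $ i + (real n * b $ i - 1) \<le> 0"
          using False by (auto simp: field_simps)
        then have "s (real n * x $ i + (- (real n * a $ i) - 1)) * s ((- real n) * x $ i + (real n * b $ i - 1)) = 0"
          by (auto simp: s)
        then show "\<beta> n x = 0" unfolding \<beta>_def by (intro prod_zero) auto
      qed
    qed
  next
    fix n x
    show "0 \<le> \<beta> n x \<and> \<beta> n x \<le> 1"
      unfolding \<beta>_def using s01 by (auto intro!: prod_nonneg prod_le_1 mult_le_one)
  next
    fix x assume x: "x \<in> box a b"
    have "(\<lambda>n. s (real n * x $ i + (- (real n * a $ i) - 1)) * s ((- real n) * x $ i + (real n * b $ i - 1)))
        \<longlonglongrightarrow> 1 * 1" for i
      using x s_lim[of "x $ i - a $ i" "-1"] s_lim[of "b $ i - x $ i" "-1"]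
      by (intro tendsto_mult) (auto simp: mem_box_cart algebra_simps)
    then have "(\<lambda>n. \<beta> n x) \<longlonglongrightarrow> (\<Prod>i\<in>(UNIV::'d set). 1 * 1)"
      unfolding \<beta>_def by (intro tendsto_prod)
    then show "(\<lambda>n. \<beta> n x) \<longlonglongrightarrow> 1" by simp
  qed
qed

text \<open>One minus the product of the complements imitates the union of the first
  \<open>n\<close> boxes while staying smooth, bounded by 1 and compactly supported. At a point of
  \<open>W\<close> the factor of one box containing it tends to 0, and the remaining factors lie
  between 0 and 1, so their growing number does no harm.\<close>

lemma test_functions_open_limit:
  fixes W :: "(real^'d::finite) set"
  assumes "open W"
  obtains \<phi> where "\<And>n::nat. \<phi> n \<in> test_functions W" "\<And>n x. \<bar>\<phi> n x\<bar> \<le> 1"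
    "\<And>x. (\<lambda>n. \<phi> n x) \<longlonglongrightarrow> indicator W x"
proof -
  obtain D where D: "countable D" "\<And>X. X \<in> D \<Longrightarrow> \<exists>a b. X = box a b" "\<Union>D = W"
    using open_countable_Union_open_box[OF assms] by metis
  \<comment> \<open>Adding the empty box makes the family nonempty, as \<open>from_nat_into\<close>
    requires, also when \<open>W\<close> is empty.\<close>
  define D' where "D' = insert {} D"
  have D': "countable D'" "D' \<noteq> {}" "\<Union>D' = W" using D by (auto simp: D'_def)
  have "\<exists>\<beta>. (\<forall>n::nat. \<beta> n \<in> test_functions X) \<and> (\<forall>n x. 0 \<le> \<beta> n x \<and> \<beta> n x \<le> 1)
      \<and> (\<forall>x\<in>X. (\<lambda>n. \<beta> n x) \<longlonglongrightarrow> 1)" if X: "X \<in> D'" for X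
  proof -
    have "{} = box (0 :: real^'d) 0" by (auto simp: mem_box_cart)
    then obtain a b where "X = box a b"
      using X D(2) unfolding D'_def by blast
    then show ?thesis using test_functions_box_limit[of a b] by metis
  qed
  then obtain \<beta> where \<beta>: "\<And>X n. X \<in> D' \<Longrightarrow> \<beta> X n \<in> test_functions X"
    "\<And>X n x. X \<in> D' \<Longrightarrow> 0 \<le> \<beta> X n x \<and> \<beta> X n x \<le> 1"
    "\<And>X x. X \<in> D' \<Longrightarrow> x \<in> X \<Longrightarrow> (\<lambda>n. \<beta> X n x) \<longlonglongrightarrow> 1"
    by metis
  define B where "B = from_nat_into D'"
  have B: "B j \<in> D'" for j by (simp add: B_def from_nat_into D')
  define \<phi> where "\<phi> n x = 1 - (\<Prod>j<n. 1 - \<beta> (B j) n x)" for n :: nat and x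
  show thesis
  proof
    fix n
    have "\<exists>K. compact K \<and> K \<subseteq> W \<and> (\<forall>x. x \<notin> K \<longrightarrow> \<beta> (B j) n x = 0)" for j
      using test_functionsE[OF \<beta>(1)[OF B]] B D'(3) by (metis Sup_upper order_trans)
    then obtain K where K: "\<And>j. compact (K j)" "\<And>j. K j \<subseteq> W" "\<And>j x. x \<notin> K j \<Longrightarrow> \<beta> (B j) n x = 0"
      by metis
    show "\<phi> n \<in> test_functions W"
    proof (rule test_functionsI[of _ "\<Union>j<n. K j"])
      have "smooth (\<beta> (B j) n)" for j
        using \<beta>(1)[OF B] by (auto simp: test_functions_def)
      then show "smooth (\<phi> n)"
        unfolding \<phi>_def by (intro smooth_diff smooth_const smooth_prod)
    qed (use K in \<open>auto simp: \<phi>_def intro!: compact_UN\<close>)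
    fix x
    have "0 \<le> (\<Prod>j<n. 1 - \<beta> (B j) n x)" "(\<Prod>j<n. 1 - \<beta> (B j) n x) \<le> 1"
      using \<beta>(2)[OF B] by (auto intro!: prod_nonneg prod_le_1)
    then show "\<bar>\<phi> n x\<bar> \<le> 1" by (simp add: \<phi>_def)
  next
    fix x
    show "(\<lambda>n. \<phi> n x) \<longlonglongrightarrow> indicator W x"
    proof (cases "x \<in> W")
      case False
      have "\<beta> (B j) n x = 0" for j n
      proof -
        have "x \<notin> B j" using False B D'(3) by blast
        then show ?thesis using test_functionsE[OF \<beta>(1)[OF B]] by (metis subsetD)
      qed
      then show ?thesis using False by (simp add: \<phi>_def)
    next
      case True
      then obtain j where j: "x \<in> B j"
        using D' range_from_nat_into[of D'] unfolding B_def by (metis Union_iff imageE)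
      have "(\<lambda>n. 1 - \<phi> n x) \<longlonglongrightarrow> 0"
      proof (rule Lim_null_comparison)
        show "\<forall>\<^sub>F n in sequentially. norm (1 - \<phi> n x) \<le> 1 - \<beta> (B j) n x"
          using eventually_gt_at_top[of j]
        proof eventually_elim
          fix n assume "j < n"
          then have "(\<Prod>j<n. 1 - \<beta> (B j) n x)
              = (1 - \<beta> (B j) n x) * (\<Prod>i\<in>{..<n} - {j}. 1 - \<beta> (B i) n x)"
            by (intro prod.remove) auto
          also have "\<dots> \<le> (1 - \<beta> (B j) n x) * 1"
            using \<beta>(2)[OF B] by (intro mult_left_mono prod_le_1) auto
          finally have "(\<Prod>j<n. 1 - \<beta> (B j) n x) \<le> 1 - \<beta> (B j) n x" by simp
          moreover have "0 \<le> (\<Prod>j<n. 1 - \<beta> (B j) n x)"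
            using \<beta>(2)[OF B] by (intro prod_nonneg) auto
          ultimately show "norm (1 - \<phi> n x) \<le> 1 - \<beta> (B j) n x" by (simp add: \<phi>_def)
        qed
        show "(\<lambda>n. 1 - \<beta> (B j) n x) \<longlonglongrightarrow> 0"
          using tendsto_diff[OF tendsto_const[of 1] \<beta>(3)[OF B j]] by simp
      qed
      then show ?thesis using True tendsto_diff[OF tendsto_const[of 1]] by fastforce
    qed
  qed
qed

section \<open>Functions on a bounded domain\<close>

lemma subspace_closure:
  fixes S :: "'a::real_normed_vector set"
  assumes "subspace S"
  shows "subspace (closure S)"
proof (rule subspaceI)
  show "0 \<in> closure S" using subspace_0[OF assms] closure_subset by blast
  fix x y and c :: real assume "x \<in> closure S"
  then obtain f where f: "\<And>n. f n \<in> S" "f \<longlonglongrightarrow> x" by (auto simp: closure_sequential)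
  show "c *\<^sub>R x \<in> closure S"
    unfolding closure_sequential using f subspace_scale[OF assms]
    by (intro exI[of _ "\<lambda>n. c *\<^sub>R f n"] conjI allI tendsto_scaleR tendsto_const) blast+
  assume "y \<in> closure S"
  then obtain g where g: "\<And>n. g n \<in> S" "g \<longlonglongrightarrow> y" by (auto simp: closure_sequential)
  show "x + y \<in> closure S"
    unfolding closure_sequential using f g subspace_add[OF assms]
    by (intro exI[of _ "\<lambda>n. f n + g n"] conjI allI tendsto_add) blast+
qed

locale bounded_domain =
  fixes \<Omega> :: "(real^'d::finite) set"
  assumes open_\<Omega>: "open \<Omega>" and bounded_\<Omega>: "bounded \<Omega>"
begin

lemma \<Omega>_sets [measurable, simp]: "\<Omega> \<in> sets lebesgue"
  using open_\<Omega> by (auto intro: borel_open)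

lemma \<Omega>_Int_space: "\<Omega> \<inter> space lebesgue \<in> sets lebesgue"
  by simp

lemma measurable_on_\<Omega>:
  "u \<in> borel_measurable (lebesgue_on \<Omega>) \<longleftrightarrow> (\<lambda>x. indicator \<Omega> x * u x :: real) \<in> borel_measurable lebesgue"
  using borel_measurable_restrict_space_iff[OF \<Omega>_Int_space, of u] by simp

lemma integrable_on_\<Omega>:
  "integrable (lebesgue_on \<Omega>) u \<longleftrightarrow> integrable lebesgue (\<lambda>x. indicator \<Omega> x * u x :: real)"
  using integrable_restrict_space[OF \<Omega>_Int_space, of u] by simp

lemma integral_on_\<Omega>:
  "(LINT x|lebesgue_on \<Omega>. u x) = (LINT x|lebesgue. indicator \<Omega> x * u x :: real)"
  using integral_restrict_space[OF \<Omega>_Int_space, of u] by simp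

lemma AE_on_\<Omega>: "(AE x in lebesgue_on \<Omega>. R x) \<longleftrightarrow> (AE x in lebesgue. x \<in> \<Omega> \<longrightarrow> R x)"
  by (rule AE_restrict_space_iff[OF \<Omega>_Int_space])

lemma indicator_square: "(indicator A x * u x :: real)\<^sup>2 = indicator A x * (u x)\<^sup>2"
  by (simp add: indicator_def)

lemma L2_iff: "u \<in> L2 \<Omega> \<longleftrightarrow> (\<lambda>x. indicator \<Omega> x * u x) \<in> square_integrable lebesgue"
  by (simp add: L2_def square_integrable_def measurable_on_\<Omega> integrable_on_\<Omega> indicator_square)

lemma L2_eq: "L2 \<Omega> = square_integrable (lebesgue_on \<Omega>)"
  by (simp add: L2_def square_integrable_def)

lemmas L2_closed =
  square_integrable_add[where M="lebesgue_on \<Omega>", folded L2_eq]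
  square_integrable_diff[where M="lebesgue_on \<Omega>", folded L2_eq]
  square_integrable_cmult[where M="lebesgue_on \<Omega>", folded L2_eq]

definition l2_class :: "(real^'d \<Rightarrow> real) \<Rightarrow> (real^'d) l2" where
  "l2_class u = abs_l2 (\<lambda>x. indicator \<Omega> x * u x)"

lemma l2_class_inner:
  assumes "u \<in> L2 \<Omega>" "v \<in> L2 \<Omega>"
  shows "l2_class u \<bullet> l2_class v = L2_inner \<Omega> u v"
proof -
  have "(\<lambda>x. indicator \<Omega> x * u x * (indicator \<Omega> x * v x)) = (\<lambda>x. indicator \<Omega> x * (u x * v x) :: real)"
    by (auto simp: indicator_def)
  then show ?thesis
    using assms by (simp add: l2_class_def abs_l2_inner L2_iff L2_inner_def integral_on_\<Omega>)
qed

lemma norm_l2_class: "u \<in> L2 \<Omega> \<Longrightarrow> norm (l2_class u) = L2_norm \<Omega> u"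
  by (simp add: norm_eq_sqrt_inner l2_class_inner L2_norm_def)

lemma l2_class_add: "u \<in> L2 \<Omega> \<Longrightarrow> v \<in> L2 \<Omega> \<Longrightarrow> l2_class (\<lambda>x. u x + v x) = l2_class u + l2_class v"
  by (simp add: l2_class_def distrib_left abs_l2_add L2_iff)

lemma l2_class_scale: "u \<in> L2 \<Omega> \<Longrightarrow> l2_class (\<lambda>x. r * u x) = r *\<^sub>R l2_class u"
  using abs_l2_scale[of "\<lambda>x. indicator \<Omega> x * u x" r]
  by (simp add: l2_class_def L2_iff mult.left_commute)

lemma l2_class_diff: "u \<in> L2 \<Omega> \<Longrightarrow> v \<in> L2 \<Omega> \<Longrightarrow> l2_class (\<lambda>x. u x - v x) = l2_class u - l2_class v"
  by (simp add: l2_class_def right_diff_distrib abs_l2_diff L2_iff)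

lemma l2_class_eq_iff: "u \<in> L2 \<Omega> \<Longrightarrow> v \<in> L2 \<Omega> \<Longrightarrow> l2_class u = l2_class v \<longleftrightarrow> ae_eq \<Omega> u v"
  by (simp add: l2_class_def abs_l2_eq_iff L2_iff ae_eq_def AE_on_\<Omega> indicator_def)

lemma test_functions_indicator:
  assumes "\<phi> \<in> test_functions \<Omega>"
  shows "indicator \<Omega> x * \<phi> x = \<phi> x"
proof -
  obtain K where "smooth \<phi>" "compact K" "K \<subseteq> \<Omega>" "\<And>x. x \<notin> K \<Longrightarrow> \<phi> x = 0"
    using test_functionsE[OF assms] by blast
  then show ?thesis by (cases "x \<in> \<Omega>") auto
qed

lemma test_functions_measurable: "\<phi> \<in> test_functions \<Omega> \<Longrightarrow> \<phi> \<in> borel_measurable lborel"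
  by (simp add: test_functions_def smooth_borel_measurable)

lemma test_functions_L2:
  assumes "\<phi> \<in> test_functions \<Omega>"
  shows "\<phi> \<in> L2 \<Omega>"
proof -
  have [measurable]: "\<phi> \<in> borel_measurable borel"
    using assms by (simp add: test_functions_def smooth_borel_measurable)
  have "(\<lambda>x. \<phi> x * \<phi> x) \<in> test_functions \<Omega>"
    using assms by (intro test_functions_mult) (auto simp: test_functions_def)
  from test_functions_integrable[OF this] have "integrable lebesgue (\<lambda>x. (\<phi> x)\<^sup>2)"
    by (subst integrable_completion) (auto simp: power2_eq_square)
  moreover have "\<phi> \<in> borel_measurable lebesgue" by (rule measurable_completion) simp
  ultimately show ?thesis
    by (simp add: L2_iff test_functions_indicator[OF assms] square_integrable_def)
qed

lemma L2_inner_test: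
  assumes "\<phi> \<in> test_functions \<Omega>"
  shows "L2_inner \<Omega> u \<phi> = (LINT x|lebesgue. u x * \<phi> x)"
proof -
  have "indicator \<Omega> x * (u x * \<phi> x) = u x * \<phi> x" for x
    using test_functions_indicator[OF assms, of x] by (simp add: mult.left_commute)
  then show ?thesis by (simp only: L2_inner_def integral_on_\<Omega>)
qed

lemma indicator_square_integrable:
  assumes "A \<in> sets lebesgue" "A \<subseteq> \<Omega>"
  shows "indicator A \<in> square_integrable lebesgue"
    "(norm (abs_l2 (indicator A)))\<^sup>2 = measure lebesgue A"
proof -
  have "A \<in> lmeasurable"
    using assms bounded_\<Omega> by (intro bounded_set_imp_lmeasurable) (auto intro: bounded_subset)
  moreover have sq: "(indicator A x :: real)\<^sup>2 = indicator A x" for x by (simp add: indicator_def)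
  ultimately show 1: "indicator A \<in> square_integrable lebesgue"
    using assms by (simp add: square_integrable_def fmeasurable_def)
  show "(norm (abs_l2 (indicator A)))\<^sup>2 = measure lebesgue A"
    using assms by (simp add: norm_abs_l2[OF 1] sq)
qed

text \<open>The integral of \<open>g\<close> vanishes over open sets, whose indicators are limits of test functions, hence
  over measurable sets by outer regularity, in particular over \<open>{g > 0}\<close> and \<open>{g < 0}\<close>.\<close>

lemma L2_orthogonal_test_functions:
  assumes g: "g \<in> L2 \<Omega>" and orth: "\<And>\<phi>. \<phi> \<in> test_functions \<Omega> \<Longrightarrow> L2_inner \<Omega> g \<phi> = 0"
  shows "l2_class g = 0"
proof -
  define g0 where "g0 x = indicator \<Omega> x * g x" for x
  have g0: "g0 \<in> square_integrable lebesgue" using g by (simp add: g0_def[abs_def] L2_iff)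
  have g0_meas[measurable]: "g0 \<in> borel_measurable lebesgue"
    using g0 by (simp add: square_integrable_def)
  have g0_ind: "integrable lebesgue (\<lambda>x. g0 x * indicator A x)" if "A \<in> sets lebesgue" "A \<subseteq> \<Omega>" for A
    by (rule square_integrable_mult[OF g0 indicator_square_integrable(1)[OF that]])
  have g0_int: "integrable lebesgue g0"
  proof -
    have "(\<lambda>x. g0 x * indicator \<Omega> x) = g0"
      by (auto simp: g0_def indicator_def fun_eq_iff)
    then show ?thesis using g0_ind[of \<Omega>] by simp
  qed
  have open_W: "(LINT x|lebesgue. g0 x * indicator W x) = 0" if W: "open W" "W \<subseteq> \<Omega>" for W
  proof -
    obtain \<phi> where \<phi>: "\<And>n::nat. \<phi> n \<in> test_functions W" "\<And>n x. \<bar>\<phi> n x\<bar> \<le> 1"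
      "\<And>x. (\<lambda>n. \<phi> n x) \<longlonglongrightarrow> indicator W x"
      using test_functions_open_limit[OF W(1)] by metis
    have \<phi>\<Omega>: "\<phi> n \<in> test_functions \<Omega>" for n
      using \<phi>(1) test_functions_mono[OF W(2)] by blast
    have [measurable]: "\<phi> n \<in> borel_measurable lebesgue" for n
      by (rule measurable_completion[OF test_functions_measurable[OF \<phi>\<Omega>]])
    have [measurable]: "W \<in> sets lebesgue" using W(1) by (auto intro: borel_open)
    have "(\<lambda>n. LINT x|lebesgue. g0 x * \<phi> n x) \<longlonglongrightarrow> (LINT x|lebesgue. g0 x * indicator W x)"
    proof (rule integral_dominated_convergence[where w="\<lambda>x. \<bar>g0 x\<bar>"])
      show "AE x in lebesgue. (\<lambda>n. g0 x * \<phi> n x) \<longlonglongrightarrow> g0 x * indicator W x"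
        by (intro AE_I2 tendsto_mult tendsto_const \<phi>)
      show "AE x in lebesgue. norm (g0 x * \<phi> n x) \<le> \<bar>g0 x\<bar>" for n
        using \<phi>(2) by (intro AE_I2) (simp add: abs_mult mult_left_le)
    qed (use g0_int in auto)
    moreover have "(LINT x|lebesgue. g0 x * \<phi> n x) = 0" for n
    proof -
      have "g0 x * \<phi> n x = g x * \<phi> n x" for x
        using test_functions_indicator[OF \<phi>\<Omega>, of x n] by (simp add: g0_def mult_ac)
      then show ?thesis using orth[OF \<phi>\<Omega>, of n] by (simp only: L2_inner_test[OF \<phi>\<Omega>])
    qed
    ultimately show ?thesis by (simp add: LIMSEQ_const_iff)
  qed
  have meas_A: "(LINT x|lebesgue. g0 x * indicator A x) = 0" if A: "A \<in> sets lebesgue" "A \<subseteq> \<Omega>" for A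
  proof -
    have bound: "\<bar>LINT x|lebesgue. g0 x * indicator A x\<bar> \<le> norm (abs_l2 g0) * e" if e: "e > 0" for e
    proof -
      \<comment> \<open>The measure is taken below \<open>e\<^sup>2\<close> because the norm of an
        indicator is the square root of the measure; Cauchy-Schwarz then bounds the error by
        \<open>e\<close> times the norm of \<open>g0\<close>.\<close>
      obtain T where T: "open T" "A \<subseteq> T" "T - A \<in> lmeasurable" "emeasure lebesgue (T - A) < ennreal (e\<^sup>2)"
        using sets_lebesgue_outer_open[OF A(1), of "e\<^sup>2"] e by auto
      define B where "B = (T \<inter> \<Omega>) - A"
      have T\<Omega>: "open (T \<inter> \<Omega>)" using T(1) open_\<Omega> by auto
      have B: "B \<in> sets lebesgue" "B \<subseteq> \<Omega>"
        using T\<Omega> A(1) by (auto simp: B_def intro!: sets.Diff borel_open)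
      have "emeasure lebesgue B \<le> emeasure lebesgue (T - A)"
        using T(3) by (intro emeasure_mono) (auto simp: B_def)
      then have "emeasure lebesgue B \<le> ennreal (e\<^sup>2)" using T(4) by simp
      then have "measure lebesgue B \<le> e\<^sup>2" by (simp add: measure_def enn2real_leI)
      then have "(norm (abs_l2 (indicator B :: _ \<Rightarrow> real)))\<^sup>2 \<le> e\<^sup>2"
        by (simp add: indicator_square_integrable(2)[OF B])
      then have nB: "norm (abs_l2 (indicator B)) \<le> e" using e by (auto intro: power2_le_imp_le)
      have "(\<lambda>x. g0 x * indicator A x) = (\<lambda>x. g0 x * indicator (T \<inter> \<Omega>) x - g0 x * indicator B x)"
        using A(2) T(2) by (auto simp: B_def indicator_def fun_eq_iff)
      then have "(LINT x|lebesgue. g0 x * indicator A x)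
          = (LINT x|lebesgue. g0 x * indicator (T \<inter> \<Omega>) x) - (LINT x|lebesgue. g0 x * indicator B x)"
        using g0_ind[of "T \<inter> \<Omega>"] g0_ind[OF B] T\<Omega>
        by (simp add: Bochner_Integration.integral_diff borel_open)
      also have "\<dots> = - (abs_l2 g0 \<bullet> abs_l2 (indicator B))"
        using open_W[OF T\<Omega>] by (simp add: abs_l2_inner[OF g0 indicator_square_integrable(1)[OF B]])
      finally have "\<bar>LINT x|lebesgue. g0 x * indicator A x\<bar> \<le> norm (abs_l2 g0) * norm (abs_l2 (indicator B))"
        using Cauchy_Schwarz_ineq2 by simp
      also have "\<dots> \<le> norm (abs_l2 g0) * e" using nB by (intro mult_left_mono) auto
      finally show ?thesis .
    qed
    have "\<bar>LINT x|lebesgue. g0 x * indicator A x\<bar> \<le> 0 + e" if "e > 0" for e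
    proof -
      have p: "norm (abs_l2 g0) + 1 > 0" using norm_ge_zero[of "abs_l2 g0"] by linarith
      have "\<bar>LINT x|lebesgue. g0 x * indicator A x\<bar> \<le> norm (abs_l2 g0) * (e / (norm (abs_l2 g0) + 1))"
        using p that by (intro bound) simp
      also have "\<dots> \<le> e" using p that by (simp add: field_simps)
      finally show ?thesis by simp
    qed
    then have "\<bar>LINT x|lebesgue. g0 x * indicator A x\<bar> \<le> 0" by (rule field_le_epsilon)
    then show ?thesis by simp
  qed
  define A where "A = {x. 0 < g0 x}"
  define B where "B = {x. g0 x < 0}"
  have A: "A \<in> sets lebesgue" "A \<subseteq> \<Omega>" and B: "B \<in> sets lebesgue" "B \<subseteq> \<Omega>"
    using borel_measurable_less[OF borel_measurable_const g0_meas, of 0]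
      borel_measurable_less[OF g0_meas borel_measurable_const, of 0]
    by (auto simp: A_def B_def g0_def indicator_def split: if_splits)
  have "AE x in lebesgue. g0 x * indicator A x = 0"
    using meas_A[OF A] g0_ind[OF A]
    by (subst (asm) integral_nonneg_eq_0_iff_AE) (auto simp: A_def indicator_def)
  moreover have "AE x in lebesgue. - (g0 x * indicator B x) = 0"
    using meas_A[OF B] g0_ind[OF B]
    by (subst integral_nonneg_eq_0_iff_AE[symmetric]) (auto simp: B_def indicator_def)
  ultimately have "AE x in lebesgue. g0 x = 0"
    by eventually_elim (auto simp: A_def B_def indicator_def split: if_splits)
  then have "abs_l2 g0 = abs_l2 (\<lambda>x. 0)"
    using g0 by (simp add: abs_l2_eq_iff square_integrable_zero)
  then show ?thesis by (simp add: l2_class_def g0_def[abs_def] zero_l2_def)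
qed

section \<open>Weak gradients of test functions and the Poincare inequality\<close>

lemma integral_lebesgue_partial:
  assumes "\<phi> \<in> test_functions \<Omega>"
  shows "(LINT x|lebesgue. partial i \<phi> x) = 0"
proof -
  have "\<phi> \<in> test_functions UNIV" using assms test_functions_mono by blast
  then show ?thesis
    using test_functions_measurable[OF test_functions_partial[OF assms]]
    by (simp add: integral_completion integral_partial_eq_0)
qed

lemma integral_lebesgue_test_mult:
  assumes "\<phi> \<in> test_functions \<Omega>" "smooth f"
  shows "integrable lebesgue (\<lambda>x. f x * \<phi> x)"
  using test_functions_integrable[OF test_functions_mult[OF assms]]
    test_functions_measurable[OF test_functions_mult[OF assms]]
  by (simp add: integrable_completion)

text \<open>Integration by parts: the derivative of the product of two test functions has integral
  zero, and the product rule splits it.\<close>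

lemma test_functions_weak_grad:
  assumes \<phi>: "\<phi> \<in> test_functions \<Omega>"
  shows "is_weak_grad \<Omega> \<phi> (\<lambda>x. \<chi> i. partial i \<phi> x)"
  unfolding is_weak_grad_def
proof (intro conjI allI ballI)
  fix i
  show "(\<lambda>x. (\<chi> i. partial i \<phi> x) $ i) \<in> L2 \<Omega>"
    using test_functions_L2[OF test_functions_partial[OF \<phi>]] by simp
  fix \<psi> assume \<psi>: "\<psi> \<in> test_functions \<Omega>"
  have smooth: "smooth \<phi>" "smooth \<psi>" using \<phi> \<psi> by (auto simp: test_functions_def)
  have "0 = (LINT x|lebesgue. partial i (\<lambda>x. \<phi> x * \<psi> x) x)"
    using integral_lebesgue_partial[OF test_functions_mult[OF \<psi> smooth(1)]] by simp
  also have "\<dots> = (LINT x|lebesgue. \<phi> x * partial i \<psi> x + partial i \<phi> x * \<psi> x)"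
    by (simp add: partial_mult smooth_differentiable smooth)
  also have "\<dots> = (LINT x|lebesgue. \<phi> x * partial i \<psi> x) + (LINT x|lebesgue. partial i \<phi> x * \<psi> x)"
    by (intro Bochner_Integration.integral_add integral_lebesgue_test_mult
        test_functions_partial \<psi> smooth smooth_partial)
  finally show "L2_inner \<Omega> \<phi> (partial i \<psi>) = - L2_inner \<Omega> (\<lambda>x. (\<chi> i. partial i \<phi> x) $ i) \<psi>"
    by (simp add: L2_inner_test \<psi> test_functions_partial)
qed

text \<open>By integration of \<open>\<partial>\<^sub>i (x\<^sub>i \<phi>\<^sup>2)\<close>.\<close>

lemma poincare_test_functions:
  assumes r: "r \<ge> 0" "\<And>x. x \<in> \<Omega> \<Longrightarrow> norm x \<le> r" and \<phi>: "\<phi> \<in> test_functions \<Omega>"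
  shows "norm (l2_class \<phi>) \<le> 2 * r * norm (l2_class (partial i \<phi>))"
proof -
  have smooth: "smooth \<phi>" using \<phi> by (auto simp: test_functions_def)
  \<comment> \<open>Writing \<open>x_i \<phi>^2\<close> as \<open>\<psi> \<phi>\<close> keeps it a
    product of test functions. Its derivative in direction \<open>i\<close> is twice the derivative
    of \<open>\<phi>\<close> times \<open>\<psi>\<close>, plus \<open>\<phi>^2\<close>, and on
    \<open>\<Omega>\<close> the absolute value of \<open>\<psi>\<close> is at most \<open>r\<close>
    times that of \<open>\<phi>\<close>.\<close>
  define \<psi> where "\<psi> x = x $ i * \<phi> x" for x
  have \<psi>: "\<psi> \<in> test_functions \<Omega>"
    unfolding \<psi>_def by (rule test_functions_mult[OF \<phi> smooth_coordinate])
  then have smooth_\<psi>: "smooth \<psi>" by (auto simp: test_functions_def)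
  have partial_\<psi>: "partial i \<psi> x = x $ i * partial i \<phi> x + \<phi> x" for x
    unfolding \<psi>_def[abs_def]
    by (subst partial_mult) (auto intro: smooth_differentiable smooth smooth_coordinate simp: partial_coordinate)
  have "0 = (LINT x|lebesgue. partial i (\<lambda>x. \<psi> x * \<phi> x) x)"
    using integral_lebesgue_partial[OF test_functions_mult[OF \<phi> smooth_\<psi>]] by simp
  also have "\<dots> = (LINT x|lebesgue. 2 * (partial i \<phi> x * \<psi> x) + \<phi> x * \<phi> x)"
    by (simp add: partial_mult smooth_differentiable smooth smooth_\<psi> partial_\<psi>)
      (simp add: \<psi>_def algebra_simps)
  also have "\<dots> = 2 * (LINT x|lebesgue. partial i \<phi> x * \<psi> x) + (LINT x|lebesgue. \<phi> x * \<phi> x)"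
    using integral_lebesgue_test_mult[OF \<phi> smooth] integral_lebesgue_test_mult[OF \<psi> smooth_partial[OF smooth]]
    by (simp add: Bochner_Integration.integral_add)
  finally have "L2_inner \<Omega> \<phi> \<phi> = - (2 * L2_inner \<Omega> (partial i \<phi>) \<psi>)"
    by (simp add: L2_inner_test \<phi> \<psi>)
  then have "(norm (l2_class \<phi>))\<^sup>2 = - (2 * (l2_class (partial i \<phi>) \<bullet> l2_class \<psi>))"
    by (simp only: power2_norm_eq_inner l2_class_inner test_functions_L2 test_functions_partial \<phi> \<psi>)
  also have "\<dots> \<le> 2 * (norm (l2_class (partial i \<phi>)) * norm (l2_class \<psi>))"
    using Cauchy_Schwarz_ineq2[of "l2_class (partial i \<phi>)" "l2_class \<psi>"] by linarith
  also have "\<dots> \<le> 2 * (norm (l2_class (partial i \<phi>)) * (r * norm (l2_class \<phi>)))"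
  proof (intro mult_left_mono)
    have "(norm (l2_class \<psi>))\<^sup>2 = (LINT x|lebesgue. \<psi> x * \<psi> x)"
      using test_functions_L2[OF \<psi>] by (simp add: power2_norm_eq_inner l2_class_inner L2_inner_test[OF \<psi>])
    also have "\<dots> \<le> (LINT x|lebesgue. r\<^sup>2 * (\<phi> x * \<phi> x))"
    proof (rule integral_mono)
      show "integrable lebesgue (\<lambda>x. \<psi> x * \<psi> x)" by (rule integral_lebesgue_test_mult[OF \<psi> smooth_\<psi>])
      show "integrable lebesgue (\<lambda>x. r\<^sup>2 * (\<phi> x * \<phi> x))"
        using integral_lebesgue_test_mult[OF \<phi> smooth] by simp
      fix x
      show "\<psi> x * \<psi> x \<le> r\<^sup>2 * (\<phi> x * \<phi> x)"
      proof (cases "x \<in> \<Omega>")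
        case True
        then have "\<bar>x $ i\<bar> \<le> r" using r(2) component_le_norm_cart[of x i] by (meson order_trans)
        then have "(x $ i)\<^sup>2 \<le> r\<^sup>2" using power_mono[of "\<bar>x $ i\<bar>" r 2] by simp
        then have "(x $ i)\<^sup>2 * (\<phi> x)\<^sup>2 \<le> r\<^sup>2 * (\<phi> x)\<^sup>2" by (rule mult_right_mono) simp
        then show ?thesis by (simp add: \<psi>_def power2_eq_square mult_ac)
      next
        case False
        then have "\<phi> x = 0" using test_functions_indicator[OF \<phi>, of x] by simp
        then show ?thesis by (simp add: \<psi>_def)
      qed
    qed
    also have "\<dots> = (r * norm (l2_class \<phi>))\<^sup>2"
      using test_functions_L2[OF \<phi>]
      by (simp add: power_mult_distrib power2_norm_eq_inner l2_class_inner L2_inner_test[OF \<phi>])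
    finally show "norm (l2_class \<psi>) \<le> r * norm (l2_class \<phi>)"
      by (rule power2_le_imp_le) (use r in simp)
  qed auto
  finally have "norm (l2_class \<phi>) * norm (l2_class \<phi>) \<le> norm (l2_class \<phi>) * (2 * r * norm (l2_class (partial i \<phi>)))"
    by (simp add: power2_eq_square mult_ac)
  then show ?thesis
    using r by (cases "norm (l2_class \<phi>) = 0") (auto simp: mult_le_cancel_left)
qed

section \<open>The embedding of \<open>H\<^sup>1(\<Omega>)\<close> into a power of \<open>L\<^sup>2\<close>\<close>

text \<open>The difference of two weak gradients is orthogonal to all test functions. This makes the
  classes of the components of \<open>grad \<Omega> u\<close> independent of the choice made by
  \<open>SOME\<close>.\<close>

lemma is_weak_grad_unique:
  assumes "is_weak_grad \<Omega> u g" "is_weak_grad \<Omega> u h"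
  shows "l2_class (\<lambda>x. g x $ i) = l2_class (\<lambda>x. h x $ i)"
proof -
  have L2: "(\<lambda>x. g x $ i) \<in> L2 \<Omega>" "(\<lambda>x. h x $ i) \<in> L2 \<Omega>"
    using assms by (auto simp: is_weak_grad_def)
  have "l2_class (\<lambda>x. g x $ i - h x $ i) = 0"
  proof (rule L2_orthogonal_test_functions)
    show "(\<lambda>x. g x $ i - h x $ i) \<in> L2 \<Omega>"
      by (intro L2_closed L2)
    fix \<phi> assume \<phi>: "\<phi> \<in> test_functions \<Omega>"
    have "l2_class (\<lambda>x. g x $ i) \<bullet> l2_class \<phi> = l2_class (\<lambda>x. h x $ i) \<bullet> l2_class \<phi>"
      using assms \<phi> by (auto simp: is_weak_grad_def l2_class_inner test_functions_L2)
    then have "l2_class (\<lambda>x. g x $ i - h x $ i) \<bullet> l2_class \<phi> = 0"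
      by (simp add: l2_class_diff L2 inner_diff_left)
    then show "L2_inner \<Omega> (\<lambda>x. g x $ i - h x $ i) \<phi> = 0"
      using \<phi> L2 by (simp add: l2_class_inner test_functions_L2 L2_closed)
  qed
  then show ?thesis by (simp add: l2_class_diff L2)
qed

definition h1_class :: "(real^'d \<Rightarrow> real) \<Rightarrow> (real^'d) l2 \<times> (((real^'d) l2)^'d)" where
  "h1_class u = (l2_class u, \<chi> i. l2_class (\<lambda>x. grad \<Omega> u x $ i))"

lemma H1_D:
  assumes "u \<in> H1 \<Omega>"
  shows "u \<in> L2 \<Omega>" "is_weak_grad \<Omega> u (grad \<Omega> u)" "(\<lambda>x. grad \<Omega> u x $ i) \<in> L2 \<Omega>"
proof -
  show "u \<in> L2 \<Omega>" using assms by (simp add: H1_def)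
  show w: "is_weak_grad \<Omega> u (grad \<Omega> u)"
    using assms someI_ex[of "is_weak_grad \<Omega> u"] by (simp add: H1_def grad_def)
  then show "(\<lambda>x. grad \<Omega> u x $ i) \<in> L2 \<Omega>" by (simp add: is_weak_grad_def)
qed

lemma H1_I:
  assumes "u \<in> L2 \<Omega>" "is_weak_grad \<Omega> u g"
  shows "u \<in> H1 \<Omega>" "h1_class u = (l2_class u, \<chi> i. l2_class (\<lambda>x. g x $ i))"
proof -
  show "u \<in> H1 \<Omega>" using assms by (auto simp: H1_def)
  then show "h1_class u = (l2_class u, \<chi> i. l2_class (\<lambda>x. g x $ i))"
    using is_weak_grad_unique[OF H1_D(2) assms(2)] by (simp add: h1_class_def)
qed

text \<open>In terms of classes, being a weak gradient is a family of linear equations between inner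
  products. Hence it passes to sums and multiples, depends on the functions only up to null sets,
  and in this form survives limits.\<close>

lemma is_weak_grad_iff:
  assumes "u \<in> L2 \<Omega>" "\<And>i. (\<lambda>x. g x $ i) \<in> L2 \<Omega>"
  shows "is_weak_grad \<Omega> u g \<longleftrightarrow> (\<forall>\<phi>\<in>test_functions \<Omega>. \<forall>i.
    l2_class u \<bullet> l2_class (partial i \<phi>) = - (l2_class (\<lambda>x. g x $ i) \<bullet> l2_class \<phi>))"
  using assms by (auto simp: is_weak_grad_def l2_class_inner test_functions_L2 test_functions_partial)

lemma H1_add:
  assumes u: "u \<in> H1 \<Omega>" and v: "v \<in> H1 \<Omega>"
  shows "(\<lambda>x. u x + v x) \<in> H1 \<Omega>" "h1_class (\<lambda>x. u x + v x) = h1_class u + h1_class v"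
proof -
  note L2 = H1_D(1,3)[OF u] H1_D(1,3)[OF v]
  have L: "(\<lambda>x. u x + v x) \<in> L2 \<Omega>" by (intro L2_closed L2)
  have "is_weak_grad \<Omega> (\<lambda>x. u x + v x) (\<lambda>x. grad \<Omega> u x + grad \<Omega> v x)"
    using H1_D(2)[OF u] H1_D(2)[OF v] L2
    by (simp add: is_weak_grad_iff L2_closed l2_class_add inner_add_left)
  from H1_I[OF L this] show "(\<lambda>x. u x + v x) \<in> H1 \<Omega>" "h1_class (\<lambda>x. u x + v x) = h1_class u + h1_class v"
    using L2 by (auto simp: h1_class_def l2_class_add vec_eq_iff)
qed

lemma H1_scale:
  assumes u: "u \<in> H1 \<Omega>"
  shows "(\<lambda>x. r * u x) \<in> H1 \<Omega>" "h1_class (\<lambda>x. r * u x) = r *\<^sub>R h1_class u"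
proof -
  note L2 = H1_D(1,3)[OF u]
  have L: "(\<lambda>x. r * u x) \<in> L2 \<Omega>" by (intro L2_closed L2)
  have "is_weak_grad \<Omega> (\<lambda>x. r * u x) (\<lambda>x. r *\<^sub>R grad \<Omega> u x)"
    using H1_D(2)[OF u] L2
    by (simp add: is_weak_grad_iff L2_closed l2_class_scale)
  from H1_I[OF L this] show "(\<lambda>x. r * u x) \<in> H1 \<Omega>" "h1_class (\<lambda>x. r * u x) = r *\<^sub>R h1_class u"
    using L2 by (auto simp: h1_class_def l2_class_scale vec_eq_iff)
qed

lemma H1_diff:
  assumes u: "u \<in> H1 \<Omega>" and v: "v \<in> H1 \<Omega>"
  shows "(\<lambda>x. u x - v x) \<in> H1 \<Omega>" "h1_class (\<lambda>x. u x - v x) = h1_class u - h1_class v"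
  using H1_add[OF u H1_scale(1)[OF v, of "-1"]] H1_scale[OF v, of "-1"] by simp_all

text \<open>Almost everywhere equal functions have the same weak gradients, so the first component
  of \<open>h1_class\<close> determines the second.\<close>

lemma h1_class_eq_iff:
  assumes u: "u \<in> H1 \<Omega>" and v: "v \<in> H1 \<Omega>"
  shows "h1_class u = h1_class v \<longleftrightarrow> ae_eq \<Omega> u v"
proof
  show "h1_class u = h1_class v \<Longrightarrow> ae_eq \<Omega> u v"
    using H1_D(1)[OF u] H1_D(1)[OF v] by (simp add: h1_class_def l2_class_eq_iff)
  assume "ae_eq \<Omega> u v"
  then have eq: "l2_class u = l2_class v" using H1_D(1)[OF u] H1_D(1)[OF v] by (simp add: l2_class_eq_iff)
  then have "is_weak_grad \<Omega> v (grad \<Omega> u)"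
    using H1_D[OF u] H1_D[OF v] by (simp add: is_weak_grad_iff)
  from H1_I(2)[OF H1_D(1)[OF v] this] show "h1_class u = h1_class v" by (simp add: h1_class_def eq)
qed

lemma norm_grad:
  assumes u: "u \<in> H1 \<Omega>"
  shows "norm (snd (h1_class u)) = grad_norm \<Omega> u"
proof -
  have i: "integrable (lebesgue_on \<Omega>) (\<lambda>x. grad \<Omega> u x $ i * grad \<Omega> u x $ i)" for i
    using H1_D(3)[OF u, of i] by (simp add: L2_def power2_eq_square)
  have "L2_inner \<Omega> (\<lambda>x. norm (grad \<Omega> u x)) (\<lambda>x. norm (grad \<Omega> u x))
      = (LINT x|lebesgue_on \<Omega>. (\<Sum>i\<in>UNIV. grad \<Omega> u x $ i * grad \<Omega> u x $ i))"
    by (simp add: L2_inner_def power2_norm_eq_inner inner_vec_def flip: power2_eq_square[of "norm _"])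
  also have "\<dots> = (\<Sum>i\<in>UNIV. LINT x|lebesgue_on \<Omega>. grad \<Omega> u x $ i * grad \<Omega> u x $ i)"
    by (rule Bochner_Integration.integral_sum) (rule i)
  also have "\<dots> = snd (h1_class u) \<bullet> snd (h1_class u)"
    using H1_D(3)[OF u] by (simp add: h1_class_def inner_vec_def l2_class_inner) (simp add: L2_inner_def)
  finally show ?thesis by (simp add: grad_norm_def L2_norm_def norm_eq_sqrt_inner)
qed

lemma norm_h1_class:
  assumes u: "u \<in> H1 \<Omega>"
  shows "norm (h1_class u) = H1_norm \<Omega> u"
  using norm_grad[OF u] norm_l2_class[OF H1_D(1)[OF u]]
  by (simp add: H1_norm_def norm_prod_def h1_class_def)

lemma test_functions_H1:
  assumes "\<phi> \<in> test_functions \<Omega>"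
  shows "\<phi> \<in> H1 \<Omega>" "h1_class \<phi> = (l2_class \<phi>, \<chi> i. l2_class (partial i \<phi>))"
  using H1_I[OF test_functions_L2 test_functions_weak_grad] assms by auto

section \<open>The image of \<open>H\<^sup>1\<^sub>0(\<Omega>)\<close>\<close>

text \<open>A closure in the ambient product is closed by construction; the work moves to
  \<open>H10_image_surj\<close>, by which every element still comes from a function.\<close>

definition H10_image :: "((real^'d) l2 \<times> (((real^'d) l2)^'d)) set" where
  "H10_image = closure (h1_class ` test_functions \<Omega>)"

lemma H10_iff: "u \<in> H10 \<Omega> \<longleftrightarrow> u \<in> H1 \<Omega> \<and> h1_class u \<in> H10_image"
proof (cases "u \<in> H1 \<Omega>")
  case True
  have "H1_norm \<Omega> (\<lambda>x. u x - \<phi> x) = dist (h1_class \<phi>) (h1_class u)" if "\<phi> \<in> test_functions \<Omega>" for \<phi>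
    using H1_diff[OF True test_functions_H1(1)[OF that]]
    by (simp add: dist_norm norm_minus_commute flip: norm_h1_class)
  then show ?thesis
    using True by (auto simp: H10_def H10_image_def closure_approachable)
qed (simp add: H10_def)

lemma subspace_H10_image: "subspace H10_image"
  unfolding H10_image_def
proof (intro subspace_closure subspaceI)
  have "h1_class (\<lambda>x. 0) = 0"
    using H1_scale(2)[OF test_functions_H1(1)[OF test_functions_zero], of 0] by simp
  then show "0 \<in> h1_class ` test_functions \<Omega>"
    using image_eqI[OF _ test_functions_zero, of 0 h1_class] by simp
next
  fix x y assume "x \<in> h1_class ` test_functions \<Omega>" "y \<in> h1_class ` test_functions \<Omega>"
  then obtain \<phi> \<psi> where "\<phi> \<in> test_functions \<Omega>" "x = h1_class \<phi>" "\<psi> \<in> test_functions \<Omega>" "y = h1_class \<psi>"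
    by blast
  then show "x + y \<in> h1_class ` test_functions \<Omega>"
    by (intro image_eqI[of _ h1_class "\<lambda>x. \<phi> x + \<psi> x"] test_functions_add)
      (simp_all add: H1_add(2) test_functions_H1(1))
next
  fix c x assume "x \<in> h1_class ` test_functions \<Omega>"
  then obtain \<phi> where "\<phi> \<in> test_functions \<Omega>" "x = h1_class \<phi>" by blast
  then show "c *\<^sub>R x \<in> h1_class ` test_functions \<Omega>"
    by (intro image_eqI[of _ h1_class "\<lambda>x. c * \<phi> x"] test_functions_mult smooth_const)
      (simp_all add: H1_scale(2) test_functions_H1(1))
qed

text \<open>The density principle: a closed condition need only be checked on test functions. It
  carries the weak gradient equations, the vanishing outside \<open>\<Omega>\<close> and the
  Poincare inequality over to limits.\<close>

lemma H10_image_minimal: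
  assumes "closed S" "\<And>\<phi>. \<phi> \<in> test_functions \<Omega> \<Longrightarrow> h1_class \<phi> \<in> S" "x \<in> H10_image"
  shows "x \<in> S"
  using closure_minimal[OF _ assms(1), of "h1_class ` test_functions \<Omega>"] assms(2,3)
  unfolding H10_image_def by blast

lemma l2_class_orthogonal_outside:
  assumes "u \<in> L2 \<Omega>" "v \<in> square_integrable lebesgue" "\<And>x. x \<in> \<Omega> \<Longrightarrow> v x = 0"
  shows "l2_class u \<bullet> abs_l2 v = 0"
proof -
  have 0: "indicator \<Omega> x * u x * v x = 0" for x using assms(3) by (auto simp: indicator_def)
  have "l2_class u \<bullet> abs_l2 v = (LINT x|lebesgue. indicator \<Omega> x * u x * v x)"
    using assms by (simp add: l2_class_def abs_l2_inner L2_iff)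
  also have "\<dots> = 0" by (simp only: 0) simp
  finally show ?thesis .
qed

text \<open>Vanishing outside \<open>\<Omega>\<close> is expressed by orthogonality to the functions
  that are zero on \<open>\<Omega>\<close>, which is a closed condition on \<open>p\<close>. Applied
  to the part of \<open>p\<close> outside \<open>\<Omega>\<close>, it makes that part orthogonal to
  itself.\<close>

lemma l2_class_rep:
  assumes "\<And>v. v \<in> square_integrable lebesgue \<Longrightarrow> (\<And>x. x \<in> \<Omega> \<Longrightarrow> v x = 0) \<Longrightarrow> p \<bullet> abs_l2 v = 0"
  shows "rep_l2 p \<in> L2 \<Omega>" "l2_class (rep_l2 p) = p"
proof -
  define v where "v x = indicator (- \<Omega>) x * rep_l2 p x" for x
  have v: "v \<in> square_integrable lebesgue"
    unfolding v_def[abs_def]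
    by (rule square_integrable_indicator[OF _ rep_l2(1)]) (simp add: Compl_in_sets_lebesgue)
  show L2: "rep_l2 p \<in> L2 \<Omega>"
    unfolding L2_iff by (rule square_integrable_indicator[OF _ rep_l2(1)]) simp
  have "rep_l2 p = (\<lambda>x. indicator \<Omega> x * rep_l2 p x + v x)"
    by (auto simp: v_def indicator_def fun_eq_iff)
  then have "abs_l2 (rep_l2 p) = l2_class (rep_l2 p) + abs_l2 v"
    using abs_l2_add[OF L2[unfolded L2_iff] v] by (simp add: l2_class_def)
  then have p: "p = l2_class (rep_l2 p) + abs_l2 v" by (simp add: rep_l2)
  have "p \<bullet> abs_l2 v = 0" using v by (rule assms) (simp add: v_def)
  moreover have "l2_class (rep_l2 p) \<bullet> abs_l2 v = 0"
    by (rule l2_class_orthogonal_outside[OF L2 v]) (simp add: v_def)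
  ultimately have "abs_l2 v \<bullet> abs_l2 v = 0"
    by (subst (asm) (1) p) (simp add: inner_add_left)
  then show "l2_class (rep_l2 p) = p" using p by simp
qed

text \<open>A limit of classes of test functions still satisfies the weak gradient equations and
  still vanishes outside \<open>\<Omega>\<close>, both being closed conditions; representatives of
  its components are therefore a function and its weak gradient.\<close>

lemma H10_image_surj:
  assumes x: "x \<in> H10_image"
  shows "\<exists>u\<in>H10 \<Omega>. h1_class u = x"
proof -
  have grad: "fst x \<bullet> l2_class (partial i \<phi>) = - ((snd x $ i) \<bullet> l2_class \<phi>)" if \<phi>: "\<phi> \<in> test_functions \<Omega>" for \<phi> i
  proof -
    have "x \<in> {x. fst x \<bullet> l2_class (partial i \<phi>) = - ((snd x $ i) \<bullet> l2_class \<phi>)}"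
    proof (rule H10_image_minimal[OF _ _ x])
      show "closed {x::(real^'d) l2 \<times> (((real^'d) l2)^'d). fst x \<bullet> l2_class (partial i \<phi>) = - ((snd x $ i) \<bullet> l2_class \<phi>)}"
        by (intro closed_Collect_eq continuous_intros)
      show "h1_class \<psi> \<in> {x. fst x \<bullet> l2_class (partial i \<phi>) = - ((snd x $ i) \<bullet> l2_class \<phi>)}" if \<psi>: "\<psi> \<in> test_functions \<Omega>" for \<psi>
        using test_functions_weak_grad[OF \<psi>] \<phi> \<psi>
        by (simp add: is_weak_grad_iff test_functions_L2 test_functions_partial test_functions_H1)
    qed
    then show ?thesis by simp
  qed
  have outside: "fst x \<bullet> abs_l2 v = 0" "(snd x $ i) \<bullet> abs_l2 v = 0"
    if v: "v \<in> square_integrable lebesgue" "\<And>x. x \<in> \<Omega> \<Longrightarrow> v x = 0" for v i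
  proof -
    have "x \<in> {x. fst x \<bullet> abs_l2 v = 0 \<and> (snd x $ i) \<bullet> abs_l2 v = 0}"
    proof (rule H10_image_minimal[OF _ _ x])
      show "closed {x::(real^'d) l2 \<times> (((real^'d) l2)^'d). fst x \<bullet> abs_l2 v = 0 \<and> (snd x $ i) \<bullet> abs_l2 v = 0}"
        by (intro closed_Collect_conj closed_Collect_eq continuous_intros)
      show "h1_class \<psi> \<in> {x. fst x \<bullet> abs_l2 v = 0 \<and> (snd x $ i) \<bullet> abs_l2 v = 0}" if "\<psi> \<in> test_functions \<Omega>" for \<psi>
        using that v by (simp add: test_functions_H1 l2_class_orthogonal_outside test_functions_L2 test_functions_partial)
    qed
    then show "fst x \<bullet> abs_l2 v = 0" "(snd x $ i) \<bullet> abs_l2 v = 0" by auto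
  qed
  define u where "u = rep_l2 (fst x)"
  define g where "g y = (\<chi> i. rep_l2 (snd x $ i) y)" for y
  have u: "u \<in> L2 \<Omega>" "l2_class u = fst x"
    unfolding u_def using l2_class_rep[OF outside(1)] by auto
  have g: "(\<lambda>y. g y $ i) \<in> L2 \<Omega>" "l2_class (\<lambda>y. g y $ i) = snd x $ i" for i
    unfolding g_def using l2_class_rep[OF outside(2)[of _ i]] by auto
  have "is_weak_grad \<Omega> u g" using grad u g by (simp add: is_weak_grad_iff)
  from H1_I[OF u(1) this] have "u \<in> H1 \<Omega>" "h1_class u = x"
    by (auto simp: u g prod_eq_iff vec_eq_iff)
  then show ?thesis using x by (auto simp: H10_iff)
qed

lemma H10_add:
  assumes "u \<in> H10 \<Omega>" "v \<in> H10 \<Omega>"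
  shows "(\<lambda>x. u x + v x) \<in> H10 \<Omega>" "h1_class (\<lambda>x. u x + v x) = h1_class u + h1_class v"
  using assms H1_add[of u v] subspace_add[OF subspace_H10_image] by (auto simp: H10_iff)

lemma H10_scale:
  assumes "u \<in> H10 \<Omega>"
  shows "(\<lambda>x. r * u x) \<in> H10 \<Omega>" "h1_class (\<lambda>x. r * u x) = r *\<^sub>R h1_class u"
  using assms H1_scale[of u r] subspace_scale[OF subspace_H10_image] by (auto simp: H10_iff)

lemma H10_diff:
  assumes "u \<in> H10 \<Omega>" "v \<in> H10 \<Omega>"
  shows "(\<lambda>x. u x - v x) \<in> H10 \<Omega>" "h1_class (\<lambda>x. u x - v x) = h1_class u - h1_class v"
  using assms H1_diff[of u v] subspace_diff[OF subspace_H10_image] by (auto simp: H10_iff)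

lemma H10_zero: "(\<lambda>x. 0) \<in> H10 \<Omega>" "h1_class (\<lambda>x. 0) = 0"
proof -
  show 0: "(\<lambda>x. 0) \<in> H10 \<Omega>"
    using test_functions_H1(1)[OF test_functions_zero] closure_subset[of "h1_class ` test_functions \<Omega>"]
      test_functions_zero by (auto simp: H10_iff H10_image_def)
  show "h1_class (\<lambda>x. 0) = 0" using H10_scale(2)[OF 0, of 0] by simp
qed

lemma H10_sum:
  assumes "finite A" "\<And>i. i \<in> A \<Longrightarrow> u i \<in> H10 \<Omega>"
  shows "(\<lambda>x. \<Sum>i\<in>A. u i x * c i) \<in> H10 \<Omega> \<and>
    h1_class (\<lambda>x. \<Sum>i\<in>A. u i x * c i) = (\<Sum>i\<in>A. c i *\<^sub>R h1_class (u i))"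
  using assms
proof (induction A)
  case (insert j A)
  then show ?case
    using H10_add[OF H10_scale(1)[of "u j" "c j"], of "\<lambda>x. \<Sum>i\<in>A. u i x * c i"] H10_scale(2)[of "u j" "c j"]
    by (simp add: mult.commute)
qed (simp add: H10_zero)

text \<open>For test functions the derivative in one coordinate direction bounds the function, and
  it is at most the full gradient; the estimate is closed. The summand 1 next to \<open>C\<close>
  accounts for the gradient part of the norm.\<close>

lemma H10_poincare:
  obtains C where "C \<ge> 0" "\<And>u. u \<in> H10 \<Omega> \<Longrightarrow> (norm (h1_class u))\<^sup>2 \<le> (C + 1) * (grad_norm \<Omega> u)\<^sup>2"
proof -
  obtain r0 where r0: "\<And>x. x \<in> \<Omega> \<Longrightarrow> norm x \<le> r0" using bounded_\<Omega> by (auto simp: bounded_iff)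
  define r where "r = \<bar>r0\<bar>"
  have r: "r \<ge> 0" "\<And>x. x \<in> \<Omega> \<Longrightarrow> norm x \<le> r" using r0 by (force simp: r_def)+
  have poincare: "norm (fst x) \<le> 2 * r * norm (snd x)" if x: "x \<in> H10_image" for x
  proof -
    have "x \<in> {x. norm (fst x) \<le> 2 * r * norm (snd x)}"
    proof (rule H10_image_minimal[OF _ _ x])
      show "closed {x::(real^'d) l2 \<times> (((real^'d) l2)^'d). norm (fst x) \<le> 2 * r * norm (snd x)}"
        by (intro closed_Collect_le continuous_intros)
      fix \<phi> assume \<phi>: "\<phi> \<in> test_functions \<Omega>"
      fix i0 :: 'd
      have "norm (l2_class \<phi>) \<le> 2 * r * norm (l2_class (partial i0 \<phi>))"
        by (rule poincare_test_functions[OF r \<phi>])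
      also have "\<dots> \<le> 2 * r * norm (\<chi> i. l2_class (partial i \<phi>))"
        using r(1) Finite_Cartesian_Product.norm_nth_le[of "\<chi> i. l2_class (partial i \<phi>)" i0] by (intro mult_left_mono) auto
      finally show "h1_class \<phi> \<in> {x. norm (fst x) \<le> 2 * r * norm (snd x)}"
        using \<phi> by (simp add: test_functions_H1)
    qed
    then show ?thesis by simp
  qed
  show thesis
  proof (rule that[of "(2 * r)\<^sup>2"])
    fix u assume u: "u \<in> H10 \<Omega>"
    then have "norm (fst (h1_class u)) \<le> 2 * r * norm (snd (h1_class u))"
      by (intro poincare) (simp add: H10_iff)
    then have "(norm (fst (h1_class u)))\<^sup>2 \<le> (2 * r * norm (snd (h1_class u)))\<^sup>2"
      by (rule power_mono) simp
    then have "(norm (h1_class u))\<^sup>2 \<le> ((2 * r)\<^sup>2 + 1) * (norm (snd (h1_class u)))\<^sup>2"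
      by (simp add: norm_prod_def power_mult_distrib algebra_simps)
    then show "(norm (h1_class u))\<^sup>2 \<le> ((2 * r)\<^sup>2 + 1) * (grad_norm \<Omega> u)\<^sup>2"
      using u by (simp add: norm_grad H10_iff)
  qed simp
qed

end

section \<open>Linear differential equations\<close>

lemma integral_has_vector_derivative_atLeast:
  fixes f :: "real \<Rightarrow> 'a::banach"
  assumes "continuous_on {a..} f" "t \<ge> a"
  shows "((\<lambda>t. integral {a..t} f) has_vector_derivative f t) (at t within {a..})"
proof -
  have "((\<lambda>t. integral {a..t} f) has_vector_derivative f t) (at t within {a..t + 1})"
    using assms by (intro integral_has_vector_derivative) (auto intro: continuous_on_subset)
  moreover have "at t within {a..t + 1} = at t within {a..}"
    using assms by (intro at_within_nhd[of _ "{..<t + 1}"]) auto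
  ultimately show ?thesis by simp
qed

lemma has_real_derivative_nonneg_imp_mono:
  fixes f :: "real \<Rightarrow> real"
  assumes f: "\<And>t. t \<ge> a \<Longrightarrow> (f has_real_derivative f' t) (at t within {a..})"
    and nonneg: "\<And>t. t \<ge> a \<Longrightarrow> f' t \<ge> 0"
    and st: "a \<le> s" "s \<le> t"
  shows "f s \<le> f t"
proof (rule DERIV_nonneg_imp_increasing_open[OF st(2)])
  fix x assume x: "s < x" "x < t"
  then have "at x within {a..} = at x" using st by (intro at_within_interior) auto
  then show "\<exists>y. DERIV f x :> y \<and> 0 \<le> y" using f[of x] nonneg[of x] x st by auto
next
  have "continuous_on {a..} f"
    using f by (auto simp: continuous_on_eq_continuous_within intro: DERIV_continuous)
  then show "continuous_on {s..t} f" using st by (elim continuous_on_subset) auto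
qed

text \<open>A contraction on the whole half-line, although \<open>l\<close> may be unbounded: for
  \<open>x = \<omega> y\<close> with \<open>\<omega> = exp (2 \<integral> l)\<close> the integral of
  \<open>l * \<omega>\<close> is \<open>(\<omega> - 1) / 2\<close>, so the integral equation for
  \<open>y\<close> contracts the supremum norm by the factor 1/2. One fixed point gives the global
  solution, with no continuation argument.\<close>

lemma linear_ode_exists:
  fixes C :: "real \<Rightarrow> 'a::banach \<Rightarrow> 'a" and l :: "real \<Rightarrow> real"
  assumes C_cont: "\<And>x. continuous_on {0..} x \<Longrightarrow> continuous_on {0..} (\<lambda>t. C t (x t))"
    and lip: "\<And>t x y. t \<ge> 0 \<Longrightarrow> norm (C t x - C t y) \<le> l t * norm (x - y)"
    and C0: "\<And>t. C t 0 = 0"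
    and l: "continuous_on {0..} l" "\<And>t. t \<ge> 0 \<Longrightarrow> l t \<ge> 0"
  shows "\<exists>x. x 0 = x0 \<and> (\<forall>t\<ge>0. (x has_vector_derivative C t (x t)) (at t within {0..}))"
proof -
  define \<omega> where "\<omega> t = exp (2 * integral {0..t} l)" for t
  have \<omega>': "(\<omega> has_real_derivative 2 * (l t * \<omega> t)) (at t within {0..})" if "t \<ge> 0" for t
  proof -
    have "((\<lambda>t. integral {0..t} l) has_real_derivative l t) (at t within {0..})"
      using integral_has_vector_derivative_atLeast[OF l(1) that]
      by (simp only: has_real_derivative_iff_has_vector_derivative)
    then show ?thesis
      unfolding \<omega>_def by (auto intro!: derivative_eq_intros)
  qed
  have \<omega>_cont: "continuous_on {0..} \<omega>"
    using \<omega>' by (auto simp: continuous_on_eq_continuous_within intro: DERIV_continuous)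
  have \<omega>_ge: "\<omega> t \<ge> 1" if "t \<ge> 0" for t
  proof -
    have "l integrable_on {0..t}"
      using l(1) by (intro integrable_continuous_real) (rule continuous_on_subset, auto)
    then have "integral {0..t} l \<ge> 0" using l(2) by (intro integral_nonneg) auto
    then show ?thesis unfolding \<omega>_def by simp
  qed
  have \<omega>_int: "((\<lambda>s. l s * \<omega> s) has_integral (\<omega> t - 1) / 2) {0..t}" if "t \<ge> 0" for t
  proof -
    have "((\<lambda>s. l s * \<omega> s) has_integral \<omega> t / 2 - \<omega> 0 / 2) {0..t}"
    proof (rule fundamental_theorem_of_calculus[OF that])
      fix s assume s: "s \<in> {0..t}"
      have "((\<lambda>s. \<omega> s / 2) has_real_derivative l s * \<omega> s) (at s within {0..})"
        using s by (auto intro!: derivative_eq_intros \<omega>')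
      then show "((\<lambda>s. \<omega> s / 2) has_vector_derivative l s * \<omega> s) (at s within {0..t})"
        by (auto simp: has_real_derivative_iff_has_vector_derivative
            intro: has_vector_derivative_within_subset)
    qed
    then show ?thesis by (simp add: \<omega>_def diff_divide_distrib)
  qed
  define I where "I y t = integral {0..t} (\<lambda>s. C s (\<omega> s *\<^sub>R y s))" for y t
  have C_\<omega>_cont: "continuous_on {0..} (\<lambda>s. C s (\<omega> s *\<^sub>R y s))" if "continuous_on {0..} y" for y
    by (intro C_cont continuous_intros \<omega>_cont that)
  have I_diff: "norm (I y t - I z t) \<le> K * ((\<omega> t - 1) / 2)"
    if y: "continuous_on {0..} y" and z: "continuous_on {0..} z"
      and K: "\<And>s. s \<ge> 0 \<Longrightarrow> norm (y s - z s) \<le> K" and t: "t \<ge> 0" for y z K t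
  proof -
    have i: "(\<lambda>s. C s (\<omega> s *\<^sub>R y s)) integrable_on {0..t}" "(\<lambda>s. C s (\<omega> s *\<^sub>R z s)) integrable_on {0..t}"
      using C_\<omega>_cont[OF y] C_\<omega>_cont[OF z]
      by (auto intro!: integrable_continuous_real intro: continuous_on_subset)
    have "norm (I y t - I z t) = norm (integral {0..t} (\<lambda>s. C s (\<omega> s *\<^sub>R y s) - C s (\<omega> s *\<^sub>R z s)))"
      unfolding I_def using i by (simp add: Henstock_Kurzweil_Integration.integral_diff)
    also have "\<dots> \<le> integral {0..t} (\<lambda>s. K * (l s * \<omega> s))"
    proof (rule integral_norm_bound_integral)
      show "(\<lambda>s. C s (\<omega> s *\<^sub>R y s) - C s (\<omega> s *\<^sub>R z s)) integrable_on {0..t}"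
        using i by (intro integrable_diff)
      show "(\<lambda>s. K * (l s * \<omega> s)) integrable_on {0..t}"
        using \<omega>_int[OF t] by (auto intro!: integrable_on_mult_right)
      fix s assume s: "s \<in> {0..t}"
      have "norm (C s (\<omega> s *\<^sub>R y s) - C s (\<omega> s *\<^sub>R z s)) \<le> l s * norm (\<omega> s *\<^sub>R y s - \<omega> s *\<^sub>R z s)"
        using s by (intro lip) auto
      also have "\<dots> = l s * (\<omega> s * norm (y s - z s))"
        using s \<omega>_ge[of s] by (simp flip: scaleR_diff_right)
      also have "\<dots> \<le> l s * (\<omega> s * K)"
        using s \<omega>_ge[of s] l(2)[of s] K[of s] by (intro mult_left_mono) auto
      finally show "norm (C s (\<omega> s *\<^sub>R y s) - C s (\<omega> s *\<^sub>R z s)) \<le> K * (l s * \<omega> s)"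
        by (simp add: mult_ac)
    qed
    also have "\<dots> = K * ((\<omega> t - 1) / 2)"
      using \<omega>_int[OF t] by (simp add: integral_unique)
    finally show ?thesis .
  qed
  have I0: "I (\<lambda>_. 0) t = 0" for t by (simp add: I_def C0)
  have I_deriv: "(I y has_vector_derivative C t (\<omega> t *\<^sub>R y t)) (at t within {0..})"
    if "continuous_on {0..} y" "t \<ge> 0" for y t
    unfolding I_def by (rule integral_has_vector_derivative_atLeast[OF C_\<omega>_cont[OF that(1)] that(2)])
  have I_cont: "continuous_on {0..} (I y)" if "continuous_on {0..} y" for y
    using I_deriv[OF that]
    by (auto simp: continuous_on_eq_continuous_within intro: has_vector_derivative_continuous)
  \<comment> \<open>Elements of the type of bounded continuous functions live on all of the reals,
    so values at negative times are frozen at time 0.\<close>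
  define S where "S y t = (1 / \<omega> (max 0 t)) *\<^sub>R (x0 + I y (max 0 t))" for y t
  have S_diff: "norm (S y t - S z t) \<le> K / 2"
    if y: "continuous_on {0..} y" and z: "continuous_on {0..} z"
      and K: "\<And>s. s \<ge> 0 \<Longrightarrow> norm (y s - z s) \<le> K" for y z K t
  proof -
    have \<omega>1: "\<omega> (max 0 t) \<ge> 1" by (intro \<omega>_ge) simp
    have "S y t - S z t = (1 / \<omega> (max 0 t)) *\<^sub>R (I y (max 0 t) - I z (max 0 t))"
      by (simp add: S_def scaleR_diff_right[symmetric])
    then have "norm (S y t - S z t) = norm (I y (max 0 t) - I z (max 0 t)) / \<omega> (max 0 t)"
      using \<omega>1 by simp
    also have "\<dots> \<le> (K * ((\<omega> (max 0 t) - 1) / 2)) / \<omega> (max 0 t)"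
      using \<omega>1 by (intro divide_right_mono I_diff y z K) auto
    also have "\<dots> \<le> K / 2"
    proof -
      have "K \<ge> 0" using K[of 0] norm_ge_zero[of "y 0 - z 0"] by linarith
      then show ?thesis using \<omega>1 by (simp add: field_simps)
    qed
    finally show ?thesis .
  qed
  have S_cont: "continuous_on UNIV (S y)" if "continuous_on {0..} y" for y
  proof -
    have "continuous_on {0..} (\<lambda>t. (1 / \<omega> t) *\<^sub>R (x0 + I y t))"
      using \<omega>_ge by (intro continuous_intros \<omega>_cont I_cont that) force
    then show ?thesis
      unfolding S_def
      by (rule continuous_on_compose2[where f="\<lambda>t. max 0 t"]) (auto intro!: continuous_intros)
  qed
  \<comment> \<open>Because \<open>C t 0 = 0\<close>, the zero function is sent to
    \<open>x0 / \<omega>\<close>, which is bounded by the norm of \<open>x0\<close>; the Lipschitz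
    estimate extends boundedness to all images.\<close>
  have S_bounded: "bounded (range (S y))"
    if y: "continuous_on {0..} y" and K: "\<And>s. s \<ge> 0 \<Longrightarrow> norm (y s) \<le> K" for y K
  proof -
    have "norm (S y t) \<le> K / 2 + norm x0" for t
    proof -
      have \<omega>1: "\<omega> (max 0 t) \<ge> 1" by (intro \<omega>_ge) simp
      have "norm (S (\<lambda>_. 0) t) \<le> norm x0"
        using \<omega>1 mult_left_mono[OF \<omega>1 norm_ge_zero[of x0]]
        by (simp add: S_def I0 divide_le_eq)
      moreover have "norm (S y t - S (\<lambda>_. 0) t) \<le> K / 2"
        using K by (intro S_diff y) auto
      ultimately show ?thesis using norm_triangle_sub[of "S y t" "S (\<lambda>_. 0) t"] by linarith
    qed
    then show ?thesis by (auto simp: bounded_iff)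
  qed
  define \<Phi> where "\<Phi> y = Bcontfun (S (apply_bcontfun y))" for y :: "real \<Rightarrow>\<^sub>C 'a"
  have y_cont: "continuous_on A (apply_bcontfun y)" for A and y :: "real \<Rightarrow>\<^sub>C 'a"
    using continuous_on_apply_bcontfun[of _ y] by (rule continuous_on_subset) auto
  have \<Phi>: "apply_bcontfun (\<Phi> y) = S (apply_bcontfun y)" for y
    unfolding \<Phi>_def using norm_bounded[of y]
    by (intro Bcontfun_inverse) (auto simp: bcontfun_def intro!: S_cont y_cont S_bounded)
  have "\<exists>!y. \<Phi> y = y"
  proof (rule banach_fix_type[of "1/2"])
    show "\<forall>y z. dist (\<Phi> y) (\<Phi> z) \<le> 1 / 2 * dist y z"
    proof (intro allI dist_bound)
      fix y z :: "real \<Rightarrow>\<^sub>C 'a" and t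
      have "norm (S y t - S z t) \<le> dist y z / 2"
        using dist_bounded[of y _ z] by (intro S_diff y_cont) (simp add: dist_norm)
      then show "dist (\<Phi> y t) (\<Phi> z t) \<le> 1 / 2 * dist y z"
        by (simp add: \<Phi> dist_norm)
    qed
  qed auto
  then obtain y where y: "\<Phi> y = y" by blast
  have yt: "\<omega> t *\<^sub>R y t = x0 + I y t" if "t \<ge> 0" for t
  proof -
    have "y t = S y t" by (metis \<Phi> y)
    then show ?thesis using that \<omega>_ge[of t] by (simp add: S_def)
  qed
  define x where "x t = x0 + I y t" for t
  have "x 0 = x0" by (simp add: x_def I_def)
  moreover have "(x has_vector_derivative C t (x t)) (at t within {0..})" if "t \<ge> 0" for t
    using I_deriv[OF y_cont that, of y] that
    by (auto simp: x_def[abs_def] yt intro!: derivative_eq_intros)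
  ultimately show ?thesis by blast
qed

section \<open>Energy spaces and the representation theorem\<close>

text \<open>The quadratic is tested at \<open>t = - c / (s + 1)\<close>; the added 1 covers
  \<open>s = 0\<close>.\<close>

lemma quadratic_nonneg_imp_linear_coeff_0:
  fixes c s :: real
  assumes "\<And>t. 0 \<le> t\<^sup>2 * s + 2 * t * c" "s \<ge> 0"
  shows "c = 0"
proof -
  define r where "r = c / (s + 1)"
  have c: "c = r * (s + 1)" using assms(2) by (simp add: r_def)
  have "0 \<le> (- r)\<^sup>2 * s + 2 * (- r) * c" by (rule assms)
  also have "\<dots> = - (r\<^sup>2 * (s + 2))" by (simp add: c power2_eq_square algebra_simps)
  finally have "r\<^sup>2 * (s + 2) \<le> 0" by simp
  then have "r = 0" using assms(2) by (simp add: mult_le_0_iff)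
  then show ?thesis by (simp add: c)
qed

text \<open>Abstracts from function spaces: \<open>V\<close> stands for the image of
  \<open>H\<^sup>1\<^sub>0(\<Omega>)\<close>, \<open>P\<close> for the embedding into
  \<open>L\<^sup>2\<close> and \<open>a\<close> for the energy form, of which only values on
  \<open>V\<close> are controlled. The upper bound concerns the diagonal; Cauchy-Schwarz spreads it
  to all pairs in \<open>a_bound\<close>.\<close>

locale energy_space =
  fixes V :: "'h::{real_inner,banach} set"
    and P :: "'h \<Rightarrow> 'l::real_inner"
    and a :: "'h \<Rightarrow> 'h \<Rightarrow> real"
    and \<alpha> \<beta> :: real
  assumes V: "subspace V" "closed V"
    and P: "bounded_linear P"
    and a_sym: "\<And>x y. x \<in> V \<Longrightarrow> y \<in> V \<Longrightarrow> a x y = a y x"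
    and a_add: "\<And>x y z. x \<in> V \<Longrightarrow> y \<in> V \<Longrightarrow> z \<in> V \<Longrightarrow> a (x + y) z = a x z + a y z"
    and a_scale: "\<And>x y r. x \<in> V \<Longrightarrow> y \<in> V \<Longrightarrow> a (r *\<^sub>R x) y = r * a x y"
    and \<alpha>: "\<alpha> > 0"
    and coercive: "\<And>x. x \<in> V \<Longrightarrow> \<alpha> * (norm x)\<^sup>2 \<le> a x x"
    and bounded: "\<And>x. x \<in> V \<Longrightarrow> a x x \<le> \<beta> * (norm x)\<^sup>2"
begin

lemmas V_closed [simp] =
  subspace_0[OF V(1)] subspace_add[OF V(1)] subspace_diff[OF V(1)] subspace_scale[OF V(1)]
  subspace_neg[OF V(1)] subspace_sum[OF V(1)]

lemma a_add_right: "x \<in> V \<Longrightarrow> y \<in> V \<Longrightarrow> z \<in> V \<Longrightarrow> a z (x + y) = a z x + a z y"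
  using a_add[of x y z] a_sym[of z "x + y"] a_sym[of z x] a_sym[of z y] by simp

lemma a_scale_right: "x \<in> V \<Longrightarrow> y \<in> V \<Longrightarrow> a y (r *\<^sub>R x) = r * a y x"
  using a_scale[of x y r] a_sym[of y "r *\<^sub>R x"] a_sym[of y x] by simp

lemma a_diff: "x \<in> V \<Longrightarrow> y \<in> V \<Longrightarrow> z \<in> V \<Longrightarrow> a (x - y) z = a x z - a y z"
  using a_add[of x "(- 1) *\<^sub>R y" z] a_scale[of y z "-1"] by simp

lemma a_diff_right: "x \<in> V \<Longrightarrow> y \<in> V \<Longrightarrow> z \<in> V \<Longrightarrow> a z (x - y) = a z x - a z y"
  using a_diff[of x y z] a_sym[of z "x - y"] a_sym[of z x] a_sym[of z y] by simp

lemma a_nonneg: "x \<in> V \<Longrightarrow> a x x \<ge> 0"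
  using coercive[of x] \<alpha> by (meson order_trans less_imp_le mult_nonneg_nonneg zero_le_power2)

lemma a_eq_0: "x \<in> V \<Longrightarrow> a x x = 0 \<Longrightarrow> x = 0"
  using coercive[of x] \<alpha> by (simp add: mult_le_0_iff)

lemma a_quadratic:
  assumes "x \<in> V" "y \<in> V"
  shows "a (x + t *\<^sub>R y) (x + t *\<^sub>R y) = a x x + 2 * t * a x y + t\<^sup>2 * a y y"
  using assms a_sym[of x y]
  by (simp add: a_add a_add_right a_scale a_scale_right power2_eq_square algebra_simps)

lemma a_cauchy_schwarz:
  assumes "x \<in> V" "y \<in> V"
  shows "(a x y)\<^sup>2 \<le> a x x * a y y"
proof (cases "a y y = 0")
  case True
  then have "y = 0" using a_eq_0 assms by blast
  then have "a x y = 0" using a_scale_right[of x x 0] assms by simp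
  then show ?thesis using True by simp
next
  case False
  then have pos: "a y y > 0" using a_nonneg[of y] assms by simp
  have "0 \<le> a (x + (- a x y / a y y) *\<^sub>R y) (x + (- a x y / a y y) *\<^sub>R y)"
    using assms by (intro a_nonneg) auto
  also have "\<dots> = a x x - (a x y)\<^sup>2 / a y y"
    using pos by (subst a_quadratic[OF assms]) (simp add: field_simps power2_eq_square)
  finally show ?thesis using pos by (simp add: field_simps)
qed

lemma a_bound:
  assumes "x \<in> V" "y \<in> V"
  shows "\<bar>a x y\<bar> \<le> \<bar>\<beta>\<bar> * norm x * norm y"
proof (rule power2_le_imp_le)
  have "(a x y)\<^sup>2 \<le> a x x * a y y" by (rule a_cauchy_schwarz[OF assms])
  also have "\<dots> \<le> (\<bar>\<beta>\<bar> * (norm x)\<^sup>2) * (\<bar>\<beta>\<bar> * (norm y)\<^sup>2)"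
    using assms bounded[of x] bounded[of y] a_nonneg
    by (intro mult_mono) (auto intro: order_trans[OF _ mult_right_mono[OF abs_ge_self]])
  finally show "\<bar>a x y\<bar>\<^sup>2 \<le> (\<bar>\<beta>\<bar> * norm x * norm y)\<^sup>2"
    by (simp add: power2_eq_square mult_ac)
qed auto

text \<open>The representing vector minimises \<open>a v v - 2 f v\<close>; minimising sequences are Cauchy by the
  parallelogram law.\<close>

lemma riesz:
  fixes f :: "'h \<Rightarrow> real"
  assumes "bounded_linear f"
  shows "\<exists>w\<in>V. \<forall>v\<in>V. a w v = f v"
proof -
  interpret f: bounded_linear f by fact
  obtain K where K: "K \<ge> 0" "\<And>v. \<bar>f v\<bar> \<le> norm v * K" using f.nonneg_bounded by auto
  define J where "J v = a v v - 2 * f v" for v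
  have J_ge: "- K\<^sup>2 / \<alpha> \<le> J v" if "v \<in> V" for v
  proof -
    have "0 \<le> (\<alpha> * norm v - K)\<^sup>2" by simp
    then have "0 \<le> \<alpha> * (\<alpha> * (norm v)\<^sup>2 - 2 * (norm v * K)) + K\<^sup>2"
      by (simp add: power2_diff power_mult_distrib power2_eq_square algebra_simps)
    then have "- K\<^sup>2 / \<alpha> \<le> \<alpha> * (norm v)\<^sup>2 - 2 * (norm v * K)"
      using \<alpha> by (simp add: field_simps)
    also have "\<dots> \<le> J v" using coercive[OF that] K(2)[of v] by (simp add: J_def)
    finally show ?thesis .
  qed
  define m where "m = Inf (J ` V)"
  have bdd: "bdd_below (J ` V)" using J_ge by (auto simp: bdd_below_def)
  have m_le: "m \<le> J v" if "v \<in> V" for v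
    unfolding m_def using that bdd by (auto intro: cInf_lower)
  have "\<exists>v\<in>V. J v < m + 1 / (real n + 1)" for n
  proof -
    have "J ` V \<noteq> {}" using V_closed(1) by blast
    then show ?thesis
      using cInf_lessD[of "J ` V" "m + 1 / (real n + 1)"] by (auto simp: m_def)
  qed
  then obtain x where x: "\<And>n. x n \<in> V" "\<And>n. J (x n) < m + 1 / (real n + 1)" by metis
  \<comment> \<open>The midpoint lies in \<open>V\<close>, so \<open>J\<close> is at least
    \<open>m\<close> there; the identity then bounds the energy distance of two nearly minimal
    vectors by their excess over \<open>m\<close>.\<close>
  have parallelogram: "a (u - v) (u - v) = 2 * J u + 2 * J v - 4 * J ((1/2) *\<^sub>R (u + v))"
    if "u \<in> V" "v \<in> V" for u v
  proof -
    have "a ((1/2) *\<^sub>R (u + v)) ((1/2) *\<^sub>R (u + v)) = (1/4) * a (u + v) (u + v)"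
      using that by (simp add: a_scale a_scale_right)
    then have half: "4 * J ((1/2) *\<^sub>R (u + v)) = a (u + v) (u + v) - 4 * f u - 4 * f v"
      unfolding J_def f.scaleR f.add real_scaleR_def by (simp only:) (simp add: algebra_simps)
    show ?thesis
      unfolding half using that
      by (simp add: J_def a_add a_add_right a_diff a_diff_right algebra_simps)
  qed
  have near: "\<alpha> * (norm (x i - x k))\<^sup>2 \<le> 4 / (real N + 1)" if "i \<ge> N" "k \<ge> N" for i k N
  proof -
    have "\<alpha> * (norm (x i - x k))\<^sup>2 \<le> a (x i - x k) (x i - x k)"
      using x by (intro coercive) auto
    also have "\<dots> \<le> 2 * (m + 1 / (real i + 1)) + 2 * (m + 1 / (real k + 1)) - 4 * m"
      using parallelogram[OF x(1)[of i] x(1)[of k]] x(2)[of i] x(2)[of k]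
        m_le[of "(1/2) *\<^sub>R (x i + x k)"] x(1) by simp
    also have "\<dots> \<le> 4 / (real N + 1)"
      using that frac_le[of 1 1 "real N + 1" "real i + 1"] frac_le[of 1 1 "real N + 1" "real k + 1"] by simp
    finally show ?thesis .
  qed
  have "Cauchy x"
  proof (rule metric_CauchyI)
    fix e :: real assume e: "0 < e"
    obtain N where N: "4 / (\<alpha> * e\<^sup>2) < real N" using reals_Archimedean2 by blast
    have "dist (x i) (x k) < e" if "i \<ge> N" "k \<ge> N" for i k
    proof -
      have "4 < \<alpha> * e\<^sup>2 * (real N + 1)"
        using N e \<alpha> by (simp add: field_simps add_strict_increasing)
      then have "4 / (real N + 1) < \<alpha> * e\<^sup>2" by (simp add: field_simps)
      then have "\<alpha> * (norm (x i - x k))\<^sup>2 < \<alpha> * e\<^sup>2" using near[OF that] by linarith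
      then have "(norm (x i - x k))\<^sup>2 < e\<^sup>2" using \<alpha> by simp
      then show ?thesis using e by (simp add: dist_norm power2_less_imp_less)
    qed
    then show "\<exists>M. \<forall>i\<ge>M. \<forall>k\<ge>M. dist (x i) (x k) < e" by blast
  qed
  then obtain w where w: "x \<longlonglongrightarrow> w" using Cauchy_convergent convergent_def by blast
  have wV: "w \<in> V" using V(2) x(1) w by (rule closed_sequentially)
  have "a w v = f v" if v: "v \<in> V" for v
  proof -
    have "(\<lambda>n. a w v - a (x n) v) \<longlonglongrightarrow> 0"
    proof (rule Lim_null_comparison)
      show "\<forall>\<^sub>F n in sequentially. norm (a w v - a (x n) v) \<le> \<bar>\<beta>\<bar> * norm (w - x n) * norm v"
        using a_bound[of "w - x _" v] wV x(1) v by (simp add: a_diff[symmetric])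
      have "(\<lambda>n. \<bar>\<beta>\<bar> * norm (w - x n) * norm v) \<longlonglongrightarrow> \<bar>\<beta>\<bar> * norm (w - w) * norm v"
        by (intro tendsto_intros w)
      then show "(\<lambda>n. \<bar>\<beta>\<bar> * norm (w - x n) * norm v) \<longlonglongrightarrow> 0" by simp
    qed
    from tendsto_diff[OF tendsto_const[of "a w v"] this]
    have "(\<lambda>n. a (x n) v) \<longlonglongrightarrow> a w v" by simp
    have "0 \<le> t\<^sup>2 * a v v + 2 * t * (a w v - f v)" for t
    proof (rule tendsto_le[OF sequentially_bot])
      show "(\<lambda>n. t\<^sup>2 * a v v + 2 * t * (a (x n) v - f v)) \<longlonglongrightarrow> t\<^sup>2 * a v v + 2 * t * (a w v - f v)"
        by (intro tendsto_intros \<open>(\<lambda>n. a (x n) v) \<longlonglongrightarrow> a w v\<close>)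
      show "(\<lambda>n. - (1 / (real n + 1))) \<longlonglongrightarrow> 0"
        using tendsto_minus[OF LIMSEQ_inverse_real_of_nat] by (simp add: inverse_eq_divide add.commute)
      show "\<forall>\<^sub>F n in sequentially. - (1 / (real n + 1)) \<le> t\<^sup>2 * a v v + 2 * t * (a (x n) v - f v)"
      proof (rule always_eventually, rule allI)
        fix n
        \<comment> \<open>Near-minimality of \<open>x n\<close> already gives the variational
          inequality up to \<open>1 / (n + 1)\<close>; the limit is taken in this inequality rather
          than in \<open>J\<close>.\<close>
        have "J (x n) - 1 / (real n + 1) \<le> J (x n + t *\<^sub>R v)"
          using x[of n] m_le[of "x n + t *\<^sub>R v"] v by simp
        then show "- (1 / (real n + 1)) \<le> t\<^sup>2 * a v v + 2 * t * (a (x n) v - f v)"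
          using x(1)[of n] v by (simp add: J_def a_quadratic f.add f.scaleR algebra_simps)
      qed
    qed
    then have "a w v - f v = 0"
      using a_nonneg[OF v] by (rule quadratic_nonneg_imp_linear_coeff_0)
    then show ?thesis by simp
  qed
  then show ?thesis using wV by blast
qed

section \<open>The solution operator \<open>G\<close> and its bounds\<close>

lemma representative_unique:
  assumes "w \<in> V" "w' \<in> V" "\<And>v. v \<in> V \<Longrightarrow> a w v = a w' v"
  shows "w = w'"
proof -
  have "a (w - w') (w - w') = 0" using assms by (simp add: a_diff)
  then show ?thesis using a_eq_0[of "w - w'"] assms by simp
qed

text \<open>Only \<open>P x\<close> enters, so this is the solution operator for the
  \<open>L\<^sup>2\<close> right-hand side \<open>P x\<close>, composed with the embedding and
  extended to the whole ambient space.\<close>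

definition G :: "'h \<Rightarrow> 'h" where
  "G x = (SOME w. w \<in> V \<and> (\<forall>v\<in>V. a w v = P x \<bullet> P v))"

lemma G: "G x \<in> V" "v \<in> V \<Longrightarrow> a (G x) v = P x \<bullet> P v"
proof -
  have "bounded_linear (\<lambda>v. P x \<bullet> P v)"
    by (rule bounded_linear_compose[OF bounded_linear_inner_right P])
  then have "\<exists>w. w \<in> V \<and> (\<forall>v\<in>V. a w v = P x \<bullet> P v)" using riesz by blast
  then have "G x \<in> V \<and> (\<forall>v\<in>V. a (G x) v = P x \<bullet> P v)"
    unfolding G_def by (rule someI_ex)
  then show "G x \<in> V" "v \<in> V \<Longrightarrow> a (G x) v = P x \<bullet> P v" by auto
qed

lemma G_eqI: "w \<in> V \<Longrightarrow> (\<And>v. v \<in> V \<Longrightarrow> a w v = P x \<bullet> P v) \<Longrightarrow> G x = w"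
  by (rule representative_unique) (auto simp: G)

text \<open>Both sides equal \<open>a (G x) (G y)\<close>; for \<open>y = x\<close> that value is
  nonnegative, which is \<open>G_nonneg\<close>.\<close>

lemma G_sym: "P (G x) \<bullet> P y = P x \<bullet> P (G y)"
  using G(2)[OF G(1), of x y] G(2)[OF G(1), of y x] a_sym[OF G(1) G(1), of x y]
  by (simp add: inner_commute)

lemma G_nonneg: "P (G x) \<bullet> P x \<ge> 0"
  using a_nonneg[OF G(1), of x] G(2)[OF G(1), of x x] by (simp add: inner_commute)

definition Pbound :: real where "Pbound = onorm P"

lemma Pbound: "norm (P x) \<le> Pbound * norm x" "Pbound \<ge> 0"
  unfolding Pbound_def using onorm[OF P] onorm_pos_le[OF P] by auto

text \<open>The equation is tested with \<open>v = G x\<close> and divided by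
  \<open>norm (G x)\<close>. Only \<open>P x\<close> stands on the right: this gain over the full
  norm yields \<open>PG_bound\<close>, an estimate within \<open>L\<^sup>2\<close> on which
  uniqueness rests.\<close>

lemma G_bound: "norm (G x) \<le> (Pbound / \<alpha>) * norm (P x)"
proof (cases "G x = 0")
  case True
  then show ?thesis using Pbound \<alpha> by simp
next
  case False
  have "\<alpha> * (norm (G x))\<^sup>2 \<le> P x \<bullet> P (G x)"
    using coercive[OF G(1), of x] G(2)[OF G(1), of x x] by simp
  also have "\<dots> \<le> norm (P x) * norm (P (G x))" by (rule norm_cauchy_schwarz)
  also have "\<dots> \<le> norm (P x) * (Pbound * norm (G x))"
    by (intro mult_left_mono Pbound) simp
  finally have "norm (G x) * (\<alpha> * norm (G x)) \<le> norm (G x) * (Pbound * norm (P x))"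
    by (simp add: power2_eq_square mult_ac)
  then have "\<alpha> * norm (G x) \<le> Pbound * norm (P x)"
    using False by (subst (asm) mult_le_cancel_left_pos) auto
  then show ?thesis using \<alpha> by (simp add: field_simps)
qed

lemma G_linear: "bounded_linear G"
proof (rule bounded_linear_intro)
  interpret P: bounded_linear P by (rule P)
  fix x y r
  show "G (x + y) = G x + G y"
    by (rule G_eqI) (auto simp: G  a_add P.add inner_add_left)
  show "G (r *\<^sub>R x) = r *\<^sub>R G x"
    by (rule G_eqI) (auto simp: G  a_scale P.scaleR)
  show "norm (G x) \<le> norm x * (Pbound / \<alpha> * Pbound)"
    using order_trans[OF G_bound mult_left_mono[OF Pbound(1)], of x] Pbound(2) \<alpha>
    by (simp add: mult_ac)
qed

definition PGbound :: real where "PGbound = Pbound * (Pbound / \<alpha>)"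

lemma PG_bound: "norm (P (G x)) \<le> PGbound * norm (P x)" "PGbound \<ge> 0"
proof -
  have "norm (P (G x)) \<le> Pbound * norm (G x)" by (rule Pbound)
  also have "\<dots> \<le> Pbound * ((Pbound / \<alpha>) * norm (P x))" by (intro mult_left_mono G_bound Pbound)
  finally show "norm (P (G x)) \<le> PGbound * norm (P x)" by (simp add: PGbound_def mult.assoc)
  show "PGbound \<ge> 0" using Pbound \<alpha> by (simp add: PGbound_def)
qed

section \<open>The flow in an energy space\<close>

definition gram :: "('n \<Rightarrow> 'h) \<Rightarrow> 'n \<Rightarrow> 'n \<Rightarrow> real" where
  "gram u i j = P (u i) \<bullet> P (u j)"

definition gramG :: "('n \<Rightarrow> 'h) \<Rightarrow> 'n \<Rightarrow> 'n \<Rightarrow> real" where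
  "gramG u i j = P (G (u i)) \<bullet> P (u j)"

definition flow :: "('n::finite \<Rightarrow> 'h) \<Rightarrow> 'n \<Rightarrow> 'h" where
  "flow u k = (\<Sum>i\<in>UNIV. gram u i k *\<^sub>R G (u i)) - (\<Sum>i\<in>UNIV. gramG u i k *\<^sub>R u i)"

text \<open>Continuity of the derivative is a consequence: differentiable curves are continuous, and
  \<open>flow\<close> is continuous along them by \<open>continuous_on_flow\<close>.\<close>

definition flow_solution :: "(real \<Rightarrow> 'n::finite \<Rightarrow> 'h) \<Rightarrow> bool" where
  "flow_solution u \<longleftrightarrow> (\<forall>t\<ge>0. \<forall>k. u t k \<in> V \<and>
     ((\<lambda>t. u t k) has_vector_derivative flow (u t) k) (at t within {0..}))"

lemma has_vector_derivative_P:
  "(f has_vector_derivative f') F \<Longrightarrow> ((\<lambda>t. P (f t)) has_vector_derivative P f') F"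
  by (rule bounded_linear.has_vector_derivative[OF P])

lemma has_real_derivative_P_inner:
  assumes "(f has_vector_derivative f') (at t within S)" "(g has_vector_derivative g') (at t within S)"
  shows "((\<lambda>t. P (f t) \<bullet> P (g t)) has_real_derivative P f' \<bullet> P (g t) + P (f t) \<bullet> P g') (at t within S)"
  using bounded_bilinear.has_vector_derivative[OF bounded_bilinear_inner
      has_vector_derivative_P[OF assms(1)] has_vector_derivative_P[OF assms(2)]]
  by (simp add: has_real_derivative_iff_has_vector_derivative add.commute)

lemma P_sum: "P (\<Sum>i\<in>A. c i *\<^sub>R f i) = (\<Sum>i\<in>A. c i *\<^sub>R P (f i))"
  using P by (simp add: bounded_linear.linear linear_sum linear_cmul)

lemma P_diff: "P (x - y) = P x - P y"
  using P by (simp add: bounded_linear.linear linear_diff)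

lemma G_sum: "G (\<Sum>i\<in>A. c i *\<^sub>R f i) = (\<Sum>i\<in>A. c i *\<^sub>R G (f i))"
  using G_linear by (simp add: bounded_linear.linear linear_sum linear_cmul)

lemma G_diff: "G (x - y) = G x - G y"
  using G_linear by (simp add: bounded_linear.linear linear_diff)

text \<open>The difference of the two sums is antisymmetric in \<open>i\<close> and
  \<open>j\<close>, so the derivative of the Gram matrix, which adds both orders, is zero.\<close>

lemma P_flow_inner:
  "P (flow u i) \<bullet> P (u j) = (\<Sum>l\<in>UNIV. gram u l i * gramG u l j) - (\<Sum>l\<in>UNIV. gramG u l i * gram u l j)"
  by (simp add: flow_def P_diff P_sum inner_diff_left inner_sum_left gram_def gramG_def)

section \<open>Conservation of the Gram matrix and uniqueness of the flow\<close>

lemma gram_conserved: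
  assumes u: "flow_solution u" and t: "t \<ge> 0"
  shows "gram (u t) i j = gram (u 0) i j"
proof -
  have "((\<lambda>t. gram (u t) i j) has_real_derivative 0) (at t within {0..})" if "t \<ge> 0" for t
  proof -
    have "((\<lambda>t. gram (u t) i j) has_real_derivative
        P (flow (u t) i) \<bullet> P (u t j) + P (u t i) \<bullet> P (flow (u t) j)) (at t within {0..})"
      unfolding gram_def using u that
      by (intro has_real_derivative_P_inner) (auto simp: flow_solution_def)
    moreover have "P (flow (u t) i) \<bullet> P (u t j) + P (u t i) \<bullet> P (flow (u t) j) = 0"
      using P_flow_inner[of "u t" i j] P_flow_inner[of "u t" j i]
      by (simp add: inner_commute[of "P (u t i)"] mult.commute)
    ultimately show ?thesis by simp
  qed
  then show ?thesis
    using t has_field_derivative_zero_constant[of "{0..}" "\<lambda>t. gram (u t) i j"]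
    by (metis atLeast_iff convex_real_interval(1) order_refl)
qed

lemma continuous_on_flow:
  assumes "\<And>k. continuous_on S (\<lambda>t. u t k)"
  shows "continuous_on S (\<lambda>t. flow (u t) k)"
  unfolding flow_def gram_def gramG_def
  by (intro continuous_intros bounded_linear.continuous_on[OF P] bounded_linear.continuous_on[OF G_linear]
      assms)

text \<open>For orthonormal tuples the Gram factors disappear and every \<open>P (u i)\<close> has
  norm 1, which makes the cubic expression Lipschitz. The constant collects \<open>PGbound\<close>
  from \<open>G (u k - w k)\<close> and, for each \<open>i\<close>, once \<open>PGbound\<close> from
  changing the vector and twice from changing its coefficient.\<close>

lemma P_diff_flow_bound:
  fixes u w :: "'n::finite \<Rightarrow> 'h"
  assumes u: "\<And>i j. gram u i j = (if i = j then 1 else 0)"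
    and w: "\<And>i j. gram w i j = (if i = j then 1 else 0)"
    and r: "\<And>i. norm (P (u i - w i)) \<le> r"
  shows "norm (P (flow u k - flow w k)) \<le> (1 + 3 * CARD('n)) * PGbound * r"
proof -
  have norm_u: "norm (P (u i)) = 1" and norm_w: "norm (P (w i)) = 1" for i
    using u[of i i] w[of i i] by (simp_all add: gram_def norm_eq_sqrt_inner)
  have flow_eq: "flow v k = G (v k) - (\<Sum>i\<in>UNIV. gramG v i k *\<^sub>R v i)"
    if "\<And>i j. gram v i j = (if i = j then 1 else 0)" for v
    by (simp add: flow_def that if_distrib[of "\<lambda>c. c *\<^sub>R _"] cong: if_cong)
  have r0: "r \<ge> 0" using r norm_ge_zero order_trans by blast
  have PG_r: "norm (P (G (u i - w i))) \<le> PGbound * r" for i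
    using PG_bound(1)[of "u i - w i"] mult_left_mono[OF r PG_bound(2)] by (rule order_trans)
  have inner_bound: "\<bar>x \<bullet> y\<bar> \<le> c" if "norm x \<le> c" "norm y = 1" for x y :: 'l and c
    using Cauchy_Schwarz_ineq2[of x y] that by simp
  have A_u: "\<bar>gramG u i k\<bar> \<le> PGbound" for i
    unfolding gramG_def using PG_bound(1)[of "u i"] norm_u by (intro inner_bound) auto
  have A_diff: "\<bar>gramG u i k - gramG w i k\<bar> \<le> 2 * PGbound * r" for i
  proof -
    have "gramG u i k - gramG w i k = P (G (u i - w i)) \<bullet> P (u k) + P (u k - w k) \<bullet> P (G (w i))"
      by (simp add: gramG_def G_diff P_diff inner_diff_left inner_diff_right inner_commute)
    \<comment> \<open>Symmetry moves \<open>G\<close> onto the difference, so both terms fall under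
      \<open>PG_r\<close> with a unit vector as second factor.\<close>
    also have "P (u k - w k) \<bullet> P (G (w i)) = P (G (u k - w k)) \<bullet> P (w i)"
      by (simp add: G_sym)
    finally have "gramG u i k - gramG w i k = P (G (u i - w i)) \<bullet> P (u k) + P (G (u k - w k)) \<bullet> P (w i)" .
    moreover have "\<bar>P (G (u i - w i)) \<bullet> P (u k)\<bar> \<le> PGbound * r"
      by (intro inner_bound PG_r norm_u)
    moreover have "\<bar>P (G (u k - w k)) \<bullet> P (w i)\<bar> \<le> PGbound * r"
      by (intro inner_bound PG_r norm_w)
    ultimately show ?thesis by linarith
  qed
  have "P (flow u k - flow w k) = P (G (u k - w k)) - (\<Sum>i\<in>UNIV. gramG u i k *\<^sub>R P (u i) - gramG w i k *\<^sub>R P (w i))"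
    by (simp add: flow_eq[OF u] flow_eq[OF w] P_diff P_sum G_diff sum_subtractf)
  also have "(\<Sum>i\<in>UNIV. gramG u i k *\<^sub>R P (u i) - gramG w i k *\<^sub>R P (w i))
      = (\<Sum>i\<in>UNIV. gramG u i k *\<^sub>R P (u i - w i) + (gramG u i k - gramG w i k) *\<^sub>R P (w i))"
    by (simp add: P_diff scaleR_diff_right scaleR_diff_left)
  finally have "norm (P (flow u k - flow w k)) \<le> norm (P (G (u k - w k))) +
      norm (\<Sum>i\<in>UNIV. gramG u i k *\<^sub>R P (u i - w i) + (gramG u i k - gramG w i k) *\<^sub>R P (w i))"
    by (simp add: norm_triangle_ineq4)
  also have "\<dots> \<le> PGbound * r + (\<Sum>i\<in>(UNIV :: 'n set). 3 * PGbound * r)"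
  proof (intro add_mono PG_r sum_norm_le)
    fix i
    have "norm (gramG u i k *\<^sub>R P (u i - w i)) \<le> PGbound * r"
      using A_u[of i] r[of i] PG_bound(2) by (auto intro: mult_mono)
    moreover have "norm ((gramG u i k - gramG w i k) *\<^sub>R P (w i)) \<le> 2 * PGbound * r"
      using A_diff[of i] norm_w by simp
    ultimately show "norm (gramG u i k *\<^sub>R P (u i - w i) + (gramG u i k - gramG w i k) *\<^sub>R P (w i)) \<le> 3 * PGbound * r"
      using norm_triangle_ineq[of "gramG u i k *\<^sub>R P (u i - w i)" "(gramG u i k - gramG w i k) *\<^sub>R P (w i)"]
      by linarith
  qed
  also have "\<dots> = (1 + 3 * CARD('n)) * PGbound * r" by (simp add: algebra_simps)
  finally show ?thesis .
qed

text \<open>Gronwall's inequality for \<open>f\<close>, the squared \<open>L\<^sup>2\<close>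
  distance. Equality under \<open>P\<close> is the right conclusion because functions are identified
  by their values almost everywhere.\<close>

theorem flow_solution_unique:
  fixes u w :: "real \<Rightarrow> 'n::finite \<Rightarrow> 'h"
  assumes u: "flow_solution u" and w: "flow_solution w"
    and init: "u 0 = w 0" "\<And>i j. gram (u 0) i j = (if i = j then 1 else 0)"
    and t: "t \<ge> 0"
  shows "P (u t k) = P (w t k)"
proof -
  define D where "D t k = P (u t k - w t k)" for t k
  define f where "f t = (\<Sum>k\<in>UNIV. D t k \<bullet> D t k)" for t
  \<comment> \<open>With \<open>r = sqrt (f t)\<close> in \<open>P_diff_flow_bound\<close>, each
    summand of \<open>f'\<close> is at most \<open>2 * (1 + 3 * CARD('n)) * PGbound * f t\<close>,
    and there are \<open>CARD('n)\<close> of them.\<close>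
  define C where "C = 2 * CARD('n) * ((1 + 3 * CARD('n)) * PGbound)"
  define f' where "f' t = (\<Sum>k\<in>UNIV. 2 * (P (flow (u t) k - flow (w t) k) \<bullet> D t k))" for t
  have f': "(f has_real_derivative f' t) (at t within {0..})" if "t \<ge> 0" for t
    unfolding f_def f'_def
  proof (rule DERIV_sum)
    fix k
    have "((\<lambda>t. u t k - w t k) has_vector_derivative flow (u t) k - flow (w t) k) (at t within {0..})"
      using u w that by (intro has_vector_derivative_diff) (auto simp: flow_solution_def)
    from has_real_derivative_P_inner[OF this this]
    show "((\<lambda>t. D t k \<bullet> D t k) has_real_derivative 2 * (P (flow (u t) k - flow (w t) k) \<bullet> D t k)) (at t within {0..})"
      by (simp add: D_def inner_commute)
  qed
  have bound: "f' t \<le> C * f t" if t: "t \<ge> 0" for t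
  proof -
    have f0: "f t \<ge> 0" unfolding f_def by (intro sum_nonneg) simp
    have D: "norm (D t k) \<le> sqrt (f t)" for k
    proof (rule real_le_rsqrt)
      have "D t k \<bullet> D t k \<le> f t" unfolding f_def by (rule member_le_sum) auto
      then show "(norm (D t k))\<^sup>2 \<le> f t" by (simp add: power2_norm_eq_inner)
    qed
    have gu: "gram (u t) i j = (if i = j then 1 else 0)" for i j
      using gram_conserved[OF u t] init by simp
    have gw: "gram (w t) i j = (if i = j then 1 else 0)" for i j
      using gram_conserved[OF w t] init by simp
    have "f' t \<le> (\<Sum>k\<in>(UNIV::'n set). 2 * ((1 + 3 * CARD('n)) * PGbound * f t))"
      unfolding f'_def
    proof (intro sum_mono mult_left_mono)
      fix k
      have "P (flow (u t) k - flow (w t) k) \<bullet> D t k \<le> norm (P (flow (u t) k - flow (w t) k)) * norm (D t k)"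
        by (rule norm_cauchy_schwarz)
      also have "\<dots> \<le> ((1 + 3 * CARD('n)) * PGbound * sqrt (f t)) * sqrt (f t)"
        using PG_bound(2) f0 D unfolding D_def
        by (intro mult_mono P_diff_flow_bound gu gw) auto
      finally show "P (flow (u t) k - flow (w t) k) \<bullet> D t k \<le> (1 + 3 * CARD('n)) * PGbound * f t"
        using f0 by (simp add: mult.assoc)
    qed simp
    also have "\<dots> = C * f t" by (simp add: C_def)
    finally show ?thesis .
  qed
  \<comment> \<open>The monotonicity lemma is about increasing functions, hence the sign:
    \<open>exp (- C * t) * f t\<close> decreases and starts at 0.\<close>
  have "- (exp (- C * 0) * f 0) \<le> - (exp (- C * t) * f t)"
  proof (rule has_real_derivative_nonneg_imp_mono[where a=0 and f="\<lambda>t. - (exp (- C * t) * f t)"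
        and f'="\<lambda>t. exp (- C * t) * (C * f t - f' t)"])
    fix t :: real assume t: "t \<ge> 0"
    show "((\<lambda>t. - (exp (- C * t) * f t)) has_real_derivative exp (- C * t) * (C * f t - f' t)) (at t within {0..})"
      by (auto intro!: derivative_eq_intros f'[OF t] simp: algebra_simps)
    show "0 \<le> exp (- C * t) * (C * f t - f' t)" using bound[OF t] by simp
  qed (use t in auto)
  moreover have "f 0 = 0" using P_diff[of 0 0] by (simp add: f_def D_def init)
  ultimately have "f t \<le> 0" by (simp add: mult_le_0_iff)
  moreover have "D t k \<bullet> D t k \<le> f t" unfolding f_def by (rule member_le_sum) auto
  ultimately have "D t k \<bullet> D t k = 0" using inner_ge_zero[of "D t k"] by linarith
  then show ?thesis by (simp add: D_def P_diff)
qed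

text \<open>\<open>G\<close> is bounded, so in the ambient space this is a linear equation with a
  constant bounded coefficient. Integration gives \<open>x t = x0 + G (\<integral> x)\<close>, and
  the range of \<open>G\<close> lies in \<open>V\<close>.\<close>

lemma heat_semigroup:
  assumes "x0 \<in> V"
  obtains x where "x 0 = x0" "\<And>t. t \<ge> 0 \<Longrightarrow> x t \<in> V"
    "\<And>t. t \<ge> 0 \<Longrightarrow> (x has_vector_derivative G (x t)) (at t within {0..})"
proof -
  interpret G: bounded_linear G by (rule G_linear)
  obtain K where K: "K \<ge> 0" "\<And>x. norm (G x) \<le> norm x * K" using G.nonneg_bounded by auto
  have "\<exists>x. x 0 = x0 \<and> (\<forall>t\<ge>0. (x has_vector_derivative G (x t)) (at t within {0..}))"
  proof (rule linear_ode_exists[where l="\<lambda>_. K"])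
    show "\<And>x. continuous_on {0..} x \<Longrightarrow> continuous_on {0..} (\<lambda>t. G (x t))"
      by (rule G.continuous_on)
    show "\<And>x y. norm (G x - G y) \<le> K * norm (x - y)"
      using K(2) by (simp flip: G.diff add: mult.commute)
  qed (use K in \<open>auto simp: G.zero\<close>)
  then obtain x where x: "x 0 = x0" "\<And>t. t \<ge> 0 \<Longrightarrow> (x has_vector_derivative G (x t)) (at t within {0..})"
    by blast
  have x_cont: "continuous_on {0..} x"
    using x(2) by (auto simp: continuous_on_eq_continuous_within intro: has_vector_derivative_continuous)
  have "x t \<in> V" if t: "t \<ge> 0" for t
  proof -
    have "((\<lambda>s. G (x s)) has_integral x t - x 0) {0..t}"
      by (intro fundamental_theorem_of_calculus[OF t] has_vector_derivative_within_subset[OF x(2)]) auto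
    moreover have "((\<lambda>s. G (x s)) has_integral G (integral {0..t} x)) {0..t}"
      using has_integral_linear[OF integrable_integral[OF integrable_continuous_real] G_linear]
        continuous_on_subset[OF x_cont, of "{0..t}"] by (simp add: o_def)
    ultimately have "x t = x0 + G (integral {0..t} x)"
      using has_integral_unique x(1) by (metis add.commute diff_eq_eq)
    then show ?thesis using assms G(1) by simp
  qed
  then show thesis using x that by blast
qed

theorem flow_solution_exists:
  fixes u0 :: "'n::finite \<Rightarrow> 'h"
  assumes u0: "\<And>k. u0 k \<in> V" "\<And>i j. gram u0 i j = (if i = j then 1 else 0)"
  shows "\<exists>u. u 0 = u0 \<and> flow_solution u"
proof -
  have "\<forall>i. \<exists>x. x 0 = u0 i \<and> (\<forall>t\<ge>0. x t \<in> V \<and> (x has_vector_derivative G (x t)) (at t within {0..}))"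
    by (metis heat_semigroup u0(1))
  then obtain w where w0: "\<And>i. w i 0 = u0 i" and wV: "\<And>i t. t \<ge> 0 \<Longrightarrow> w i t \<in> V"
    and w': "\<And>i t. t \<ge> 0 \<Longrightarrow> (w i has_vector_derivative G (w i t)) (at t within {0..})"
    by metis
  have w_cont: "continuous_on {0..} (w i)" for i
    using w' by (auto simp: continuous_on_eq_continuous_within intro: has_vector_derivative_continuous)
  have Pw_cont: "continuous_on {0..} (\<lambda>t. P (w i t))" for i
    by (rule bounded_linear.continuous_on[OF P w_cont])
  have PGw_cont: "continuous_on {0..} (\<lambda>t. P (G (w i t)))" for i
    by (rule bounded_linear.continuous_on[OF P bounded_linear.continuous_on[OF G_linear w_cont]])
  \<comment> \<open>\<open>lc t x\<close> combines the \<open>w i t\<close> with coefficients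
    \<open>x\<close>. Thus \<open>M\<close> and \<open>N\<close> are the coordinate matrices of the
    forms \<open>P y \<bullet> P y'\<close> and \<open>P (G y) \<bullet> P y'\<close> on the span of
    the \<open>w i t\<close>, and a column \<open>q k\<close> of the matrix sought becomes the
    component \<open>lc t (q k t)\<close> of the tuple.\<close>
  define lc where "lc t x = (\<Sum>i\<in>UNIV. x $ i *\<^sub>R w i t)" for t and x :: "real^'n"
  have lc_linear: "linear (lc t)" for t
    by (rule linearI) (simp_all add: lc_def scaleR_left_distrib sum.distrib scaleR_sum_right)
  define M :: "real \<Rightarrow> real^'n^'n" where "M t = (\<chi> i j. P (w i t) \<bullet> P (w j t))" for t
  define N :: "real \<Rightarrow> real^'n^'n" where "N t = (\<chi> i j. P (G (w i t)) \<bullet> P (w j t))" for t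
  have inner_M: "x \<bullet> (M t *v y) = P (lc t x) \<bullet> P (lc t y)" for t x y
    unfolding lc_def M_def P_sum inner_sum_left inner_scaleR_left unfolding inner_sum_right inner_scaleR_right
    by (simp add: inner_vec_def matrix_vector_mult_def sum_distrib_left mult.commute)
  have inner_N: "x \<bullet> (N t *v y) = P (G (lc t x)) \<bullet> P (lc t y)" for t x y
    unfolding lc_def N_def P_sum G_sum inner_sum_left inner_scaleR_left unfolding inner_sum_right inner_scaleR_right
    by (simp add: inner_vec_def matrix_vector_mult_def sum_distrib_left mult.commute)
  have lc0: "P (lc 0 x) \<bullet> P (lc 0 x) = (norm x)\<^sup>2" for x
  proof -
    have "M 0 = mat 1" using u0(2) by (simp add: M_def w0 mat_def gram_def vec_eq_iff)
    then show ?thesis by (simp flip: inner_M add: power2_norm_eq_inner)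
  qed
  \<comment> \<open>For fixed coefficients the curve \<open>y = lc t x\<close> solves the linear
    equation as well, so the square of \<open>norm (P y)\<close> has the derivative
    \<open>2 * (P (G y) \<bullet> P y) \<ge> 0\<close>; at time 0 it is the square of
    \<open>norm x\<close> by orthonormality.\<close>
  have coercive_M: "(norm x)\<^sup>2 \<le> x \<bullet> (M t *v x)" if "t \<ge> 0" for x t
  proof -
    have "P (lc 0 x) \<bullet> P (lc 0 x) \<le> P (lc t x) \<bullet> P (lc t x)"
    proof (rule has_real_derivative_nonneg_imp_mono[where a=0 and f="\<lambda>t. P (lc t x) \<bullet> P (lc t x)"
          and f'="\<lambda>t. 2 * (P (G (lc t x)) \<bullet> P (lc t x))"])
      fix t :: real assume t: "t \<ge> 0"
      have "((\<lambda>t. lc t x) has_vector_derivative G (lc t x)) (at t within {0..})"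
        unfolding lc_def G_sum by (auto intro!: derivative_eq_intros w'[OF t])
      from has_real_derivative_P_inner[OF this this]
      show "((\<lambda>t. P (lc t x) \<bullet> P (lc t x)) has_real_derivative 2 * (P (G (lc t x)) \<bullet> P (lc t x)))
          (at t within {0..})"
        by (simp add: inner_commute)
      show "0 \<le> 2 * (P (G (lc t x)) \<bullet> P (lc t x))" using G_nonneg by simp
    qed (use that in auto)
    then show ?thesis by (simp add: inner_M lc0)
  qed
  define R where "R t = matrix_inv (M t)" for t
  have M_R: "M t *v (R t *v z) = z" and R_M: "R t *v (M t *v z) = z" if t: "t \<ge> 0" for t z
  proof -
    have "x = 0" if "M t *v x = 0" for x using coercive_M[OF t, of x] that by simp
    then have "invertible (M t)"
      using matrix_left_invertible_ker[of "M t"] invertible_left_inverse by blast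
    then show "M t *v (R t *v z) = z" "R t *v (M t *v z) = z"
      using someI_ex[of "\<lambda>B. M t ** B = mat 1 \<and> B ** M t = mat 1"]
      by (simp_all add: R_def matrix_vector_mul_assoc invertible_def matrix_inv_def)
  qed
  have R_bound: "norm (R t *v z) \<le> norm z" if t: "t \<ge> 0" for t z
  proof (cases "R t *v z = 0")
    case False
    have "(norm (R t *v z))\<^sup>2 \<le> (R t *v z) \<bullet> z" using coercive_M[OF t, of "R t *v z"] by (simp add: M_R t)
    also have "\<dots> \<le> norm (R t *v z) * norm z" by (rule norm_cauchy_schwarz)
    finally show ?thesis using False by (simp add: power2_eq_square)
  qed simp
  have M_cont: "continuous_on {0..} (\<lambda>t. M t *v y t)" if "continuous_on {0..} y" for y
    unfolding M_def matrix_vector_mult_def by (simp, intro continuous_intros Pw_cont that)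
  have N_cont: "continuous_on {0..} (\<lambda>t. N t *v y t)" if "continuous_on {0..} y" for y
    unfolding N_def matrix_vector_mult_def by (simp, intro continuous_intros Pw_cont PGw_cont that)
  \<comment> \<open>For \<open>z = R t *v y t\<close> one has
    \<open>R s *v y s - z = R s *v (y s - M s *v z)\<close>, and \<open>R s\<close> does not
    increase norms; continuity of the inverse is thus reduced to that of \<open>M\<close>.\<close>
  have R_cont: "continuous_on {0..} (\<lambda>t. R t *v y t)" if y: "continuous_on {0..} y" for y
    unfolding continuous_on_def
  proof
    fix t :: real assume "t \<in> {0..}"
    then have t: "t \<ge> 0" by simp
    define z where "z = R t *v y t"
    have "((\<lambda>s. R s *v y s - R t *v y t) \<longlongrightarrow> 0) (at t within {0..})"
    proof (rule Lim_null_comparison)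
      show "\<forall>\<^sub>F s in at t within {0..}. norm (R s *v y s - R t *v y t) \<le> norm (y s - M s *v z)"
        unfolding eventually_at_filter
      proof (rule always_eventually, intro allI impI)
        fix s :: real assume "s \<in> {0..}"
        then have s: "s \<ge> 0" by simp
        have "R s *v y s - R t *v y t = R s *v (y s - M s *v z)"
          by (simp add: matrix_vector_mult_diff_distrib R_M[OF s]) (simp add: z_def)
        then show "norm (R s *v y s - R t *v y t) \<le> norm (y s - M s *v z)"
          using R_bound[OF s] by simp
      qed
      have "continuous_on {0..} (\<lambda>s. norm (y s - M s *v z))"
        by (intro continuous_intros y M_cont)
      then have "((\<lambda>s. norm (y s - M s *v z)) \<longlongrightarrow> norm (y t - M t *v z)) (at t within {0..})"
        using t by (simp add: continuous_on_def)
      then show "((\<lambda>s. norm (y s - M s *v z)) \<longlongrightarrow> 0) (at t within {0..})"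
        by (simp add: z_def M_R[OF t])
    qed
    then show "((\<lambda>t. R t *v y t) \<longlongrightarrow> R t *v y t) (at t within {0..})"
      by (rule Lim_null[THEN iffD2])
  qed
  have "\<exists>q. q 0 = x0 \<and> (\<forall>t\<ge>0. (q has_vector_derivative - (R t *v (N t *v q t))) (at t within {0..}))" for x0
  \<comment> \<open>The sum of the absolute entries bounds the operator norm of \<open>N t\<close>
    and is visibly continuous; \<open>R t\<close> contributes at most a factor 1.\<close>
  proof (rule linear_ode_exists[where l="\<lambda>t. \<Sum>i\<in>UNIV. \<Sum>j\<in>UNIV. \<bar>N t $ i $ j\<bar>"])
    show "continuous_on {0..} (\<lambda>t. - (R t *v (N t *v x t)))" if "continuous_on {0..} x" for x
      by (intro continuous_on_minus R_cont N_cont that)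
    show "norm (- (R t *v (N t *v x)) - - (R t *v (N t *v y))) \<le> (\<Sum>i\<in>UNIV. \<Sum>j\<in>UNIV. \<bar>N t $ i $ j\<bar>) * norm (x - y)"
      if t: "t \<ge> 0" for t x y
    proof -
      have "- (R t *v (N t *v x)) - - (R t *v (N t *v y)) = R t *v (N t *v (y - x))"
        by (simp add: matrix_vector_mult_diff_distrib)
      then have "norm (- (R t *v (N t *v x)) - - (R t *v (N t *v y))) \<le> norm (N t *v (y - x))"
        using R_bound[OF t] by simp
      also have "\<dots> \<le> onorm ((*v) (N t)) * norm (y - x)"
        by (rule onorm[OF matrix_vector_mul_bounded_linear])
      also have "\<dots> \<le> (\<Sum>i\<in>UNIV. \<Sum>j\<in>UNIV. \<bar>N t $ i $ j\<bar>) * norm (y - x)"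
        by (intro mult_right_mono onorm_le_matrix_component_sum) simp
      finally show ?thesis by (simp add: norm_minus_commute)
    qed
    show "continuous_on {0..} (\<lambda>t. \<Sum>i\<in>UNIV. \<Sum>j\<in>UNIV. \<bar>N t $ i $ j\<bar>)"
      unfolding N_def by (simp, intro continuous_intros Pw_cont PGw_cont)
  qed (auto intro!: sum_nonneg)
  then have "\<forall>k. \<exists>q. q 0 = axis k 1 \<and>
      (\<forall>t\<ge>0. (q has_vector_derivative - (R t *v (N t *v q t))) (at t within {0..}))" by blast
  then obtain q where q0: "\<And>k. q k 0 = axis k 1"
    and q': "\<And>k t. t \<ge> 0 \<Longrightarrow> (q k has_vector_derivative - (R t *v (N t *v q k t))) (at t within {0..})"
    by metis
  define u where "u t k = lc t (q k t)" for t k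
  define z where "z t k = R t *v (N t *v q k t)" for t k
  have u': "((\<lambda>t. u t k) has_vector_derivative G (u t k) - lc t (z t k)) (at t within {0..})" if t: "t \<ge> 0" for t k
  proof -
    have "((\<lambda>t. q k t $ i) has_real_derivative - z t k $ i) (at t within {0..})" for i
      using bounded_linear.has_vector_derivative[OF bounded_linear_vec_nth q'[OF t], of k i]
      by (simp add: has_real_derivative_iff_has_vector_derivative z_def)
    then show ?thesis
      unfolding u_def lc_def G_sum
      by (auto intro!: derivative_eq_intros w'[OF t] simp: sum_subtractf[symmetric])
  qed
  \<comment> \<open>Since \<open>M z = N q\<close>, the vectors \<open>lc t (z t k)\<close> and
    \<open>G (u t k)\<close> have the same \<open>L\<^sup>2\<close> products with combinations of
    the \<open>w i t\<close>: the former is a projection of the latter onto their span. Hence the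
    velocity of \<open>u t k\<close> is orthogonal to the tuple, and the Gram matrix stays
    constant.\<close>
  have P_lc_z: "P (lc t (z t k)) \<bullet> P (u t l) = P (G (u t k)) \<bullet> P (u t l)" if t: "t \<ge> 0" for t k l
  proof -
    have "P (lc t (z t k)) \<bullet> P (u t l) = q l t \<bullet> (M t *v z t k)"
      by (simp add: u_def inner_M inner_commute)
    also have "\<dots> = P (G (u t k)) \<bullet> P (u t l)"
      by (simp add: z_def M_R[OF t] inner_N u_def G_sym[of "lc t (q l t)"]) (rule inner_commute)
    finally show ?thesis .
  qed
  have gram_u: "gram (u t) i j = (if i = j then 1 else 0)" if "t \<ge> 0" for t i j
  proof -
    have "((\<lambda>t. gram (u t) i j) has_real_derivative 0) (at t within {0..})" if "t \<ge> 0" for t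
      using has_real_derivative_P_inner[OF u'[OF that, of i] u'[OF that, of j]] P_lc_z[OF that, of i j]
        P_lc_z[OF that, of j i]
      by (simp add: gram_def P_diff inner_diff_left inner_diff_right inner_commute)
    then have "gram (u t) i j = gram (u 0) i j"
      using \<open>t \<ge> 0\<close> has_field_derivative_zero_constant[of "{0..}" "\<lambda>t. gram (u t) i j"]
      by (metis atLeast_iff convex_real_interval(1) order_refl)
    also have "u 0 = u0"
      by (simp add: fun_eq_iff u_def lc_def q0 w0 axis_def if_distrib[of "\<lambda>c. c *\<^sub>R _"] cong: if_cong)
    finally show ?thesis by (simp add: u0)
  qed
  \<comment> \<open>Orthonormality reads \<open>Q^T M Q = I\<close>; for square matrices this gives
    \<open>Q Q^T M = I\<close>, which expands \<open>z t k\<close> in the columns of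
    \<open>Q\<close> with coefficients \<open>q l t \<bullet> (N t *v q k t)\<close>, the entries of
    \<open>gramG\<close>. Here the linear matrix equation turns into the nonlinear flow.\<close>
  have lc_z: "lc t (z t k) = (\<Sum>l\<in>UNIV. gramG (u t) l k *\<^sub>R u t l)" if t: "t \<ge> 0" for t k
  proof -
    define Q :: "real^'n^'n" where "Q = (\<chi> i l. q l t $ i)"
    have Q_mult: "Q *v c = (\<Sum>l\<in>UNIV. c $ l *\<^sub>R q l t)" for c
      by (simp add: Q_def matrix_vector_mult_def vec_eq_iff sum_component mult.commute)
    have Q_transpose_mult: "(transpose Q *v m) $ l = q l t \<bullet> m" for m l
      by (simp add: Q_def transpose_def matrix_vector_mult_def inner_vec_def)
    have "((transpose Q ** M t) ** Q) *v c = c" for c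
    proof -
      have "(((transpose Q ** M t) ** Q) *v c) $ k = c $ k" for k
      proof -
        have "(((transpose Q ** M t) ** Q) *v c) $ k = q k t \<bullet> (M t *v (Q *v c))"
          by (simp only: Q_transpose_mult flip: matrix_vector_mul_assoc)
        also have "\<dots> = (\<Sum>l\<in>UNIV. c $ l * gram (u t) k l)"
          by (simp add: Q_mult linear_sum linear_cmul inner_sum_right inner_M gram_def u_def)
        also have "\<dots> = c $ k" by (simp add: gram_u[OF t] if_distrib cong: if_cong)
        finally show ?thesis .
      qed
      then show ?thesis by (simp add: vec_eq_iff)
    qed
    then have "(transpose Q ** M t) ** Q = mat 1"
      by (simp add: matrix_eq)
    then have "Q ** (transpose Q ** M t) = mat 1"
      by (simp add: matrix_left_right_inverse)
    then have "z t k = Q *v (transpose Q *v (M t *v z t k))"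
      by (simp only: matrix_vector_mul_assoc matrix_mul_assoc matrix_vector_mul_lid)
    also have "\<dots> = (\<Sum>l\<in>UNIV. (q l t \<bullet> (N t *v q k t)) *\<^sub>R q l t)"
      by (simp only: Q_mult Q_transpose_mult z_def M_R[OF t])
    also have "\<dots> = (\<Sum>l\<in>UNIV. gramG (u t) l k *\<^sub>R q l t)"
      by (simp add: inner_N gramG_def u_def)
    finally have "lc t (z t k) = lc t (\<Sum>l\<in>UNIV. gramG (u t) l k *\<^sub>R q l t)" by simp
    also have "\<dots> = (\<Sum>l\<in>UNIV. gramG (u t) l k *\<^sub>R u t l)"
      by (simp add: u_def linear_sum[OF lc_linear] linear_cmul[OF lc_linear])
    finally show ?thesis .
  qed
  have "flow_solution u"
    unfolding flow_solution_def
  proof (intro allI impI conjI)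
    fix t :: real and k assume t: "t \<ge> 0"
    show "u t k \<in> V" using wV[OF t] by (simp add: u_def lc_def)
    have "flow (u t) k = G (u t k) - lc t (z t k)"
      by (simp add: flow_def gram_u[OF t] lc_z[OF t] if_distrib[of "\<lambda>c. c *\<^sub>R _"] cong: if_cong)
    then show "((\<lambda>t. u t k) has_vector_derivative flow (u t) k) (at t within {0..})"
      using u'[OF t] by simp
  qed
  moreover have "u 0 = u0"
    by (simp add: fun_eq_iff u_def lc_def q0 w0 axis_def if_distrib[of "\<lambda>c. c *\<^sub>R _"] cong: if_cong)
  ultimately show ?thesis by blast
qed

end

section \<open>The evolution problem on a bounded domain\<close>

lemma has_vector_derivative_iff_quotient:
  fixes f :: "real \<Rightarrow> 'e::real_normed_vector"
  shows "(f has_vector_derivative D) (at t within S) \<longleftrightarrow>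
    ((\<lambda>s. (1 / (s - t)) *\<^sub>R (f s - f t) - D) \<longlongrightarrow> 0) (at t within S)"
proof -
  have "norm ((f s - f t) - (s - t) *\<^sub>R D) / norm (s - t) = norm ((1 / (s - t)) *\<^sub>R (f s - f t) - D)"
    if "s \<noteq> t" for s
  proof -
    have "(1 / (s - t)) *\<^sub>R (f s - f t) - D = (1 / (s - t)) *\<^sub>R ((f s - f t) - (s - t) *\<^sub>R D)"
      using that by (simp add: scaleR_diff_right)
    then show ?thesis by simp
  qed
  then have "((\<lambda>s. norm ((f s - f t) - (s - t) *\<^sub>R D) / norm (s - t)) \<longlongrightarrow> 0) (at t within S) \<longleftrightarrow>
      ((\<lambda>s. norm ((1 / (s - t)) *\<^sub>R (f s - f t) - D)) \<longlongrightarrow> 0) (at t within S)"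
    by (intro filterlim_cong refl) (auto simp: eventually_at_filter)
  then show ?thesis
    by (simp add: has_vector_derivative_def has_derivative_iff_norm bounded_linear_scaleR_left tendsto_norm_zero_iff)
qed

locale energy_domain = bounded_domain \<Omega> for \<Omega> :: "(real^'d::finite) set" +
  fixes \<V> :: "real^'d \<Rightarrow> real" and c1 c2 :: real
  assumes admissible: "admissible_potential \<Omega> \<V>"
    and c1: "c1 > 0"
    and energy_bounds: "\<And>u. u \<in> H10 \<Omega> \<Longrightarrow>
           c1 * (grad_norm \<Omega> u)\<^sup>2 \<le> energy_form \<Omega> \<V> u u \<and>
           energy_form \<Omega> \<V> u u \<le> c2 * (grad_norm \<Omega> u)\<^sup>2"
    and c2: "c2 > 0"
begin

lemma energy_sym: "u \<in> H10 \<Omega> \<Longrightarrow> v \<in> H10 \<Omega> \<Longrightarrow> energy_form \<Omega> \<V> u v = energy_form \<Omega> \<V> v u"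
  and energy_add: "u \<in> H10 \<Omega> \<Longrightarrow> v \<in> H10 \<Omega> \<Longrightarrow> w \<in> H10 \<Omega> \<Longrightarrow>
    energy_form \<Omega> \<V> (\<lambda>x. u x + v x) w = energy_form \<Omega> \<V> u w + energy_form \<Omega> \<V> v w"
  and energy_scale: "u \<in> H10 \<Omega> \<Longrightarrow> v \<in> H10 \<Omega> \<Longrightarrow>
    energy_form \<Omega> \<V> (\<lambda>x. r * u x) v = r * energy_form \<Omega> \<V> u v"
  using admissible by (auto simp: admissible_potential_def inner_product_on_H10_def)

text \<open>The classes of the chosen gradients are determined, so the integrands agree almost
  everywhere; admissibility provides their measurability. This is what makes \<open>energy\<close>
  independent of representatives.\<close>

lemma energy_cong:
  assumes u: "u \<in> H10 \<Omega>" "u' \<in> H10 \<Omega>" "h1_class u = h1_class u'" and v: "v \<in> H10 \<Omega>"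
  shows "energy_form \<Omega> \<V> u v = energy_form \<Omega> \<V> u' v"
  unfolding energy_form_def
proof (rule integral_cong_AE)
  show "energy_integrand \<Omega> \<V> u v \<in> borel_measurable (lebesgue_on \<Omega>)"
    "energy_integrand \<Omega> \<V> u' v \<in> borel_measurable (lebesgue_on \<Omega>)"
    using admissible u v by (auto simp: admissible_potential_def)
  have H1: "u \<in> H1 \<Omega>" "u' \<in> H1 \<Omega>" using u by (auto simp: H10_iff)
  have "AE x in lebesgue_on \<Omega>. u x = u' x"
    using u H1 by (simp add: h1_class_eq_iff ae_eq_def)
  moreover have "AE x in lebesgue_on \<Omega>. \<forall>i. grad \<Omega> u x $ i = grad \<Omega> u' x $ i"
  proof (rule eventually_all_finite)
    fix i
    have "l2_class (\<lambda>x. grad \<Omega> u x $ i) = l2_class (\<lambda>x. grad \<Omega> u' x $ i)"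
      using u(3) by (simp add: h1_class_def vec_eq_iff)
    then show "AE x in lebesgue_on \<Omega>. grad \<Omega> u x $ i = grad \<Omega> u' x $ i"
      using H1_D(3)[OF H1(1)] H1_D(3)[OF H1(2)] by (simp add: l2_class_eq_iff ae_eq_def)
  qed
  ultimately show "AE x in lebesgue_on \<Omega>. energy_integrand \<Omega> \<V> u v x = energy_integrand \<Omega> \<V> u' v x"
  proof eventually_elim
    case (elim x)
    then have "grad \<Omega> u x = grad \<Omega> u' x" by (simp add: vec_eq_iff)
    then show ?case using elim(1) by (simp add: energy_integrand_def)
  qed
qed

section \<open>Transport of the energy form and of the solution operator to the Hilbert
  space\<close>

definition h1rep :: "(real^'d) l2 \<times> (((real^'d) l2)^'d) \<Rightarrow> real^'d \<Rightarrow> real" where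
  "h1rep x = (SOME u. u \<in> H10 \<Omega> \<and> h1_class u = x)"

lemma h1rep:
  assumes "x \<in> H10_image"
  shows "h1rep x \<in> H10 \<Omega>" "h1_class (h1rep x) = x"
proof -
  have "\<exists>u. u \<in> H10 \<Omega> \<and> h1_class u = x" using H10_image_surj[OF assms] by blast
  from someI_ex[OF this] show "h1rep x \<in> H10 \<Omega>" "h1_class (h1rep x) = x"
    by (simp_all add: h1rep_def)
qed

definition energy where "energy x y = energy_form \<Omega> \<V> (h1rep x) (h1rep y)"

lemma energy_h1_class:
  assumes u: "u \<in> H10 \<Omega>" and v: "v \<in> H10 \<Omega>"
  shows "energy (h1_class u) (h1_class v) = energy_form \<Omega> \<V> u v"
proof -
  have uV: "h1_class u \<in> H10_image" and vV: "h1_class v \<in> H10_image" using u v by (auto simp: H10_iff)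
  note ru = h1rep[OF uV] and rv = h1rep[OF vV]
  have "energy (h1_class u) (h1_class v) = energy_form \<Omega> \<V> u (h1rep (h1_class v))"
    unfolding energy_def by (rule energy_cong[OF ru(1) u ru(2) rv(1)])
  also have "\<dots> = energy_form \<Omega> \<V> (h1rep (h1_class v)) u" by (rule energy_sym[OF u rv(1)])
  also have "\<dots> = energy_form \<Omega> \<V> v u" by (rule energy_cong[OF rv(1) v rv(2) u])
  also have "\<dots> = energy_form \<Omega> \<V> u v" by (rule energy_sym[OF v u])
  finally show ?thesis .
qed

text \<open>A fixed term for the constant is required because it occurs among the parameters of the
  \<open>sublocale\<close> below.\<close>

definition poincare_const where
  "poincare_const = (SOME C. C \<ge> 0 \<and> (\<forall>u\<in>H10 \<Omega>. (norm (h1_class u))\<^sup>2 \<le> (C + 1) * (grad_norm \<Omega> u)\<^sup>2))"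

lemma poincare_const:
  "poincare_const \<ge> 0" "u \<in> H10 \<Omega> \<Longrightarrow> (norm (h1_class u))\<^sup>2 \<le> (poincare_const + 1) * (grad_norm \<Omega> u)\<^sup>2"
proof -
  have "\<exists>C. C \<ge> 0 \<and> (\<forall>u\<in>H10 \<Omega>. (norm (h1_class u))\<^sup>2 \<le> (C + 1) * (grad_norm \<Omega> u)\<^sup>2)"
    by (rule H10_poincare) blast
  from someI_ex[OF this] show "poincare_const \<ge> 0"
    "u \<in> H10 \<Omega> \<Longrightarrow> (norm (h1_class u))\<^sup>2 \<le> (poincare_const + 1) * (grad_norm \<Omega> u)\<^sup>2"
    by (simp_all add: poincare_const_def)
qed

text \<open>\<open>energy_bounds\<close> controls the gradient only: division by
  \<open>poincare_const + 1\<close> passes to the full norm, while \<open>c2\<close> is kept above,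
  the gradient being a part of that norm.\<close>

sublocale energy_space H10_image fst energy "c1 / (poincare_const + 1)" c2
proof (rule energy_space.intro)
  show "bounded_linear fst" by (rule bounded_linear_fst)
  show "subspace H10_image" by (rule subspace_H10_image)
  show "closed H10_image" by (simp add: H10_image_def)
  show "c1 / (poincare_const + 1) > 0" using c1 poincare_const(1) by simp
  fix x y z and r :: real
  assume x: "x \<in> H10_image"
  obtain u where u: "u \<in> H10 \<Omega>" "x = h1_class u" using H10_image_surj[OF x] by blast
  have H1: "u \<in> H1 \<Omega>" using u by (simp add: H10_iff)
  have "c1 * (norm x)\<^sup>2 \<le> c1 * ((poincare_const + 1) * (grad_norm \<Omega> u)\<^sup>2)"
    using poincare_const(2)[OF u(1)] c1 by (simp add: u)
  also have "\<dots> \<le> (poincare_const + 1) * energy x x"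
    using energy_bounds[OF u(1)] poincare_const(1) by (simp add: u energy_h1_class mult.left_commute)
  finally show "c1 / (poincare_const + 1) * (norm x)\<^sup>2 \<le> energy x x"
    using poincare_const(1) by (simp add: field_simps)
  have "(grad_norm \<Omega> u)\<^sup>2 \<le> (norm x)\<^sup>2"
    using norm_grad[OF H1] by (simp add: u norm_prod_def)
  then show "energy x x \<le> c2 * (norm x)\<^sup>2"
    using energy_bounds[OF u(1)] c2 by (simp add: u energy_h1_class) (meson mult_left_mono order_trans less_imp_le)
  assume y: "y \<in> H10_image"
  obtain v where v: "v \<in> H10 \<Omega>" "y = h1_class v" using H10_image_surj[OF y] by blast
  show "energy x y = energy y x" using u v by (simp add: energy_h1_class energy_sym)
  show "energy (r *\<^sub>R x) y = r * energy x y"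
    using u v energy_h1_class[OF H10_scale(1)[OF u(1)] v(1)] by (simp add: energy_h1_class energy_scale H10_scale)
  assume z: "z \<in> H10_image"
  obtain w where w: "w \<in> H10 \<Omega>" "z = h1_class w" using H10_image_surj[OF z] by blast
  show "energy (x + y) z = energy x z + energy y z"
    using u v w energy_h1_class[OF H10_add(1)[OF u(1) v(1)] w(1)] by (simp add: energy_h1_class energy_add H10_add)
qed

lemma fst_inner:
  assumes "u \<in> H10 \<Omega>" "v \<in> H10 \<Omega>"
  shows "fst (h1_class u) \<bullet> fst (h1_class v) = L2_inner \<Omega> u v"
  using assms H1_D(1) by (simp add: h1_class_def l2_class_inner H10_iff)

text \<open>A representative of \<open>G (h1_class u)\<close> solves the variational equation, so
  \<open>SOME\<close> returns a solution; the equation fixes its class, whichever function is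
  returned.\<close>

lemma solution_op:
  assumes u: "u \<in> H10 \<Omega>"
  shows "solution_op \<Omega> \<V> (L2_inner \<Omega> u) \<in> H10 \<Omega>"
    "h1_class (solution_op \<Omega> \<V> (L2_inner \<Omega> u)) = G (h1_class u)"
proof -
  define w where "w = solution_op \<Omega> \<V> (L2_inner \<Omega> u)"
  have "\<exists>w. w \<in> H10 \<Omega> \<and> (\<forall>v\<in>H10 \<Omega>. energy_form \<Omega> \<V> w v = L2_inner \<Omega> u v)"
  proof (intro exI conjI ballI)
    show "h1rep (G (h1_class u)) \<in> H10 \<Omega>" by (rule h1rep[OF G(1)])
    fix v assume v: "v \<in> H10 \<Omega>"
    have "energy_form \<Omega> \<V> (h1rep (G (h1_class u))) v = energy (G (h1_class u)) (h1_class v)"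
      using energy_h1_class[OF h1rep(1)[OF G(1)] v, of "h1_class u"] by (simp add: h1rep[OF G(1)])
    also have "\<dots> = L2_inner \<Omega> u v" using G(2)[of "h1_class v"] v u by (simp add: H10_iff fst_inner)
    finally show "energy_form \<Omega> \<V> (h1rep (G (h1_class u))) v = L2_inner \<Omega> u v" .
  qed
  from someI_ex[OF this]
  have w: "w \<in> H10 \<Omega>" "\<And>v. v \<in> H10 \<Omega> \<Longrightarrow> energy_form \<Omega> \<V> w v = L2_inner \<Omega> u v"
    by (auto simp: w_def solution_op_def)
  then show "solution_op \<Omega> \<V> (L2_inner \<Omega> u) \<in> H10 \<Omega>" by (simp add: w_def)
  have "G (h1_class u) = h1_class w"
  proof (rule G_eqI)
    show "h1_class w \<in> H10_image" using w(1) by (simp add: H10_iff)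
    fix y assume "y \<in> H10_image"
    then obtain v where v: "v \<in> H10 \<Omega>" "y = h1_class v" using H10_image_surj by blast
    then show "energy (h1_class w) y = fst (h1_class u) \<bullet> fst y" using w u by (simp add: energy_h1_class fst_inner)
  qed
  then show "h1_class (solution_op \<Omega> \<V> (L2_inner \<Omega> u)) = G (h1_class u)" by (simp add: w_def)
qed

lemma flow_rhs:
  assumes U: "U \<in> H10_tuples \<Omega>"
  shows "flow_rhs \<Omega> \<V> U k \<in> H10 \<Omega>" "h1_class (flow_rhs \<Omega> \<V> U k) = flow (\<lambda>i. h1_class (U i)) k"
proof -
  have Ui: "U i \<in> H10 \<Omega>" for i using U by (simp add: H10_tuples_def)
  define GU where "GU = solution_op_tuple \<Omega> \<V> U"
  have GU: "GU i \<in> H10 \<Omega>" "h1_class (GU i) = G (h1_class (U i))" for i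
    using solution_op[OF Ui] by (auto simp: GU_def solution_op_tuple_def)
  have eq: "flow_rhs \<Omega> \<V> U k = (\<lambda>x. (\<Sum>i\<in>UNIV. GU i x * outer \<Omega> U U $ i $ k) - (\<Sum>i\<in>UNIV. U i x * outer \<Omega> GU U $ i $ k))"
    by (simp add: flow_rhs_def Let_def tuple_mult_def flip: GU_def)
  have grams: "gram (\<lambda>i. h1_class (U i)) i k = outer \<Omega> U U $ i $ k"
    "gramG (\<lambda>i. h1_class (U i)) i k = outer \<Omega> GU U $ i $ k" for i
    by (simp_all add: gram_def gramG_def outer_def GU(2)[symmetric] fst_inner Ui GU(1))
  note sums = H10_sum[where A=UNIV and u=GU, OF finite GU(1)] H10_sum[where A=UNIV and u=U, OF finite Ui]
  show "flow_rhs \<Omega> \<V> U k \<in> H10 \<Omega>"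
    unfolding eq using sums by (intro H10_diff) auto
  have "h1_class (flow_rhs \<Omega> \<V> U k) =
      (\<Sum>i\<in>UNIV. (outer \<Omega> U U $ i $ k) *\<^sub>R h1_class (GU i)) -
      (\<Sum>i\<in>UNIV. (outer \<Omega> GU U $ i $ k) *\<^sub>R h1_class (U i))"
    unfolding eq using sums by (subst H10_diff) auto
  also have "\<dots> = flow (\<lambda>i. h1_class (U i)) k"
    by (simp add: flow_def GU(2) grams)
  finally show "h1_class (flow_rhs \<Omega> \<V> U k) = flow (\<lambda>i. h1_class (U i)) k" .
qed

section \<open>Curves of tuples as curves in the Hilbert space\<close>

lemma tuple_norm_tendsto_0:
  fixes f :: "'a \<Rightarrow> ('d, 'n::finite) tuple"
  assumes "\<forall>\<^sub>F s in F. \<forall>k. f s k \<in> H10 \<Omega>"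
  shows "((\<lambda>s. tuple_norm \<Omega> (f s)) \<longlongrightarrow> 0) F \<longleftrightarrow> (\<forall>k. ((\<lambda>s. h1_class (f s k)) \<longlongrightarrow> 0) F)"
proof
  assume lim: "((\<lambda>s. tuple_norm \<Omega> (f s)) \<longlongrightarrow> 0) F"
  show "\<forall>k. ((\<lambda>s. h1_class (f s k)) \<longlongrightarrow> 0) F"
  proof (rule allI, rule Lim_null_comparison[OF _ lim])
    fix k
    show "\<forall>\<^sub>F s in F. norm (h1_class (f s k)) \<le> tuple_norm \<Omega> (f s)"
      using assms
    proof eventually_elim
      case (elim s)
      have "(H1_norm \<Omega> (f s k))\<^sup>2 \<le> (\<Sum>k\<in>UNIV. (H1_norm \<Omega> (f s k))\<^sup>2)"
        by (rule member_le_sum[of k UNIV "\<lambda>k. (H1_norm \<Omega> (f s k))\<^sup>2"]) auto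
      then show ?case
        using elim by (simp add: tuple_norm_def norm_h1_class H10_iff real_le_rsqrt)
    qed
  qed
next
  assume lim: "\<forall>k. ((\<lambda>s. h1_class (f s k)) \<longlongrightarrow> 0) F"
  have "((\<lambda>s. sqrt (\<Sum>k\<in>UNIV. (norm (h1_class (f s k)))\<^sup>2)) \<longlongrightarrow>
      sqrt (\<Sum>k\<in>(UNIV::'n set). (norm (0 :: (real^'d) l2 \<times> (((real^'d) l2)^'d)))\<^sup>2)) F"
    using lim by (intro tendsto_intros) auto
  then have "((\<lambda>s. sqrt (\<Sum>k\<in>UNIV. (norm (h1_class (f s k)))\<^sup>2)) \<longlongrightarrow> 0) F" by simp
  moreover have "\<forall>\<^sub>F s in F. sqrt (\<Sum>k\<in>UNIV. (norm (h1_class (f s k)))\<^sup>2) = tuple_norm \<Omega> (f s)"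
    using assms by eventually_elim (simp add: tuple_norm_def norm_h1_class H10_iff)
  ultimately show "((\<lambda>s. tuple_norm \<Omega> (f s)) \<longlongrightarrow> 0) F" by (rule Lim_transform_eventually)
qed

text \<open>On \<open>H10\<close> the tuple norm is computed from the norms of the classes, so
  limits can be read off componentwise in the Hilbert space. If a curve leaves \<open>H10\<close> at
  some time, both sides fail.\<close>

lemma C1_curve_iff:
  fixes U U' :: "real \<Rightarrow> ('d, 'n::finite) tuple"
  shows "C1_curve \<Omega> U U' \<longleftrightarrow> (\<forall>t\<ge>0. \<forall>k. U t k \<in> H10 \<Omega> \<and> U' t k \<in> H10 \<Omega> \<and>
    ((\<lambda>t. h1_class (U t k)) has_vector_derivative h1_class (U' t k)) (at t within {0..}) \<and>
    ((\<lambda>s. h1_class (U' s k)) \<longlongrightarrow> h1_class (U' t k)) (at t within {0..}))"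
proof (cases "\<forall>t\<ge>0. U t \<in> H10_tuples \<Omega> \<and> U' t \<in> H10_tuples \<Omega>")
  case True
  then have U: "U t k \<in> H10 \<Omega>" "U' t k \<in> H10 \<Omega>" if "t \<ge> 0" for t k
    using that by (auto simp: H10_tuples_def)
  have quotient: "(\<lambda>x. (U s k x - U t k x) / (s - t) - U' t k x) \<in> H10 \<Omega>"
    "h1_class (\<lambda>x. (U s k x - U t k x) / (s - t) - U' t k x) =
      (1 / (s - t)) *\<^sub>R (h1_class (U s k) - h1_class (U t k)) - h1_class (U' t k)"
    if "s \<ge> 0" "t \<ge> 0" for s t k
  proof -
    note d = H10_diff[OF U(1)[OF that(1), of k] U(1)[OF that(2), of k]]
    note q = H10_diff[OF H10_scale(1)[OF d(1), of "1 / (s - t)"] U(2)[OF that(2), of k]]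
    show "(\<lambda>x. (U s k x - U t k x) / (s - t) - U' t k x) \<in> H10 \<Omega>" using q(1) by simp
    show "h1_class (\<lambda>x. (U s k x - U t k x) / (s - t) - U' t k x) =
      (1 / (s - t)) *\<^sub>R (h1_class (U s k) - h1_class (U t k)) - h1_class (U' t k)"
      using q(2) H10_scale(2)[OF d(1), of "1 / (s - t)"] d(2) by simp
  qed
  have nonneg: "\<forall>\<^sub>F s in at t within {0..}. s \<ge> 0" for t :: real
    by (simp add: eventually_at_filter)
  have deriv: "((\<lambda>s. tuple_norm \<Omega> (\<lambda>k x. (U s k x - U t k x) / (s - t) - U' t k x)) \<longlongrightarrow> 0) (at t within {0..})
      \<longleftrightarrow> (\<forall>k. ((\<lambda>t. h1_class (U t k)) has_vector_derivative h1_class (U' t k)) (at t within {0..}))" if t: "t \<ge> 0" for t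
  proof -
    have "((\<lambda>s. tuple_norm \<Omega> (\<lambda>k x. (U s k x - U t k x) / (s - t) - U' t k x)) \<longlongrightarrow> 0) (at t within {0..})
      \<longleftrightarrow> (\<forall>k. ((\<lambda>s. h1_class (\<lambda>x. (U s k x - U t k x) / (s - t) - U' t k x)) \<longlongrightarrow> 0) (at t within {0..}))"
      by (rule tuple_norm_tendsto_0) (use nonneg in \<open>eventually_elim, simp add: quotient t\<close>)
    also have "\<dots> \<longleftrightarrow>
        (\<forall>k. ((\<lambda>s. (1 / (s - t)) *\<^sub>R (h1_class (U s k) - h1_class (U t k)) - h1_class (U' t k)) \<longlongrightarrow> 0) (at t within {0..}))"
      by (intro all_cong1 filterlim_cong refl) (use nonneg in \<open>eventually_elim, simp add: quotient t\<close>)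
    finally show ?thesis by (simp add: has_vector_derivative_iff_quotient)
  qed
  have cont: "((\<lambda>s. tuple_norm \<Omega> (\<lambda>k x. U' s k x - U' t k x)) \<longlongrightarrow> 0) (at t within {0..})
      \<longleftrightarrow> (\<forall>k. ((\<lambda>s. h1_class (U' s k)) \<longlongrightarrow> h1_class (U' t k)) (at t within {0..}))" if t: "t \<ge> 0" for t
  proof -
    have "((\<lambda>s. tuple_norm \<Omega> (\<lambda>k x. U' s k x - U' t k x)) \<longlongrightarrow> 0) (at t within {0..})
      \<longleftrightarrow> (\<forall>k. ((\<lambda>s. h1_class (\<lambda>x. U' s k x - U' t k x)) \<longlongrightarrow> 0) (at t within {0..}))"
      by (rule tuple_norm_tendsto_0) (use nonneg in \<open>eventually_elim, simp add: H10_diff U t\<close>)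
    also have "\<dots> \<longleftrightarrow> (\<forall>k. ((\<lambda>s. h1_class (U' s k) - h1_class (U' t k)) \<longlongrightarrow> 0) (at t within {0..}))"
      by (intro all_cong1 filterlim_cong refl) (use nonneg in \<open>eventually_elim, simp add: H10_diff U t\<close>)
    finally show ?thesis by (simp add: Lim_null[symmetric])
  qed
  show ?thesis
    using True deriv cont U unfolding C1_curve_def by blast
next
  case False
  then show ?thesis unfolding C1_curve_def H10_tuples_def by blast
qed

lemma global_solution_imp_flow_solution:
  assumes U0: "U0 \<in> H10_tuples \<Omega>" and sol: "global_solution \<Omega> \<V> U0 U"
  shows "flow_solution (\<lambda>t k. h1_class (U t k))" "h1_class (U 0 k) = h1_class (U0 k)" "t \<ge> 0 \<Longrightarrow> U t k \<in> H10 \<Omega>"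
proof -
  obtain U' where U': "C1_curve \<Omega> U U'" "\<And>t. t \<ge> 0 \<Longrightarrow> tuple_ae_eq \<Omega> (U' t) (flow_rhs \<Omega> \<V> (U t))"
    using sol by (auto simp: global_solution_def)
  have U: "U t k \<in> H10 \<Omega>" "U' t k \<in> H10 \<Omega>" if "t \<ge> 0" for t k
    using U'(1) that by (auto simp: C1_curve_iff)
  show "t \<ge> 0 \<Longrightarrow> U t k \<in> H10 \<Omega>" by (rule U)
  show "h1_class (U 0 k) = h1_class (U0 k)"
    using sol U(1)[of 0 k] U0
    by (subst h1_class_eq_iff) (auto simp: global_solution_def tuple_ae_eq_def H10_tuples_def H10_iff)
  show "flow_solution (\<lambda>t k. h1_class (U t k))"
    unfolding flow_solution_def
  proof (intro allI impI conjI)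
    fix t :: real and k assume t: "t \<ge> 0"
    show "h1_class (U t k) \<in> H10_image" using U[OF t] by (simp add: H10_iff)
    have Ut: "U t \<in> H10_tuples \<Omega>" using U[OF t] by (simp add: H10_tuples_def)
    have eq: "h1_class (U' t k) = h1_class (flow_rhs \<Omega> \<V> (U t) k)"
      using U'(2)[OF t] U(2)[OF t] flow_rhs(1)[OF Ut]
      by (subst h1_class_eq_iff) (auto simp: tuple_ae_eq_def H10_iff)
    have "((\<lambda>t. h1_class (U t k)) has_vector_derivative h1_class (U' t k)) (at t within {0..})"
      using U'(1) t by (simp add: C1_curve_iff)
    then show "((\<lambda>t. h1_class (U t k)) has_vector_derivative flow (\<lambda>k. h1_class (U t k)) k) (at t within {0..})"
      by (simp only: eq flow_rhs(2)[OF Ut])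
  qed
qed

lemma gram_orthonormal:
  assumes "U0 \<in> orthonormal_tuples \<Omega>"
  shows "gram (\<lambda>k. h1_class (U0 k)) i j = (if i = j then 1 else 0)"
proof -
  have "U0 k \<in> H10 \<Omega>" for k using assms by (simp add: orthonormal_tuples_def H10_tuples_def)
  then have "gram (\<lambda>k. h1_class (U0 k)) i j = outer \<Omega> U0 U0 $ i $ j"
    by (simp add: gram_def outer_def fst_inner)
  also have "outer \<Omega> U0 U0 = mat 1" using assms by (simp add: orthonormal_tuples_def)
  finally show ?thesis by (simp add: mat_def)
qed

lemma global_solution_exists:
  fixes U0 :: "('d, 'n::finite) tuple"
  assumes U0: "U0 \<in> orthonormal_tuples \<Omega>"
  shows "\<exists>U. global_solution \<Omega> \<V> U0 U"
proof -
  have U0k: "U0 k \<in> H10 \<Omega>" for k using U0 by (simp add: orthonormal_tuples_def H10_tuples_def)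
  obtain u where u: "u 0 = (\<lambda>k. h1_class (U0 k))" "flow_solution u"
    using flow_solution_exists[of "\<lambda>k. h1_class (U0 k)"] gram_orthonormal[OF U0] U0k
    by (auto simp: H10_iff)
  have uV: "u t k \<in> H10_image" and u': "((\<lambda>t. u t k) has_vector_derivative flow (u t) k) (at t within {0..})"
    if "t \<ge> 0" for t k
    using u(2) that by (auto simp: flow_solution_def)
  define U where "U t k = h1rep (u t k)" for t k
  have U: "U t k \<in> H10 \<Omega>" "h1_class (U t k) = u t k" if "t \<ge> 0" for t k
    using h1rep[OF uV[OF that]] by (auto simp: U_def)
  have Ut: "U t \<in> H10_tuples \<Omega>" if "t \<ge> 0" for t using U[OF that] by (simp add: H10_tuples_def)
  have rhs: "h1_class (flow_rhs \<Omega> \<V> (U t) k) = flow (u t) k" if "t \<ge> 0" for t k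
    using flow_rhs(2)[OF Ut[OF that]] U(2)[OF that] by simp
  have nonneg: "\<forall>\<^sub>F s in at t within {0..}. s \<ge> 0" for t :: real
    by (simp add: eventually_at_filter)
  \<comment> \<open>The right-hand side itself serves as the derivative, so the equation holds by
    reflexivity and only its class has to be identified with \<open>flow\<close>.\<close>
  have "C1_curve \<Omega> U (\<lambda>t. flow_rhs \<Omega> \<V> (U t))"
    unfolding C1_curve_iff
  proof (intro allI impI conjI)
    fix t :: real and k assume t: "t \<ge> 0"
    show "U t k \<in> H10 \<Omega>" by (rule U[OF t])
    show "flow_rhs \<Omega> \<V> (U t) k \<in> H10 \<Omega>" by (rule flow_rhs[OF Ut[OF t]])
    show "((\<lambda>t. h1_class (U t k)) has_vector_derivative h1_class (flow_rhs \<Omega> \<V> (U t) k)) (at t within {0..})"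
      unfolding rhs[OF t]
      by (rule has_vector_derivative_transform[OF _ _ u'[OF t]]) (use t U in auto)
    have "continuous_on {0..} (\<lambda>t. u t k)" for k
      using u' by (auto simp: continuous_on_eq_continuous_within intro: has_vector_derivative_continuous)
    then have "continuous_on {0..} (\<lambda>t. flow (u t) k)" by (rule continuous_on_flow)
    then have "((\<lambda>s. flow (u s) k) \<longlongrightarrow> flow (u t) k) (at t within {0..})"
      using t by (simp add: continuous_on_def)
    then show "((\<lambda>s. h1_class (flow_rhs \<Omega> \<V> (U s) k)) \<longlongrightarrow> h1_class (flow_rhs \<Omega> \<V> (U t) k)) (at t within {0..})"
      unfolding rhs[OF t]
      by (rule Lim_transform_eventually) (use nonneg in \<open>eventually_elim, simp add: rhs\<close>)
  qed
  moreover have "tuple_ae_eq \<Omega> (U 0) U0"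
    unfolding tuple_ae_eq_def
  proof
    fix k
    have "h1_class (U 0 k) = h1_class (U0 k)" using U(2)[of 0 k] u(1) by simp
    then show "ae_eq \<Omega> (U 0 k) (U0 k)"
      using U(1)[of 0 k] U0k[of k] by (simp add: h1_class_eq_iff H10_iff)
  qed
  ultimately have "global_solution \<Omega> \<V> U0 U"
    by (auto simp: global_solution_def tuple_ae_eq_def ae_eq_def)
  then show ?thesis by blast
qed

lemma global_solution_unique:
  assumes U0: "U0 \<in> orthonormal_tuples \<Omega>"
    and U: "global_solution \<Omega> \<V> U0 U" and W: "global_solution \<Omega> \<V> U0 W" and t: "t \<ge> 0"
  shows "tuple_ae_eq \<Omega> (U t) (W t)"
  unfolding tuple_ae_eq_def
proof
  fix k
  have H10: "U0 \<in> H10_tuples \<Omega>" using U0 by (simp add: orthonormal_tuples_def)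
  note u = global_solution_imp_flow_solution[OF H10 U] and w = global_solution_imp_flow_solution[OF H10 W]
  \<comment> \<open>The \<open>L\<^sup>2\<close> components alone decide equality almost
    everywhere.\<close>
  have "fst (h1_class (U t k)) = fst (h1_class (W t k))"
    using flow_solution_unique[OF u(1) w(1) _ _ t, of k] u(2) w(2) gram_orthonormal[OF U0] by simp
  then show "ae_eq \<Omega> (U t k) (W t k)"
    using u(3)[OF t, of k] w(3)[OF t, of k] H1_D(1) by (simp add: h1_class_def l2_class_eq_iff H10_iff)
qed

end

theorem theorem3p9:
  fixes \<Omega> :: "(real^'d::finite) set"
    and \<V> :: "real^'d \<Rightarrow> real"
    and c1 c2 :: real
    and U0 :: "('d, 'n::finite) tuple"
  assumes "open \<Omega>" "connected \<Omega>" "\<Omega> \<noteq> {}" "bounded \<Omega>"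
    and "admissible_potential \<Omega> \<V>"
    and "c1 > 0" "c2 > 0"
    and "\<And>u. u \<in> H10 \<Omega> \<Longrightarrow>
           c1 * (grad_norm \<Omega> u)\<^sup>2 \<le> energy_form \<Omega> \<V> u u \<and>
           energy_form \<Omega> \<V> u u \<le> c2 * (grad_norm \<Omega> u)\<^sup>2"
    and "U0 \<in> orthonormal_tuples \<Omega>"
  shows "(\<exists>U. global_solution \<Omega> \<V> U0 U) \<and>
         (\<forall>U W. global_solution \<Omega> \<V> U0 U \<longrightarrow> global_solution \<Omega> \<V> U0 W \<longrightarrow>
            (\<forall>t\<ge>0. tuple_ae_eq \<Omega> (U t) (W t)))"
proof -
  interpret energy_domain \<Omega> \<V> c1 c2
    by unfold_locales (use assms in auto)
  show ?thesis
    using global_solution_exists[OF assms(9)] global_solution_unique[OF assms(9)] by blast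
qed

end
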